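(* Let $\mathcal K$ be a triangulated category, $\mathcal E$ a Frobenius class of triangles in $\mathcal K$, and $\pi\colon\mathcal K\to\underline{\mathcal K}_{\mathcal E}$ the additive quotient functor to the relative stable category. Then $\pi$ is exact if and only if it is a localization. In that case, and if $\mathcal K$ is idempotent-complete, then $\pi$ is the projection of $\mathcal K$ onto a direct summand, i.e. $\mathcal K=\mathcal J\oplus\mathcal J'$ where $\mathcal J=\operatorname{proj}(\mathcal E)$ and $\mathcal J'\cong\underline{\mathcal K}_{\mathcal E}$ are orthogonal subcategories of $\mathcal K$, both ways: $\mathcal K(\mathcal J,\mathcal J')=0=\mathcal K(\mathcal J',\mathcal J)$.
   Context: Standing assumption: $\mathcal K$ is essentially small, with suspension $\Sigma$. Subcategories are full and replete. A functor between triangulated categories is a localization if it is (up to exact equivalence of its target) the Verdier quotient functor by a thick subcategory. Let $\mathcal E$ be a family of distinguished triangles $X\xrightarrow{f}Y\xrightarrow{g}Z\xrightarrow{h}\Sigma X$ in $\mathcal K$; for a triangle in $\mathcal E$ one calls $f$ an $\mathcal E$-monomorphism, $g$ an $\mathcal E$-epimorphism and $h$ an $\mathcal E$-phantom. $\mathcal E$ is a proper class of triangles if it is closed under isomorphisms, suspension (triple rotation), finite sums and retracts; contains all triangles $X\xrightarrow{\mathrm{id}}X\to0\to\Sigma X$ and $0\to Y\xrightarrow{\mathrm{id}}Y\to0$; $\mathcal E$-monomorphisms are closed under homotopy pushouts and $\mathcal E$-epimorphisms under homotopy pullbacks (along arbitrary morphisms); and $\mathcal E$ is saturated: if the homotopy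 pullback of a morphism $g$ along an $\mathcal E$-epimorphism is an $\mathcal E$-epimorphism, then $g$ is an $\mathcal E$-epimorphism. An object $P$ is $\mathcal E$-projective if $0\to\mathcal K(P,X)\to\mathcal K(P,Y)\to\mathcal K(P,Z)\to0$ is exact for every triangle in $\mathcal E$; $\mathcal E$-injectives are defined dually; $\operatorname{proj}(\mathcal E)$ and $\operatorname{inj}(\mathcal E)$ denote the classes of these. $\mathcal E$ has enough projectives (injectives) if every $X$ admits an $\mathcal E$-epimorphism $P\to X$ with $P\in\operatorname{proj}(\mathcal E)$ (an $\mathcal E$-monomorphism $X\to I$ with $I\in\operatorname{inj}(\mathcal E)$). $\mathcal E$ is Frobenius if it is a proper class with enough projectives, enough injectives and $\operatorname{proj}(\mathcal E)=\operatorname{inj}(\mathcal E)$. For $\mathcal E$ Frobenius, the relative stable category is the additive quotient $\pi\colon\mathcal K\to\underline{\mathcal K}_{\mathcal E}=\mathcal K/\operatorname{proj}(\mathcal E)$ (same objects, morphisms modulo those factoring through an object of $\operatorname{proj}(\mathcal E)$). It is triangulated (Beligiannis): for each $X$ choose an $\mathcal E$-monomorphism $i_X\colon X\to X_{\mathcal E}$ with $X_{\mathcal E}\in\operatorname{inj}(\mathcal E)$ and a distinguished triangle $X\xrightarrow{i_X}X_{\mathcal E}\to X'\to\Sigma X$, and set $\Sigma_{\mathcal E}X=\pi(X')$. For $f\colon X\to Y$ in $\mathcal K$ form the homotopy pushout $Z$ of $X_{\mathcal E}\leftarrow X\xrightarrow{f}Y$ and the induced map from $X\to X_{\mathcal E}\to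 X'\to\Sigma X$ to the distinguished triangle $Y\xrightarrow{g}Z\xrightarrow{h}X'\to\Sigma Y$ which is the identity on $X'$; the distinguished triangles in $\underline{\mathcal K}_{\mathcal E}$ are those isomorphic to some $X\xrightarrow{\pi f}Y\xrightarrow{\pi g}Z\xrightarrow{\pi h}\Sigma_{\mathcal E}X$. *)

theory Defs
  imports "HOL-Algebra.Group"
begin

section \<open>Categories and functors\<close>

text \<open>Every arrow carries its domain and codomain, so hom-sets are disjoint. As objects and arrows
  form HOL sets, every category is small; this replaces "essentially small".\<close>

record ('o, 'm) cat =
  Obj :: "'o set"
  Arr :: "'m set"
  Dom :: "'m \<Rightarrow> 'o"
  Cod :: "'m \<Rightarrow> 'o"
  Id :: "'o \<Rightarrow> 'm"
  Comp :: "'m \<Rightarrow> 'm \<Rightarrow> 'm" (infixl "\<cdot>\<index>" 70)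

definition Hom :: "('o, 'm, 'z) cat_scheme \<Rightarrow> 'o \<Rightarrow> 'o \<Rightarrow> 'm set" where
  "Hom C X Y = {f \<in> Arr C. Dom C f = X \<and> Cod C f = Y}"

locale category =
  fixes C :: "('o, 'm, 'z) cat_scheme" (structure)
  assumes dom_in: "f \<in> Arr C \<Longrightarrow> Dom C f \<in> Obj C"
    and cod_in: "f \<in> Arr C \<Longrightarrow> Cod C f \<in> Obj C"
    and id_in: "X \<in> Obj C \<Longrightarrow> Id C X \<in> Hom C X X"
    and comp_in: "\<lbrakk>f \<in> Hom C X Y; g \<in> Hom C Y Z\<rbrakk> \<Longrightarrow> g \<cdot> f \<in> Hom C X Z"
    and comp_assoc: "\<lbrakk>f \<in> Hom C W X; g \<in> Hom C X Y; h \<in> Hom C Y Z\<rbrakk> \<Longrightarrow> h \<cdot> (g \<cdot> f) = (h \<cdot> g) \<cdot> f"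
    and id_left: "f \<in> Hom C X Y \<Longrightarrow> Id C Y \<cdot> f = f"
    and id_right: "f \<in> Hom C X Y \<Longrightarrow> f \<cdot> Id C X = f"

definition is_iso :: "('o, 'm, 'z) cat_scheme \<Rightarrow> 'm \<Rightarrow> bool" where
  "is_iso C f \<longleftrightarrow> f \<in> Arr C \<and> (\<exists>g \<in> Hom C (Cod C f) (Dom C f).
     g \<cdot>\<^bsub>C\<^esub> f = Id C (Dom C f) \<and> f \<cdot>\<^bsub>C\<^esub> g = Id C (Cod C f))"

definition isomorphic :: "('o, 'm, 'z) cat_scheme \<Rightarrow> 'o \<Rightarrow> 'o \<Rightarrow> bool" where
  "isomorphic C X Y \<longleftrightarrow> (\<exists>f \<in> Hom C X Y. is_iso C f)"

definition is_retract :: "('o, 'm, 'z) cat_scheme \<Rightarrow> 'o \<Rightarrow> 'o \<Rightarrow> bool" where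
  "is_retract C X Y \<longleftrightarrow> (\<exists>s \<in> Hom C X Y. \<exists>r \<in> Hom C Y X. r \<cdot>\<^bsub>C\<^esub> s = Id C X)"

definition idempotent_complete :: "('o, 'm, 'z) cat_scheme \<Rightarrow> bool" where
  "idempotent_complete C \<longleftrightarrow> (\<forall>X \<in> Obj C. \<forall>e \<in> Hom C X X. e \<cdot>\<^bsub>C\<^esub> e = e \<longrightarrow>
     (\<exists>Y \<in> Obj C. \<exists>r \<in> Hom C X Y. \<exists>s \<in> Hom C Y X. r \<cdot>\<^bsub>C\<^esub> s = Id C Y \<and> s \<cdot>\<^bsub>C\<^esub> r = e))"

record ('o, 'm, 'p, 'n) fnctr =
  FObj :: "'o \<Rightarrow> 'p"
  FArr :: "'m \<Rightarrow> 'n"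

definition is_functor ::
  "('o, 'm, 'z) cat_scheme \<Rightarrow> ('p, 'n, 'y) cat_scheme \<Rightarrow> ('o, 'm, 'p, 'n) fnctr \<Rightarrow> bool" where
  "is_functor C D F \<longleftrightarrow>
     (\<forall>X \<in> Obj C. FObj F X \<in> Obj D) \<and>
     (\<forall>f \<in> Arr C. FArr F f \<in> Hom D (FObj F (Dom C f)) (FObj F (Cod C f))) \<and>
     (\<forall>X \<in> Obj C. FArr F (Id C X) = Id D (FObj F X)) \<and>
     (\<forall>f \<in> Arr C. \<forall>g \<in> Arr C. Cod C f = Dom C g \<longrightarrow>
        FArr F (g \<cdot>\<^bsub>C\<^esub> f) = FArr F g \<cdot>\<^bsub>D\<^esub> FArr F f)"

definition fcomp :: "('p, 'n, 'q, 'l) fnctr \<Rightarrow> ('o, 'm, 'p, 'n) fnctr \<Rightarrow> ('o, 'm, 'q, 'l) fnctr" where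
  "fcomp G F = \<lparr>FObj = FObj G \<circ> FObj F, FArr = FArr G \<circ> FArr F\<rparr>"

definition natural_iso ::
  "('o, 'm, 'z) cat_scheme \<Rightarrow> ('p, 'n, 'y) cat_scheme \<Rightarrow> ('o, 'm, 'p, 'n) fnctr \<Rightarrow>
   ('o, 'm, 'p, 'n) fnctr \<Rightarrow> ('o \<Rightarrow> 'n) \<Rightarrow> bool" where
  "natural_iso C D F G \<alpha> \<longleftrightarrow>
     (\<forall>X \<in> Obj C. \<alpha> X \<in> Hom D (FObj F X) (FObj G X) \<and> is_iso D (\<alpha> X)) \<and>
     (\<forall>f \<in> Arr C. FArr G f \<cdot>\<^bsub>D\<^esub> \<alpha> (Dom C f) = \<alpha> (Cod C f) \<cdot>\<^bsub>D\<^esub> FArr F f)"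

definition naturally_isomorphic ::
  "('o, 'm, 'z) cat_scheme \<Rightarrow> ('p, 'n, 'y) cat_scheme \<Rightarrow> ('o, 'm, 'p, 'n) fnctr \<Rightarrow>
   ('o, 'm, 'p, 'n) fnctr \<Rightarrow> bool" where
  "naturally_isomorphic C D F G \<longleftrightarrow>
     is_functor C D F \<and> is_functor C D G \<and> (\<exists>\<alpha>. natural_iso C D F G \<alpha>)"

definition is_equivalence ::
  "('o, 'm, 'z) cat_scheme \<Rightarrow> ('p, 'n, 'y) cat_scheme \<Rightarrow> ('o, 'm, 'p, 'n) fnctr \<Rightarrow> bool" where
  "is_equivalence C D F \<longleftrightarrow> is_functor C D F \<and>
     (\<forall>X \<in> Obj C. \<forall>Y \<in> Obj C. bij_betw (FArr F) (Hom C X Y) (Hom D (FObj F X) (FObj F Y))) \<and>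
     (\<forall>Z \<in> Obj D. \<exists>X \<in> Obj C. isomorphic D (FObj F X) Z)"


section \<open>Additive categories\<close>

record ('o, 'm) preadd = "('o, 'm) cat" +
  Zero :: "'o \<Rightarrow> 'o \<Rightarrow> 'm"
  Add :: "'m \<Rightarrow> 'm \<Rightarrow> 'm" (infixl "\<oplus>\<index>" 65)

definition hom_group :: "('o, 'm, 'z) preadd_scheme \<Rightarrow> 'o \<Rightarrow> 'o \<Rightarrow> 'm monoid" where
  "hom_group C X Y = \<lparr>carrier = Hom C X Y, mult = Add C, one = Zero C X Y\<rparr>"

definition Neg :: "('o, 'm, 'z) preadd_scheme \<Rightarrow> 'm \<Rightarrow> 'm" where
  "Neg C f = inv\<^bsub>hom_group C (Dom C f) (Cod C f)\<^esub> f"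

definition zero_object :: "('o, 'm, 'z) cat_scheme \<Rightarrow> 'o \<Rightarrow> bool" where
  "zero_object C Z \<longleftrightarrow> Z \<in> Obj C \<and>
     (\<forall>X \<in> Obj C. (\<exists>!f. f \<in> Hom C X Z) \<and> (\<exists>!f. f \<in> Hom C Z X))"

definition biproduct ::
  "('o, 'm, 'z) preadd_scheme \<Rightarrow> 'o \<Rightarrow> 'o \<Rightarrow> 'o \<Rightarrow> 'm \<Rightarrow> 'm \<Rightarrow> 'm \<Rightarrow> 'm \<Rightarrow> bool" where
  "biproduct C X Y B i j p q \<longleftrightarrow> B \<in> Obj C \<and>
     i \<in> Hom C X B \<and> j \<in> Hom C Y B \<and> p \<in> Hom C B X \<and> q \<in> Hom C B Y \<and>
     p \<cdot>\<^bsub>C\<^esub> i = Id C X \<and> q \<cdot>\<^bsub>C\<^esub> j = Id C Y \<and> p \<cdot>\<^bsub>C\<^esub> j = Zero C Y X \<and> q \<cdot>\<^bsub>C\<^esub> i = Zero C X Y \<and>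
     (i \<cdot>\<^bsub>C\<^esub> p) \<oplus>\<^bsub>C\<^esub> (j \<cdot>\<^bsub>C\<^esub> q) = Id C B"

locale additive_category = category C for C :: "('o, 'm, 'z) preadd_scheme" (structure) +
  assumes hom_comm_group: "\<lbrakk>X \<in> Obj C; Y \<in> Obj C\<rbrakk> \<Longrightarrow> comm_group (hom_group C X Y)"
    and comp_add_right: "\<lbrakk>f \<in> Hom C X Y; f' \<in> Hom C X Y; g \<in> Hom C Y Z\<rbrakk> \<Longrightarrow>
      g \<cdot> (f \<oplus> f') = (g \<cdot> f) \<oplus> (g \<cdot> f')"
    and comp_add_left: "\<lbrakk>f \<in> Hom C X Y; g \<in> Hom C Y Z; g' \<in> Hom C Y Z\<rbrakk> \<Longrightarrow>
      (g \<oplus> g') \<cdot> f = (g \<cdot> f) \<oplus> (g' \<cdot> f)"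
    and ex_zero_object: "\<exists>Z. zero_object C Z"
    and ex_biproduct: "\<lbrakk>X \<in> Obj C; Y \<in> Obj C\<rbrakk> \<Longrightarrow> \<exists>B i j p q. biproduct C X Y B i j p q"

definition additive_functor ::
  "('o, 'm, 'z) preadd_scheme \<Rightarrow> ('p, 'n, 'y) preadd_scheme \<Rightarrow> ('o, 'm, 'p, 'n) fnctr \<Rightarrow> bool" where
  "additive_functor C D F \<longleftrightarrow> is_functor C D F \<and>
     (\<forall>f \<in> Arr C. \<forall>g \<in> Hom C (Dom C f) (Cod C f).
        FArr F (f \<oplus>\<^bsub>C\<^esub> g) = FArr F f \<oplus>\<^bsub>D\<^esub> FArr F g)"


section \<open>Triangulated categories\<close>

text \<open>A triangle is given by its three arrows. The suspension is an autoequivalence, not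
  necessarily an automorphism: the suspension of a relative stable category is in general no better
  than that.\<close>

type_synonym 'm triangle = "'m \<times> 'm \<times> 'm"

record ('o, 'm) tri_cat = "('o, 'm) preadd" +
  Susp :: "('o, 'm, 'o, 'm) fnctr"
  Tri :: "'m triangle set"

definition candidates ::
  "('o, 'm, 'z) cat_scheme \<Rightarrow> ('o, 'm, 'o, 'm) fnctr \<Rightarrow> 'm triangle set" where
  "candidates C S = {(f, g, h). f \<in> Arr C \<and> g \<in> Arr C \<and> h \<in> Arr C \<and>
     Cod C f = Dom C g \<and> Cod C g = Dom C h \<and> Cod C h = FObj S (Dom C f)}"

fun tri_mor ::
  "('o, 'm, 'z) cat_scheme \<Rightarrow> ('o, 'm, 'o, 'm) fnctr \<Rightarrow> 'm triangle \<Rightarrow> 'm triangle \<Rightarrow>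
   'm \<Rightarrow> 'm \<Rightarrow> 'm \<Rightarrow> bool" where
  "tri_mor C S (f, g, h) (f', g', h') a b c \<longleftrightarrow>
     a \<in> Hom C (Dom C f) (Dom C f') \<and> b \<in> Hom C (Cod C f) (Cod C f') \<and>
     c \<in> Hom C (Cod C g) (Cod C g') \<and>
     b \<cdot>\<^bsub>C\<^esub> f = f' \<cdot>\<^bsub>C\<^esub> a \<and> c \<cdot>\<^bsub>C\<^esub> g = g' \<cdot>\<^bsub>C\<^esub> b \<and> FArr S a \<cdot>\<^bsub>C\<^esub> h = h' \<cdot>\<^bsub>C\<^esub> c"

definition tri_isomorphic ::
  "('o, 'm, 'z) cat_scheme \<Rightarrow> ('o, 'm, 'o, 'm) fnctr \<Rightarrow> 'm triangle \<Rightarrow> 'm triangle \<Rightarrow> bool" where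
  "tri_isomorphic C S T T' \<longleftrightarrow>
     (\<exists>a b c. tri_mor C S T T' a b c \<and> is_iso C a \<and> is_iso C b \<and> is_iso C c)"

fun rotate_tri :: "('o, 'm) tri_cat \<Rightarrow> 'm triangle \<Rightarrow> 'm triangle" where
  "rotate_tri K (f, g, h) = (g, h, Neg K (FArr (Susp K) f))"

locale triangulated_category = additive_category K for K :: "('o, 'm) tri_cat" (structure) +
  assumes susp_additive: "additive_functor K K (Susp K)"
    and susp_equivalence: "is_equivalence K K (Susp K)"
    and tri_candidates: "Tri K \<subseteq> candidates K (Susp K)"
    and tri_iso_closed: "\<lbrakk>T \<in> Tri K; T' \<in> candidates K (Susp K); tri_isomorphic K (Susp K) T T'\<rbrakk> \<Longrightarrow>
      T' \<in> Tri K"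
    and tri_id: "\<lbrakk>X \<in> Obj K; zero_object K Z\<rbrakk> \<Longrightarrow>
      (Id K X, Zero K X Z, Zero K Z (FObj (Susp K) X)) \<in> Tri K"
    and tri_complete: "f \<in> Arr K \<Longrightarrow> \<exists>g h. (f, g, h) \<in> Tri K"
    and tri_rotate: "T \<in> candidates K (Susp K) \<Longrightarrow> T \<in> Tri K \<longleftrightarrow> rotate_tri K T \<in> Tri K"
    and tri_fill: "\<lbrakk>(f, g, h) \<in> Tri K; (f', g', h') \<in> Tri K; a \<in> Hom K (Dom K f) (Dom K f');
      b \<in> Hom K (Cod K f) (Cod K f'); b \<cdot> f = f' \<cdot> a\<rbrakk> \<Longrightarrow>
      \<exists>c. tri_mor K (Susp K) (f, g, h) (f', g', h') a b c"
    and octahedral: "\<lbrakk>(f, u, u') \<in> Tri K; (g, v, v') \<in> Tri K; Cod K f = Dom K g;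
      (g \<cdot> f, w, w') \<in> Tri K\<rbrakk> \<Longrightarrow>
      \<exists>s \<in> Hom K (Cod K u) (Cod K w). \<exists>t \<in> Hom K (Cod K w) (Cod K v).
        (s, t, FArr (Susp K) u \<cdot> v') \<in> Tri K \<and>
        s \<cdot> u = w \<cdot> g \<and> w' \<cdot> s = u' \<and> t \<cdot> w = v \<and> v' \<cdot> t = FArr (Susp K) f \<cdot> w'"

definition exact_functor :: "('o, 'm) tri_cat \<Rightarrow> ('p, 'n) tri_cat \<Rightarrow> ('o, 'm, 'p, 'n) fnctr \<Rightarrow> bool" where
  "exact_functor K L F \<longleftrightarrow> additive_functor K L F \<and>
     (\<exists>\<phi>. natural_iso K L (fcomp F (Susp K)) (fcomp (Susp L) F) \<phi> \<and>
       (\<forall>(f, g, h) \<in> Tri K. (FArr F f, FArr F g, \<phi> (Dom K f) \<cdot>\<^bsub>L\<^esub> FArr F h) \<in> Tri L))"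

definition exact_equivalence ::
  "('o, 'm) tri_cat \<Rightarrow> ('p, 'n) tri_cat \<Rightarrow> ('o, 'm, 'p, 'n) fnctr \<Rightarrow> bool" where
  "exact_equivalence K L F \<longleftrightarrow> exact_functor K L F \<and> is_equivalence K L F"

text \<open>Full subcategories are given by their sets of objects.\<close>

definition triangulated_subcategory :: "('o, 'm) tri_cat \<Rightarrow> 'o set \<Rightarrow> bool" where
  "triangulated_subcategory K J \<longleftrightarrow> J \<subseteq> Obj K \<and>
     (\<forall>X \<in> J. \<forall>Y \<in> Obj K. isomorphic K X Y \<longrightarrow> Y \<in> J) \<and>
     (\<forall>Z. zero_object K Z \<longrightarrow> Z \<in> J) \<and>
     (\<forall>X \<in> Obj K. X \<in> J \<longleftrightarrow> FObj (Susp K) X \<in> J) \<and>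
     (\<forall>(f, g, h) \<in> Tri K. Dom K f \<in> J \<and> Cod K f \<in> J \<longrightarrow> Cod K g \<in> J)"

definition thick_subcategory :: "('o, 'm) tri_cat \<Rightarrow> 'o set \<Rightarrow> bool" where
  "thick_subcategory K J \<longleftrightarrow> triangulated_subcategory K J \<and>
     (\<forall>X \<in> Obj K. \<forall>Y \<in> J. is_retract K X Y \<longrightarrow> X \<in> J)"

definition full_subcategory :: "('o, 'm) tri_cat \<Rightarrow> 'o set \<Rightarrow> ('o, 'm) tri_cat" where
  "full_subcategory K J = (let A = {f \<in> Arr K. Dom K f \<in> J \<and> Cod K f \<in> J} in
     K\<lparr>Obj := J, Arr := A, Tri := Tri K \<inter> (A \<times> A \<times> A)\<rparr>)"


section \<open>Verdier quotients and localizations\<close>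

definition cone_in :: "('o, 'm) tri_cat \<Rightarrow> 'o set \<Rightarrow> 'm set" where
  "cone_in K J = {s. \<exists>g h. (s, g, h) \<in> Tri K \<and> Cod K g \<in> J}"

text \<open>A roof \<open>(s, f)\<close> stands for \<open>f s\<^sup>-\<^sup>1\<close>, an arrow from \<open>Cod s\<close> to \<open>Cod f\<close>.\<close>

definition roofs :: "('o, 'm) tri_cat \<Rightarrow> 'o set \<Rightarrow> ('m \<times> 'm) set" where
  "roofs K J = {(s, f). s \<in> cone_in K J \<and> f \<in> Arr K \<and> Dom K s = Dom K f}"

fun roof_equiv :: "('o, 'm) tri_cat \<Rightarrow> 'o set \<Rightarrow> 'm \<times> 'm \<Rightarrow> 'm \<times> 'm \<Rightarrow> bool" where
  "roof_equiv K J (s, f) (t, g) \<longleftrightarrow> Cod K s = Cod K t \<and> Cod K f = Cod K g \<and>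
     (\<exists>u v. u \<in> Arr K \<and> v \<in> Arr K \<and> Dom K u = Dom K v \<and> Cod K u = Dom K s \<and> Cod K v = Dom K t \<and>
       s \<cdot>\<^bsub>K\<^esub> u \<in> cone_in K J \<and> s \<cdot>\<^bsub>K\<^esub> u = t \<cdot>\<^bsub>K\<^esub> v \<and> f \<cdot>\<^bsub>K\<^esub> u = g \<cdot>\<^bsub>K\<^esub> v)"

definition frac :: "('o, 'm) tri_cat \<Rightarrow> 'o set \<Rightarrow> 'm \<Rightarrow> 'm \<Rightarrow> ('m \<times> 'm) set" where
  "frac K J s f = {r \<in> roofs K J. roof_equiv K J (s, f) r}"

definition verdier_functor ::
  "('o, 'm) tri_cat \<Rightarrow> 'o set \<Rightarrow> ('o, 'm, 'o, ('m \<times> 'm) set) fnctr" where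
  "verdier_functor K J = \<lparr>FObj = \<lambda>X. X, FArr = \<lambda>f. frac K J (Id K (Dom K f)) f\<rparr>"

definition verdier_preadd :: "('o, 'm) tri_cat \<Rightarrow> 'o set \<Rightarrow> ('o, ('m \<times> 'm) set) preadd" where
  "verdier_preadd K J =
     \<lparr>Obj = Obj K,
      Arr = {frac K J s f | s f. (s, f) \<in> roofs K J},
      Dom = \<lambda>F. THE X. \<forall>(s, f) \<in> F. Cod K s = X,
      Cod = \<lambda>F. THE Y. \<forall>(s, f) \<in> F. Cod K f = Y,
      Id = \<lambda>X. frac K J (Id K X) (Id K X),
      Comp = \<lambda>G F. THE H. \<exists>s f t g u v. (s, f) \<in> F \<and> (t, g) \<in> G \<and> u \<in> cone_in K J \<and> v \<in> Arr K \<and>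
        Dom K u = Dom K v \<and> Cod K u = Dom K f \<and> Cod K v = Dom K t \<and>
        f \<cdot>\<^bsub>K\<^esub> u = t \<cdot>\<^bsub>K\<^esub> v \<and> H = frac K J (s \<cdot>\<^bsub>K\<^esub> u) (g \<cdot>\<^bsub>K\<^esub> v),
      Zero = \<lambda>X Y. frac K J (Id K X) (Zero K X Y),
      Add = \<lambda>F G. THE H. \<exists>s f g. (s, f) \<in> F \<and> (s, g) \<in> G \<and> H = frac K J s (f \<oplus>\<^bsub>K\<^esub> g)\<rparr>"

definition verdier_susp ::
  "('o, 'm) tri_cat \<Rightarrow> 'o set \<Rightarrow> ('o, ('m \<times> 'm) set, 'o, ('m \<times> 'm) set) fnctr" where
  "verdier_susp K J =
     \<lparr>FObj = FObj (Susp K),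
      FArr = \<lambda>F. THE G. \<exists>(s, f) \<in> F. G = frac K J (FArr (Susp K) s) (FArr (Susp K) f)\<rparr>"

definition verdier_quotient :: "('o, 'm) tri_cat \<Rightarrow> 'o set \<Rightarrow> ('o, ('m \<times> 'm) set) tri_cat" where
  "verdier_quotient K J =
     (let C = verdier_preadd K J; S = verdier_susp K J; q = FArr (verdier_functor K J) in
      preadd.extend C (tri_cat.fields S
        {T \<in> candidates C S. \<exists>(f, g, h) \<in> Tri K. tri_isomorphic C S (q f, q g, q h) T}))"

definition localization :: "('o, 'm) tri_cat \<Rightarrow> ('p, 'n) tri_cat \<Rightarrow> ('o, 'm, 'p, 'n) fnctr \<Rightarrow> bool" where
  "localization K L F \<longleftrightarrow> (\<exists>J G. thick_subcategory K J \<and>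
     exact_equivalence (verdier_quotient K J) L G \<and>
     naturally_isomorphic K L F (fcomp G (verdier_functor K J)))"


section \<open>Proper and Frobenius classes of triangles\<close>

text \<open>The square with arrows \<open>a : W \<rightarrow> X\<close>, \<open>b : W \<rightarrow> Y\<close>, \<open>c : X \<rightarrow> Z\<close>, \<open>d : Y \<rightarrow> Z\<close> is homotopy
  cartesian: there is a distinguished triangle \<open>W \<rightarrow> X \<oplus> Y \<rightarrow> Z \<rightarrow> \<Sigma>W\<close> with first maps
  \<open>(a, -b)\<close> and \<open>(c, d)\<close>. Then \<open>Z\<close> is a homotopy pushout of \<open>a, b\<close> and \<open>W\<close> a homotopy pullback
  of \<open>c, d\<close>; \<open>d\<close> is the pushout of \<open>a\<close> along \<open>b\<close>, and \<open>a\<close> is the pullback of \<open>d\<close> along \<open>c\<close>.\<close>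

definition homotopy_cartesian :: "('o, 'm) tri_cat \<Rightarrow> 'm \<Rightarrow> 'm \<Rightarrow> 'm \<Rightarrow> 'm \<Rightarrow> bool" where
  "homotopy_cartesian K a b c d \<longleftrightarrow>
     a \<in> Arr K \<and> b \<in> Arr K \<and> c \<in> Arr K \<and> d \<in> Arr K \<and>
     Dom K a = Dom K b \<and> Cod K a = Dom K c \<and> Cod K b = Dom K d \<and> Cod K c = Cod K d \<and>
     (\<exists>B i j p q e. biproduct K (Cod K a) (Cod K b) B i j p q \<and>
       ((i \<cdot>\<^bsub>K\<^esub> a) \<oplus>\<^bsub>K\<^esub> Neg K (j \<cdot>\<^bsub>K\<^esub> b), (c \<cdot>\<^bsub>K\<^esub> p) \<oplus>\<^bsub>K\<^esub> (d \<cdot>\<^bsub>K\<^esub> q), e) \<in> Tri K)"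

definition E_mono :: "'m triangle set \<Rightarrow> 'm \<Rightarrow> bool" where
  "E_mono E f \<longleftrightarrow> (\<exists>g h. (f, g, h) \<in> E)"

definition E_epi :: "'m triangle set \<Rightarrow> 'm \<Rightarrow> bool" where
  "E_epi E g \<longleftrightarrow> (\<exists>f h. (f, g, h) \<in> E)"

definition tri_sum :: "('o, 'm) tri_cat \<Rightarrow> 'm triangle \<Rightarrow> 'm triangle \<Rightarrow> 'm triangle \<Rightarrow> bool" where
  "tri_sum K T\<^sub>1 T\<^sub>2 T \<longleftrightarrow> (\<exists>i i' i'' j j' j'' p p' p'' q q' q''.
     tri_mor K (Susp K) T\<^sub>1 T i i' i'' \<and> tri_mor K (Susp K) T\<^sub>2 T j j' j'' \<and>
     tri_mor K (Susp K) T T\<^sub>1 p p' p'' \<and> tri_mor K (Susp K) T T\<^sub>2 q q' q'' \<and>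
     biproduct K (Dom K i) (Dom K j) (Cod K i) i j p q \<and>
     biproduct K (Dom K i') (Dom K j') (Cod K i') i' j' p' q' \<and>
     biproduct K (Dom K i'') (Dom K j'') (Cod K i'') i'' j'' p'' q'')"

definition tri_retract :: "('o, 'm) tri_cat \<Rightarrow> 'm triangle \<Rightarrow> 'm triangle \<Rightarrow> bool" where
  "tri_retract K T' T \<longleftrightarrow> (\<exists>s s' s'' r r' r''.
     tri_mor K (Susp K) T' T s s' s'' \<and> tri_mor K (Susp K) T T' r r' r'' \<and>
     r \<cdot>\<^bsub>K\<^esub> s = Id K (Dom K s) \<and> r' \<cdot>\<^bsub>K\<^esub> s' = Id K (Dom K s') \<and> r'' \<cdot>\<^bsub>K\<^esub> s'' = Id K (Dom K s''))"

text \<open>Closure under suspension is only required in the positive direction, which is the weaker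
  hypothesis. The empty sum of triangles is an instance of \<open>E_id_left\<close>.\<close>

locale proper_class = triangulated_category K for K :: "('o, 'm) tri_cat" (structure) +
  fixes E :: "'m triangle set"
  assumes E_tri: "E \<subseteq> Tri K"
    and E_iso: "\<lbrakk>T \<in> E; T' \<in> Tri K; tri_isomorphic K (Susp K) T T'\<rbrakk> \<Longrightarrow> T' \<in> E"
    and E_susp: "T \<in> E \<Longrightarrow> rotate_tri K (rotate_tri K (rotate_tri K T)) \<in> E"
    and E_sum: "\<lbrakk>T\<^sub>1 \<in> E; T\<^sub>2 \<in> E; T \<in> Tri K; tri_sum K T\<^sub>1 T\<^sub>2 T\<rbrakk> \<Longrightarrow> T \<in> E"
    and E_retract: "\<lbrakk>T \<in> E; T' \<in> Tri K; tri_retract K T' T\<rbrakk> \<Longrightarrow> T' \<in> E"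
    and E_id_left: "\<lbrakk>X \<in> Obj K; zero_object K Z\<rbrakk> \<Longrightarrow>
      (Id K X, Zero K X Z, Zero K Z (FObj (Susp K) X)) \<in> E"
    and E_id_right: "\<lbrakk>Y \<in> Obj K; zero_object K Z\<rbrakk> \<Longrightarrow>
      (Zero K Z Y, Id K Y, Zero K Y (FObj (Susp K) Z)) \<in> E"
    and E_pushout: "\<lbrakk>homotopy_cartesian K a b c d; E_mono E a\<rbrakk> \<Longrightarrow> E_mono E d"
    and E_pullback: "\<lbrakk>homotopy_cartesian K a b c d; E_epi E d\<rbrakk> \<Longrightarrow> E_epi E a"
    and E_saturated: "\<lbrakk>homotopy_cartesian K a b c d; E_epi E c; E_epi E a\<rbrakk> \<Longrightarrow> E_epi E d"

text \<open>\<open>E_proj\<close>: the sequence \<open>0 \<rightarrow> K(P, X) \<rightarrow> K(P, Y) \<rightarrow> K(P, Z) \<rightarrow> 0\<close> is exact for all triangles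
  \<open>X \<rightarrow> Y \<rightarrow> Z \<rightarrow> \<Sigma>X\<close> in \<open>E\<close>; dually for \<open>E_inj\<close>.\<close>

definition E_proj :: "('o, 'm) tri_cat \<Rightarrow> 'm triangle set \<Rightarrow> 'o set" where
  "E_proj K E = {P \<in> Obj K. \<forall>(f, g, h) \<in> E.
     inj_on (\<lambda>a. f \<cdot>\<^bsub>K\<^esub> a) (Hom K P (Dom K f)) \<and>
     (\<lambda>a. f \<cdot>\<^bsub>K\<^esub> a) ` Hom K P (Dom K f) = {b \<in> Hom K P (Dom K g). g \<cdot>\<^bsub>K\<^esub> b = Zero K P (Cod K g)} \<and>
     (\<lambda>b. g \<cdot>\<^bsub>K\<^esub> b) ` Hom K P (Dom K g) = Hom K P (Cod K g)}"

definition E_inj :: "('o, 'm) tri_cat \<Rightarrow> 'm triangle set \<Rightarrow> 'o set" where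
  "E_inj K E = {I \<in> Obj K. \<forall>(f, g, h) \<in> E.
     inj_on (\<lambda>a. a \<cdot>\<^bsub>K\<^esub> g) (Hom K (Cod K g) I) \<and>
     (\<lambda>a. a \<cdot>\<^bsub>K\<^esub> g) ` Hom K (Cod K g) I = {b \<in> Hom K (Dom K g) I. b \<cdot>\<^bsub>K\<^esub> f = Zero K (Dom K f) I} \<and>
     (\<lambda>b. b \<cdot>\<^bsub>K\<^esub> f) ` Hom K (Dom K g) I = Hom K (Dom K f) I}"

locale frobenius_class = proper_class K E for K :: "('o, 'm) tri_cat" (structure) and E +
  assumes enough_proj: "X \<in> Obj K \<Longrightarrow> \<exists>P \<in> E_proj K E. \<exists>g \<in> Hom K P X. E_epi E g"
    and enough_inj: "X \<in> Obj K \<Longrightarrow> \<exists>I \<in> E_inj K E. \<exists>f \<in> Hom K X I. E_mono E f"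
    and proj_eq_inj: "E_proj K E = E_inj K E"


section \<open>The relative stable category\<close>

definition factors_through :: "('o, 'm, 'z) cat_scheme \<Rightarrow> 'o set \<Rightarrow> 'm \<Rightarrow> bool" where
  "factors_through C P f \<longleftrightarrow>
     (\<exists>A \<in> P. \<exists>a \<in> Hom C (Dom C f) A. \<exists>b \<in> Hom C A (Cod C f). f = b \<cdot>\<^bsub>C\<^esub> a)"

definition coset :: "('o, 'm, 'z) preadd_scheme \<Rightarrow> 'o set \<Rightarrow> 'm \<Rightarrow> 'm set" where
  "coset C P f = {g \<in> Hom C (Dom C f) (Cod C f). factors_through C P (g \<oplus>\<^bsub>C\<^esub> Neg C f)}"

definition additive_quotient :: "('o, 'm, 'z) preadd_scheme \<Rightarrow> 'o set \<Rightarrow> ('o, 'm set) preadd" where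
  "additive_quotient C P =
     \<lparr>Obj = Obj C,
      Arr = coset C P ` Arr C,
      Dom = \<lambda>F. THE X. \<forall>f \<in> F. Dom C f = X,
      Cod = \<lambda>F. THE Y. \<forall>f \<in> F. Cod C f = Y,
      Id = \<lambda>X. coset C P (Id C X),
      Comp = \<lambda>G F. THE H. \<exists>f \<in> F. \<exists>g \<in> G. H = coset C P (g \<cdot>\<^bsub>C\<^esub> f),
      Zero = \<lambda>X Y. coset C P (Zero C X Y),
      Add = \<lambda>F G. THE H. \<exists>f \<in> F. \<exists>g \<in> G. H = coset C P (f \<oplus>\<^bsub>C\<^esub> g)\<rparr>"

definition stable_functor :: "('o, 'm) tri_cat \<Rightarrow> 'm triangle set \<Rightarrow> ('o, 'm, 'o, 'm set) fnctr" where
  "stable_functor K E = \<lparr>FObj = \<lambda>X. X, FArr = coset K (E_proj K E)\<rparr>"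

text \<open>The triangulation depends on a choice \<open>\<tau>\<close> of triangles
  \<open>X \<rightarrow> X\<^sub>E \<rightarrow> X' \<rightarrow> \<Sigma>X\<close>, one for each object \<open>X\<close>.\<close>

definition injective_choice ::
  "('o, 'm) tri_cat \<Rightarrow> 'm triangle set \<Rightarrow> ('o \<Rightarrow> 'm triangle) \<Rightarrow> bool" where
  "injective_choice K E \<tau> \<longleftrightarrow> (\<forall>X \<in> Obj K. \<tau> X \<in> Tri K \<and>
     (case \<tau> X of (i, p, q) \<Rightarrow> Dom K i = X \<and> Cod K i \<in> E_inj K E \<and> E_mono E i))"

text \<open>On arrows, \<open>\<Sigma>\<^sub>E\<close> sends the class of \<open>f : X \<rightarrow> Y\<close> to the class of the third component of any
  morphism of triangles \<open>\<tau> X \<rightarrow> \<tau> Y\<close> extending \<open>f\<close>.\<close>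

definition stable_susp ::
  "('o, 'm) tri_cat \<Rightarrow> 'm triangle set \<Rightarrow> ('o \<Rightarrow> 'm triangle) \<Rightarrow> ('o, 'm set, 'o, 'm set) fnctr" where
  "stable_susp K E \<tau> =
     \<lparr>FObj = \<lambda>X. case \<tau> X of (i, p, q) \<Rightarrow> Cod K p,
      FArr = \<lambda>F. THE G. \<exists>f \<in> F. \<exists>f' f''.
        tri_mor K (Susp K) (\<tau> (Dom K f)) (\<tau> (Cod K f)) f f' f'' \<and> G = coset K (E_proj K E) f''\<rparr>"

definition standard_triangle ::
  "('o, 'm) tri_cat \<Rightarrow> ('o \<Rightarrow> 'm triangle) \<Rightarrow> 'm \<Rightarrow> 'm \<Rightarrow> 'm \<Rightarrow> bool" where
  "standard_triangle K \<tau> f g h \<longleftrightarrow> f \<in> Arr K \<and> (case \<tau> (Dom K f) of (i, p, q) \<Rightarrow>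
     \<exists>k. homotopy_cartesian K i f k g \<and>
       (g, h, FArr (Susp K) f \<cdot>\<^bsub>K\<^esub> q) \<in> Tri K \<and>
       tri_mor K (Susp K) (i, p, q) (g, h, FArr (Susp K) f \<cdot>\<^bsub>K\<^esub> q) f k (Id K (Cod K p)))"

definition stable_category ::
  "('o, 'm) tri_cat \<Rightarrow> 'm triangle set \<Rightarrow> ('o \<Rightarrow> 'm triangle) \<Rightarrow> ('o, 'm set) tri_cat" where
  "stable_category K E \<tau> =
     (let C = additive_quotient K (E_proj K E); S = stable_susp K E \<tau>; \<pi> = FArr (stable_functor K E) in
      preadd.extend C (tri_cat.fields S
        {T \<in> candidates C S. \<exists>f g h. standard_triangle K \<tau> f g h \<and>
           tri_isomorphic C S (\<pi> f, \<pi> g, \<pi> h) T}))"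


section \<open>Direct summands\<close>

text \<open>\<open>K = J \<oplus> J'\<close> with \<open>J\<close> and \<open>J'\<close> orthogonal both ways.\<close>

definition orthogonal_sum :: "('o, 'm) tri_cat \<Rightarrow> 'o set \<Rightarrow> 'o set \<Rightarrow> bool" where
  "orthogonal_sum K J J' \<longleftrightarrow>
     triangulated_subcategory K J \<and> triangulated_subcategory K J' \<and>
     (\<forall>X \<in> Obj K. \<exists>A \<in> J. \<exists>B \<in> J'. \<exists>i j p q. biproduct K A B X i j p q) \<and>
     (\<forall>A \<in> J. \<forall>B \<in> J'. Hom K A B = {Zero K A B} \<and> Hom K B A = {Zero K B A})"

text \<open>The functor \<open>R\<close> is a projection of \<open>K = J \<oplus> J'\<close> onto \<open>J'\<close>: it picks a complement
  \<open>R X \<in> J'\<close> of some \<open>A X \<in> J\<close> in \<open>X\<close>, naturally.\<close>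

definition is_projection ::
  "('o, 'm) tri_cat \<Rightarrow> 'o set \<Rightarrow> 'o set \<Rightarrow> ('o, 'm, 'o, 'm) fnctr \<Rightarrow> bool" where
  "is_projection K J J' R \<longleftrightarrow> is_functor K (full_subcategory K J') R \<and>
     (\<exists>A i j p q. (\<forall>X \<in> Obj K. A X \<in> J \<and> biproduct K (A X) (FObj R X) X (i X) (j X) (p X) (q X)) \<and>
       (\<forall>f \<in> Arr K. FArr R f \<cdot>\<^bsub>K\<^esub> q (Dom K f) = q (Cod K f) \<cdot>\<^bsub>K\<^esub> f))"

text \<open>\<open>F : K \<rightarrow> L\<close> is, up to the exact equivalence \<open>H\<close>, the projection onto the summand \<open>J'\<close>.\<close>

definition projection_onto_summand ::
  "('o, 'm) tri_cat \<Rightarrow> ('p, 'n) tri_cat \<Rightarrow> ('o, 'm, 'p, 'n) fnctr \<Rightarrow> 'o set \<Rightarrow> 'o set \<Rightarrow> bool" where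
  "projection_onto_summand K L F J J' \<longleftrightarrow> orthogonal_sum K J J' \<and>
     (\<exists>R H. is_projection K J J' R \<and> exact_equivalence (full_subcategory K J') L H \<and>
       naturally_isomorphic K L F (fcomp H R))"

end

theory Submission
  imports Defs
begin

text \<open>
  Let \<open>J\<close> be the class of objects that are projective, equivalently injective, and let \<open>L\<close> be
  the relative stable category. An arrow of \<open>L\<close> is a class of arrows of \<open>K\<close> modulo those that
  factor through \<open>J\<close>. In the Verdier quotient \<open>K/J\<close> an arrow is a fraction whose denominator has
  its cone in \<open>J\<close>, and arrows that factor through \<open>J\<close> vanish there too. The two constructions
  agree as soon as \<open>\<pi>\<close> inverts these denominators.

  Exactness of \<open>\<pi>\<close> forces this. Let \<open>X \<rightarrow> Y \<rightarrow> Z\<close> be distinguished in \<open>K\<close> with \<open>X \<in> J\<close>. Its image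
  is isomorphic in \<open>L\<close> to a standard triangle on an arrow whose domain again lies in \<open>J\<close>. For
  such a domain the chosen triangle \<open>X \<rightarrow> X\<^sub>E \<rightarrow> X' \<rightarrow> \<Sigma>X\<close> has zero third arrow, hence so has the
  triangle \<open>Y \<rightarrow> Z \<rightarrow> X' \<rightarrow> \<Sigma>Y\<close> obtained by homotopy pushout, and \<open>Y \<rightarrow> Z\<close> is the inclusion of a
  summand with complement \<open>X' \<in> J\<close>. So \<open>\<pi>\<close> inverts \<open>Y \<rightarrow> Z\<close> (\<open>cone_of_J_iso\<close>). In particular
  \<open>Z \<in> J\<close> if also \<open>Y \<in> J\<close>. Since moreover \<open>X \<in> J\<close> if and only if \<open>X' \<in> J\<close> (\<open>cosyzygy_J_iff\<close>),
  and \<open>\<pi>(\<Sigma>X) \<cong> X'\<close> in \<open>L\<close>, the class \<open>J\<close> is closed under suspension in both directions; with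
  closure under retracts this makes it thick (\<open>J_thick\<close>). If \<open>s\<close> is a denominator and \<open>t\<close>
  represents the inverse of \<open>\<pi> s\<close>, then \<open>f s\<^sup>-\<^sup>1\<close> and \<open>f t\<close> agree in \<open>K/J\<close> (\<open>q_full\<close>), and
  arrows of \<open>K\<close> agree in \<open>K/J\<close> exactly when they agree in \<open>L\<close> (\<open>q_eq_iff\<close>). Thus \<open>K/J \<rightarrow> L\<close> is
  the identity on objects and bijective on arrows.

  Conversely, the functor to any Verdier quotient commutes strictly with the suspensions and
  preserves triangles (\<open>q_susp\<close>, \<open>q_Tri\<close>); composing with an exact equivalence keeps
  these properties, and exactness passes to isomorphic functors (\<open>exact_functor_cong\<close>).

  Now let \<open>\<pi>\<close> be exact and \<open>K\<close> idempotent complete. For an \<open>E\<close>-epimorphism \<open>P \<rightarrow> X\<close> with \<open>P \<in> J\<close>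
  let \<open>h\<close> be the next arrow \<open>X \<rightarrow> \<Sigma>W\<close> of its triangle. Every arrow from \<open>J\<close> to \<open>X\<close> lifts to \<open>P\<close>
  and so is killed by \<open>h\<close>, while \<open>\<pi> h\<close> is invertible, say with inverse \<open>\<pi> s\<close>. Then \<open>e = s h\<close>
  kills all arrows from \<open>J\<close>, and \<open>1 - e\<close> factors through \<open>J\<close>; hence \<open>e (1 - e) = 0\<close>. Splitting
  this idempotent decomposes \<open>X\<close> into an object of \<open>J\<close> and an object \<open>B\<close> that receives no
  nonzero arrow from \<open>J\<close>. Such a \<open>B\<close> admits no nonzero arrow \<open>f\<close> to \<open>J\<close> either: the fibre
  \<open>w : W \<rightarrow> B\<close> of \<open>f\<close> is a denominator, so \<open>1 - w s\<close> factors through \<open>J\<close> for some \<open>s\<close>, hence is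
  zero, and \<open>f = f w s = 0\<close>.
\<close>

section \<open>Additive categories\<close>

text \<open>
  Composability is expressed through \<open>Arr\<close>, \<open>Dom\<close> and \<open>Cod\<close> rather than through membership in
  hom-sets: in this form the typing rules are conditional rewrite rules without extra variables,
  and the simplifier discharges typing conditions by itself.
\<close>

lemma in_Hom: "f \<in> Hom C X Y \<longleftrightarrow> f \<in> Arr C \<and> Dom C f = X \<and> Cod C f = Y"
  by (simp add: Hom_def)

context category begin

lemma Dom_Obj [simp]: "f \<in> Arr C \<Longrightarrow> Dom C f \<in> Obj C" by (rule dom_in)
lemma Cod_Obj [simp]: "f \<in> Arr C \<Longrightarrow> Cod C f \<in> Obj C" by (rule cod_in)

lemma Id_simps [simp]:
  assumes "X \<in> Obj C"
  shows "Id C X \<in> Arr C" "Dom C (Id C X) = X" "Cod C (Id C X) = X"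
  using id_in[OF assms] by (auto simp: in_Hom)

lemma Comp_simps [simp]:
  assumes "f \<in> Arr C" "g \<in> Arr C" "Cod C f = Dom C g"
  shows "g \<cdot> f \<in> Arr C" "Dom C (g \<cdot> f) = Dom C f" "Cod C (g \<cdot> f) = Cod C g"
  using comp_in[of f "Dom C f" "Cod C f" g "Cod C g"] assms by (auto simp: in_Hom)

lemma Comp_assoc:
  assumes "f \<in> Arr C" "g \<in> Arr C" "h \<in> Arr C" "Cod C f = Dom C g" "Cod C g = Dom C h"
  shows "(h \<cdot> g) \<cdot> f = h \<cdot> (g \<cdot> f)"
  using comp_assoc[of f "Dom C f" "Cod C f" g "Cod C g" h "Cod C h"] assms by (auto simp: in_Hom)

text \<open>Makes a known composite usable inside a product that is bracketed to the right.\<close>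
lemma Comp_cong_assoc:
  assumes "g \<cdot> f = k" "f \<in> Arr C" "g \<in> Arr C" "x \<in> Arr C" "Cod C x = Dom C f" "Cod C f = Dom C g"
  shows "g \<cdot> (f \<cdot> x) = k \<cdot> x"
  using Comp_assoc[of x f g] assms by simp

lemma Id_left [simp]: "\<lbrakk>f \<in> Arr C; Cod C f = X\<rbrakk> \<Longrightarrow> Id C X \<cdot> f = f"
  by (rule id_left) (auto simp: in_Hom)

lemma Id_right [simp]: "\<lbrakk>f \<in> Arr C; Dom C f = X\<rbrakk> \<Longrightarrow> f \<cdot> Id C X = f"
  by (rule id_right) (auto simp: in_Hom)

lemma is_iso_Id [simp]: "X \<in> Obj C \<Longrightarrow> is_iso C (Id C X)"
  unfolding is_iso_def by (auto simp: in_Hom intro!: bexI[of _ "Id C X"])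

lemma is_isoE:
  assumes "is_iso C f"
  obtains g where "g \<in> Arr C" "Dom C g = Cod C f" "Cod C g = Dom C f"
    "g \<cdot> f = Id C (Dom C f)" "f \<cdot> g = Id C (Cod C f)" "f \<in> Arr C" "is_iso C g"
proof -
  from assms obtain g where g: "f \<in> Arr C" "g \<in> Hom C (Cod C f) (Dom C f)"
    "g \<cdot> f = Id C (Dom C f)" "f \<cdot> g = Id C (Cod C f)"
    unfolding is_iso_def by auto
  then have "is_iso C g" unfolding is_iso_def by (auto simp: in_Hom intro!: bexI[of _ f])
  then show ?thesis using that g by (auto simp: in_Hom)
qed

lemma is_iso_Comp:
  assumes f: "is_iso C f" and g: "is_iso C g" and fg: "Cod C f = Dom C g"
  shows "is_iso C (g \<cdot> f)"
proof -
  obtain f' where f': "f' \<in> Arr C" "Dom C f' = Cod C f" "Cod C f' = Dom C f"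
    "f' \<cdot> f = Id C (Dom C f)" "f \<cdot> f' = Id C (Cod C f)" "f \<in> Arr C" by (rule is_isoE[OF f])
  obtain g' where g': "g' \<in> Arr C" "Dom C g' = Cod C g" "Cod C g' = Dom C g"
    "g' \<cdot> g = Id C (Dom C g)" "g \<cdot> g' = Id C (Cod C g)" "g \<in> Arr C" by (rule is_isoE[OF g])
  have "(f' \<cdot> g') \<cdot> (g \<cdot> f) = Id C (Dom C f)"
    using f' g' fg Comp_cong_assoc[OF g'(4), of f] by (simp add: Comp_assoc)
  moreover have "(g \<cdot> f) \<cdot> (f' \<cdot> g') = Id C (Cod C g)"
    using f' g' fg Comp_cong_assoc[OF f'(5), of g'] by (simp add: Comp_assoc)
  ultimately show ?thesis unfolding is_iso_def using f' g' fg
    by (auto simp: in_Hom intro!: bexI[of _ "f' \<cdot> g'"])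
qed

end

lemma is_functorD:
  assumes "is_functor C D F"
  shows "X \<in> Obj C \<Longrightarrow> FObj F X \<in> Obj D"
    "f \<in> Arr C \<Longrightarrow> FArr F f \<in> Arr D"
    "f \<in> Arr C \<Longrightarrow> Dom D (FArr F f) = FObj F (Dom C f)"
    "f \<in> Arr C \<Longrightarrow> Cod D (FArr F f) = FObj F (Cod C f)"
    "X \<in> Obj C \<Longrightarrow> FArr F (Id C X) = Id D (FObj F X)"
    "\<lbrakk>f \<in> Arr C; g \<in> Arr C; Cod C f = Dom C g\<rbrakk> \<Longrightarrow> FArr F (g \<cdot>\<^bsub>C\<^esub> f) = FArr F g \<cdot>\<^bsub>D\<^esub> FArr F f"
  using assms unfolding is_functor_def by (auto simp: in_Hom)

lemma functor_is_iso:
  assumes C: "category C" and F: "is_functor C D F" and f: "is_iso C f"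
  shows "is_iso D (FArr F f)"
proof -
  interpret category C by fact
  note [simp] = is_functorD[OF F]
  obtain g where g: "g \<in> Arr C" "Dom C g = Cod C f" "Cod C g = Dom C f"
    "g \<cdot>\<^bsub>C\<^esub> f = Id C (Dom C f)" "f \<cdot>\<^bsub>C\<^esub> g = Id C (Cod C f)" "f \<in> Arr C" by (rule is_isoE[OF f])
  have "FArr F g \<cdot>\<^bsub>D\<^esub> FArr F f = Id D (FObj F (Dom C f))"
    "FArr F f \<cdot>\<^bsub>D\<^esub> FArr F g = Id D (FObj F (Cod C f))"
    using g is_functorD(6)[OF F, of f g] is_functorD(6)[OF F, of g f] by auto
  then show ?thesis unfolding is_iso_def using g by (auto simp: in_Hom intro!: bexI[of _ "FArr F g"])
qed

context additive_category begin

lemma Zero_simps [simp]: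
  assumes "X \<in> Obj C" "Y \<in> Obj C"
  shows "Zero C X Y \<in> Arr C" "Dom C (Zero C X Y) = X" "Cod C (Zero C X Y) = Y"
proof -
  interpret G: comm_group "hom_group C X Y" using assms by (rule hom_comm_group)
  show "Zero C X Y \<in> Arr C" "Dom C (Zero C X Y) = X" "Cod C (Zero C X Y) = Y"
    using G.one_closed by (auto simp: hom_group_def in_Hom)
qed

lemma Add_simps [simp]:
  assumes "f \<in> Arr C" "g \<in> Arr C" "Dom C g = Dom C f" "Cod C g = Cod C f"
  shows "f \<oplus> g \<in> Arr C" "Dom C (f \<oplus> g) = Dom C f" "Cod C (f \<oplus> g) = Cod C f"
proof -
  interpret G: comm_group "hom_group C (Dom C f) (Cod C f)" using assms by (intro hom_comm_group) auto
  have "f \<oplus> g \<in> Hom C (Dom C f) (Cod C f)"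
    using G.m_closed[of f g] assms by (auto simp: hom_group_def in_Hom)
  then show "f \<oplus> g \<in> Arr C" "Dom C (f \<oplus> g) = Dom C f" "Cod C (f \<oplus> g) = Cod C f"
    by (auto simp: in_Hom)
qed

lemma Neg_simps [simp]:
  assumes "f \<in> Arr C"
  shows "Neg C f \<in> Arr C" "Dom C (Neg C f) = Dom C f" "Cod C (Neg C f) = Cod C f"
proof -
  interpret G: comm_group "hom_group C (Dom C f) (Cod C f)" using assms by (intro hom_comm_group) auto
  have "Neg C f \<in> Hom C (Dom C f) (Cod C f)"
    using G.inv_closed[of f] assms by (auto simp: hom_group_def Neg_def in_Hom)
  then show "Neg C f \<in> Arr C" "Dom C (Neg C f) = Dom C f" "Cod C (Neg C f) = Cod C f"
    by (auto simp: in_Hom)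
qed

lemma Add_assoc:
  assumes "f \<in> Arr C" "g \<in> Arr C" "h \<in> Arr C" "Dom C g = Dom C f" "Cod C g = Cod C f"
    "Dom C h = Dom C f" "Cod C h = Cod C f"
  shows "(f \<oplus> g) \<oplus> h = f \<oplus> (g \<oplus> h)"
proof -
  interpret G: comm_group "hom_group C (Dom C f) (Cod C f)" using assms by (intro hom_comm_group) auto
  show ?thesis using G.m_assoc[of f g h] assms by (auto simp: hom_group_def in_Hom)
qed

lemma Add_commute:
  assumes "f \<in> Arr C" "g \<in> Arr C" "Dom C g = Dom C f" "Cod C g = Cod C f"
  shows "f \<oplus> g = g \<oplus> f"
proof -
  interpret G: comm_group "hom_group C (Dom C f) (Cod C f)" using assms by (intro hom_comm_group) auto
  show ?thesis using G.m_comm[of f g] assms by (auto simp: hom_group_def in_Hom)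
qed

lemma Add_left_commute:
  assumes "f \<in> Arr C" "g \<in> Arr C" "h \<in> Arr C" "Dom C g = Dom C f" "Cod C g = Cod C f"
    "Dom C h = Dom C f" "Cod C h = Cod C f"
  shows "f \<oplus> (g \<oplus> h) = g \<oplus> (f \<oplus> h)"
  using assms Add_assoc[of f g h] Add_assoc[of g f h] Add_commute[of f g] by simp

lemmas Add_ac = Add_assoc Add_commute Add_left_commute

lemma Add_Zero [simp]:
  assumes "f \<in> Arr C" "Dom C f = X" "Cod C f = Y"
  shows "f \<oplus> Zero C X Y = f" "Zero C X Y \<oplus> f = f"
proof -
  interpret G: comm_group "hom_group C (Dom C f) (Cod C f)" using assms by (intro hom_comm_group) auto
  show "f \<oplus> Zero C X Y = f" "Zero C X Y \<oplus> f = f"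
    using G.r_one[of f] G.l_one[of f] assms by (auto simp: hom_group_def in_Hom)
qed

lemma Add_Neg [simp]:
  assumes "f \<in> Arr C"
  shows "f \<oplus> Neg C f = Zero C (Dom C f) (Cod C f)" "Neg C f \<oplus> f = Zero C (Dom C f) (Cod C f)"
proof -
  interpret G: comm_group "hom_group C (Dom C f) (Cod C f)" using assms by (intro hom_comm_group) auto
  show "f \<oplus> Neg C f = Zero C (Dom C f) (Cod C f)" "Neg C f \<oplus> f = Zero C (Dom C f) (Cod C f)"
    using G.r_inv[of f] G.l_inv[of f] assms by (auto simp: hom_group_def Neg_def in_Hom)
qed

lemma Neg_unique:
  assumes "f \<in> Arr C" "g \<in> Arr C" "Dom C g = Dom C f" "Cod C g = Cod C f"
    "f \<oplus> g = Zero C (Dom C f) (Cod C f)"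
  shows "g = Neg C f"
proof -
  have "g = (Neg C f \<oplus> f) \<oplus> g" using assms by simp
  also have "\<dots> = Neg C f \<oplus> (f \<oplus> g)" using assms by (intro Add_assoc) auto
  also have "\<dots> = Neg C f" using assms by simp
  finally show ?thesis .
qed

lemma Neg_Neg [simp]: "f \<in> Arr C \<Longrightarrow> Neg C (Neg C f) = f"
  using Neg_unique[of "Neg C f" f] by simp

lemma Neg_eq_iff: "\<lbrakk>f \<in> Arr C; g \<in> Arr C\<rbrakk> \<Longrightarrow> Neg C f = Neg C g \<longleftrightarrow> f = g"
  by (metis Neg_Neg)

lemma Neg_Zero [simp]: "\<lbrakk>X \<in> Obj C; Y \<in> Obj C\<rbrakk> \<Longrightarrow> Neg C (Zero C X Y) = Zero C X Y"
  using Neg_unique[of "Zero C X Y" "Zero C X Y"] by simp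

lemma diff_eq_Zero_iff:
  assumes "f \<in> Arr C" "g \<in> Arr C" "Dom C g = Dom C f" "Cod C g = Cod C f"
  shows "f \<oplus> Neg C g = Zero C (Dom C f) (Cod C f) \<longleftrightarrow> f = g"
  using assms Neg_unique[of f "Neg C g"] Neg_Neg[of f] Neg_Neg[of g] by (metis Add_Neg(1) Neg_simps)

lemma diff_add [simp]:
  assumes "f \<in> Arr C" "g \<in> Arr C" "Dom C g = Dom C f" "Cod C g = Cod C f"
  shows "(f \<oplus> Neg C g) \<oplus> g = f"
  using assms by (simp add: Add_assoc)

lemma Neg_Add:
  assumes "f \<in> Arr C" "g \<in> Arr C" "Dom C g = Dom C f" "Cod C g = Cod C f"
  shows "Neg C (f \<oplus> g) = Neg C f \<oplus> Neg C g"
proof -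
  have "(f \<oplus> g) \<oplus> (Neg C f \<oplus> Neg C g) = (f \<oplus> Neg C f) \<oplus> (g \<oplus> Neg C g)"
    using assms by (simp add: Add_ac del: Add_Neg)
  then show ?thesis using assms Neg_unique[of "f \<oplus> g" "Neg C f \<oplus> Neg C g"] by simp
qed

lemma Comp_Add:
  assumes "f \<in> Arr C" "f' \<in> Arr C" "g \<in> Arr C" "Dom C f' = Dom C f" "Cod C f' = Cod C f"
    "Cod C f = Dom C g"
  shows "g \<cdot> (f \<oplus> f') = (g \<cdot> f) \<oplus> (g \<cdot> f')"
  using assms by (intro comp_add_right) (auto simp: in_Hom)

lemma Add_Comp:
  assumes "f \<in> Arr C" "g' \<in> Arr C" "g \<in> Arr C" "Dom C g' = Dom C g" "Cod C g' = Cod C g"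
    "Cod C f = Dom C g"
  shows "(g \<oplus> g') \<cdot> f = (g \<cdot> f) \<oplus> (g' \<cdot> f)"
  using assms by (intro comp_add_left) (auto simp: in_Hom)

lemma Add_idem_Zero:
  assumes "f \<in> Arr C" "f \<oplus> f = f" shows "f = Zero C (Dom C f) (Cod C f)"
proof -
  have "(f \<oplus> f) \<oplus> Neg C f = f" using assms(1) by (simp add: Add_assoc)
  then show ?thesis using assms by simp
qed

lemma Comp_Zero [simp]:
  assumes "g \<in> Arr C" "X \<in> Obj C" "Dom C g = Y" shows "g \<cdot> Zero C X Y = Zero C X (Cod C g)"
proof -
  have O: "Y \<in> Obj C" using assms by auto
  then have "(g \<cdot> Zero C X Y) \<oplus> (g \<cdot> Zero C X Y) = g \<cdot> Zero C X Y"
    using assms Comp_Add[of "Zero C X Y" "Zero C X Y" g] by simp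
  from Add_idem_Zero[OF _ this] show ?thesis using assms O by simp
qed

lemma Zero_Comp [simp]:
  assumes "f \<in> Arr C" "Y \<in> Obj C" "Cod C f = X" shows "Zero C X Y \<cdot> f = Zero C (Dom C f) Y"
proof -
  have O: "X \<in> Obj C" using assms by auto
  then have "(Zero C X Y \<cdot> f) \<oplus> (Zero C X Y \<cdot> f) = Zero C X Y \<cdot> f"
    using assms Add_Comp[of f "Zero C X Y" "Zero C X Y"] by simp
  from Add_idem_Zero[OF _ this] show ?thesis using assms O by simp
qed

lemma Comp_Neg [simp]:
  assumes "f \<in> Arr C" "g \<in> Arr C" "Cod C f = Dom C g" shows "g \<cdot> Neg C f = Neg C (g \<cdot> f)"
  using assms Neg_unique[of "g \<cdot> f" "g \<cdot> Neg C f"] Comp_Add[of f "Neg C f" g] by simp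

lemma Neg_Comp [simp]:
  assumes "f \<in> Arr C" "g \<in> Arr C" "Cod C f = Dom C g" shows "Neg C g \<cdot> f = Neg C (g \<cdot> f)"
  using assms Neg_unique[of "g \<cdot> f" "Neg C g \<cdot> f"] Add_Comp[of f "Neg C g" g] by simp

lemma is_iso_Neg:
  assumes "is_iso C f" shows "is_iso C (Neg C f)"
proof -
  obtain g where g: "g \<in> Arr C" "Dom C g = Cod C f" "Cod C g = Dom C f"
    "g \<cdot> f = Id C (Dom C f)" "f \<cdot> g = Id C (Cod C f)" "f \<in> Arr C" by (rule is_isoE[OF assms])
  then show ?thesis unfolding is_iso_def by (auto simp: in_Hom intro!: bexI[of _ "Neg C g"])
qed

lemma zero_object_iff: "zero_object C Z \<longleftrightarrow> Z \<in> Obj C \<and> Id C Z = Zero C Z Z"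
proof
  assume Z: "zero_object C Z"
  then have "Z \<in> Obj C" "\<exists>!f. f \<in> Hom C Z Z" by (auto simp: zero_object_def)
  moreover from this have "Id C Z \<in> Hom C Z Z" "Zero C Z Z \<in> Hom C Z Z" by (auto simp: in_Hom)
  ultimately show "Z \<in> Obj C \<and> Id C Z = Zero C Z Z" by blast
next
  assume Z: "Z \<in> Obj C \<and> Id C Z = Zero C Z Z"
  have "f = Zero C X Z" if "f \<in> Hom C X Z" "X \<in> Obj C" for f X
  proof -
    have "f = Id C Z \<cdot> f" using that by (simp add: in_Hom)
    also have "\<dots> = Zero C X Z" using that Z by (auto simp: in_Hom)
    finally show ?thesis .
  qed
  moreover have "f = Zero C Z X" if "f \<in> Hom C Z X" "X \<in> Obj C" for f X
  proof -
    have "f = f \<cdot> Id C Z" using that by (simp add: in_Hom)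
    also have "\<dots> = Zero C Z X" using that Z by (auto simp: in_Hom)
    finally show ?thesis .
  qed
  moreover have "Zero C X Z \<in> Hom C X Z" "Zero C Z X \<in> Hom C Z X" if "X \<in> Obj C" for X
    using that Z by (auto simp: in_Hom)
  ultimately show "zero_object C Z" unfolding zero_object_def using Z by metis
qed

lemma zero_object_Obj: "zero_object C Z \<Longrightarrow> Z \<in> Obj C" by (simp add: zero_object_def)

end

section \<open>Triangulated categories\<close>
context triangulated_category begin

abbreviation S where "S \<equiv> FObj (Susp K)"
abbreviation SA where "SA \<equiv> FArr (Susp K)"

lemma susp_functor: "is_functor K K (Susp K)"
  using susp_additive by (simp add: additive_functor_def)

lemmas susp_simps [simp] = is_functorD[OF susp_functor]

lemma susp_Add [simp]:
  assumes "f \<in> Arr K" "g \<in> Arr K" "Dom K g = Dom K f" "Cod K g = Cod K f"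
  shows "SA (f \<oplus> g) = SA f \<oplus> SA g"
  using susp_additive assms by (auto simp: additive_functor_def in_Hom)

lemma susp_Zero [simp]:
  assumes "X \<in> Obj K" "Y \<in> Obj K" shows "SA (Zero K X Y) = Zero K (S X) (S Y)"
  using Add_idem_Zero[of "SA (Zero K X Y)"] susp_Add[of "Zero K X Y" "Zero K X Y"] assms by simp

lemma susp_Neg [simp]:
  assumes "f \<in> Arr K" shows "SA (Neg K f) = Neg K (SA f)"
  using Neg_unique[of "SA f" "SA (Neg K f)"] susp_Add[of f "Neg K f"] assms by simp

lemma susp_faithful:
  assumes "SA f = SA g" "f \<in> Arr K" "g \<in> Arr K" "Dom K g = Dom K f" "Cod K g = Cod K f"
  shows "f = g"
proof -
  have "bij_betw SA (Hom K (Dom K f) (Cod K f)) (Hom K (S (Dom K f)) (S (Cod K f)))"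
    using susp_equivalence assms by (simp add: is_equivalence_def)
  then show ?thesis using assms by (auto simp: bij_betw_def in_Hom dest: inj_onD)
qed

lemma susp_full:
  assumes "f \<in> Arr K" "X \<in> Obj K" "Y \<in> Obj K" "Dom K f = S X" "Cod K f = S Y"
  obtains g where "g \<in> Arr K" "Dom K g = X" "Cod K g = Y" "f = SA g"
proof -
  have "bij_betw SA (Hom K X Y) (Hom K (S X) (S Y))"
    using susp_equivalence assms by (simp add: is_equivalence_def)
  moreover have "f \<in> Hom K (S X) (S Y)" using assms by (simp add: in_Hom)
  ultimately obtain g where "g \<in> Hom K X Y" "f = SA g" by (auto simp: bij_betw_def)
  then show ?thesis using that by (auto simp: in_Hom)
qed

lemma susp_ess_surj:
  assumes "Z \<in> Obj K"
  obtains X \<theta> where "X \<in> Obj K" "is_iso K \<theta>" "\<theta> \<in> Arr K" "Dom K \<theta> = S X" "Cod K \<theta> = Z"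
  using susp_equivalence assms unfolding is_equivalence_def isomorphic_def by (auto simp: in_Hom)

lemma susp_zero_object: "zero_object K Z \<Longrightarrow> zero_object K (S Z)"
  using susp_simps(5)[of Z] susp_Zero[of Z Z] by (simp add: zero_object_iff)

lemma triD:
  assumes "(f, g, h) \<in> Tri K"
  shows "f \<in> Arr K" "g \<in> Arr K" "h \<in> Arr K" "Cod K f = Dom K g" "Cod K g = Dom K h"
    "Cod K h = S (Dom K f)"
  using assms tri_candidates by (auto simp: candidates_def)

lemma tri_rot: "(f, g, h) \<in> Tri K \<Longrightarrow> (g, h, Neg K (SA f)) \<in> Tri K"
  using tri_rotate[of "(f, g, h)"] tri_candidates by auto

lemma tri_rot_iff:
  assumes "f \<in> Arr K" "g \<in> Arr K" "h \<in> Arr K" "Cod K f = Dom K g" "Cod K g = Dom K h"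
    "Cod K h = S (Dom K f)"
  shows "(f, g, h) \<in> Tri K \<longleftrightarrow> (g, h, Neg K (SA f)) \<in> Tri K"
  using tri_rotate[of "(f, g, h)"] assms by (auto simp: candidates_def)

lemma tri_fillE:
  assumes "(f, g, h) \<in> Tri K" "(f', g', h') \<in> Tri K" "a \<in> Arr K" "Dom K a = Dom K f"
    "Cod K a = Dom K f'"
    "b \<in> Arr K" "Dom K b = Dom K g" "Cod K b = Dom K g'" "b \<cdot> f = f' \<cdot> a"
  obtains c where "c \<in> Arr K" "Dom K c = Cod K g" "Cod K c = Cod K g'" "c \<cdot> g = g' \<cdot> b"
    "SA a \<cdot> h = h' \<cdot> c"
proof -
  have "\<exists>c. tri_mor K (Susp K) (f, g, h) (f', g', h') a b c"
    using assms triD[OF assms(1)] triD[OF assms(2)] by (intro tri_fill) (auto simp: in_Hom)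
  then show ?thesis using that by (auto simp: in_Hom)
qed

text \<open>Compare with the triangle on \<open>Id X\<close>, whose third object is zero.\<close>
lemma tri_comp_zero:
  assumes T: "(f, g, h) \<in> Tri K" shows "g \<cdot> f = Zero K (Dom K f) (Cod K g)"
proof -
  note t = triD[OF T]
  obtain Z where Z: "zero_object K Z" using ex_zero_object by auto
  then have ZO: "Z \<in> Obj K" by (rule zero_object_Obj)
  obtain c where c: "c \<in> Arr K" "Dom K c = Z" "Cod K c = Cod K g"
    "c \<cdot> Zero K (Dom K f) Z = g \<cdot> f"
    by (rule tri_fillE[OF tri_id[of "Dom K f" Z] T, of "Id K (Dom K f)" f]) (use t Z ZO in auto)
  then show ?thesis using t by simp
qed

lemma tri_comp_zero2:
  assumes T: "(f, g, h) \<in> Tri K" shows "h \<cdot> g = Zero K (Dom K g) (S (Dom K f))"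
  using tri_comp_zero[OF tri_rot[OF T]] triD[OF T] by simp

text \<open>Two rotations give the statement for \<open>- \<Sigma>f\<close>; the sign is then removed.\<close>
lemma tri_comp_zero3:
  assumes T: "(f, g, h) \<in> Tri K" shows "SA f \<cdot> h = Zero K (Dom K h) (S (Cod K f))"
proof -
  note t = triD[OF T]
  have "Neg K (SA f) \<cdot> h = Zero K (Dom K h) (S (Cod K f))"
    using tri_comp_zero[OF tri_rot[OF tri_rot[OF T]]] tri_comp_zero[OF tri_rot[OF T]] t
     tri_comp_zero2[OF tri_rot[OF T]] by simp
  then have "Neg K (Neg K (SA f \<cdot> h)) = Neg K (Zero K (Dom K h) (S (Cod K f)))" using t by simp
  then show ?thesis using t by (simp del: Neg_Neg) (simp)
qed

text \<open>
  The arrow \<open>m\<close> is the middle of a morphism to the triangle \<open>0 \<rightarrow> M \<rightarrow> M\<close>, whose third component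
  is the required factorization.
\<close>
lemma tri_weak_cokernel:
  assumes T: "(f, g, h) \<in> Tri K" and m: "m \<in> Arr K" "Dom K m = Dom K g"
    "m \<cdot> f = Zero K (Dom K f) (Cod K m)"
  obtains m' where "m' \<in> Arr K" "Dom K m' = Cod K g" "Cod K m' = Cod K m" "m' \<cdot> g = m"
proof -
  note t = triD[OF T]
  obtain Z where Z: "zero_object K Z" using ex_zero_object by auto
  then have ZO: "Z \<in> Obj K" by (rule zero_object_Obj)
  have "(Zero K Z (Cod K m), Id K (Cod K m), Zero K (Cod K m) (S Z)) \<in> Tri K"
  proof (subst tri_rot_iff)
    show "(Id K (Cod K m), Zero K (Cod K m) (S Z), Neg K (SA (Zero K Z (Cod K m)))) \<in> Tri K"
      using tri_id[of "Cod K m" "S Z"] susp_zero_object[OF Z] m ZO by simp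
  qed (use m ZO in auto)
  then obtain c where "c \<in> Arr K" "Dom K c = Cod K g" "Cod K c = Cod K m" "c \<cdot> g = Id K (Cod K m) \<cdot> m"
    by (rule tri_fillE[OF T _, of _ _ _ "Zero K (Dom K f) Z" m]) (use t m ZO in auto)
  then show ?thesis using that m by auto
qed

text \<open>
  Dually, \<open>m\<close> is the first component of a morphism from \<open>M \<rightarrow> 0 \<rightarrow> \<Sigma>M\<close> to the rotated triangle.
  Its third component is an arrow \<open>\<Sigma>M \<rightarrow> \<Sigma>X\<close>, which desuspends because \<open>\<Sigma>\<close> is full and faithful.
\<close>
lemma tri_weak_kernel:
  assumes T: "(f, g, h) \<in> Tri K" and m: "m \<in> Arr K" "Cod K m = Dom K g"
    "g \<cdot> m = Zero K (Dom K m) (Cod K g)"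
  obtains m' where "m' \<in> Arr K" "Dom K m' = Dom K m" "Cod K m' = Dom K f" "f \<cdot> m' = m"
proof -
  note t = triD[OF T]
  obtain Z where Z: "zero_object K Z" using ex_zero_object by auto
  then have ZO: "Z \<in> Obj K" by (rule zero_object_Obj)
  have I: "(Zero K (Dom K m) Z, Zero K Z (S (Dom K m)), Neg K (SA (Id K (Dom K m)))) \<in> Tri K"
    using tri_rot[OF tri_id[of "Dom K m" Z]] Z m by simp
  obtain c where c: "c \<in> Arr K" "Dom K c = S (Dom K m)" "Cod K c = S (Dom K f)"
      "SA m \<cdot> Neg K (SA (Id K (Dom K m))) = Neg K (SA f) \<cdot> c"
    by (rule tri_fillE[OF I tri_rot[OF T], of m "Zero K Z (Cod K g)"]) (use t m ZO in auto)
  obtain m' where m': "m' \<in> Arr K" "Dom K m' = Dom K m" "Cod K m' = Dom K f" "c = SA m'"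
    using susp_full[of c "Dom K m" "Dom K f"] c t m by auto
  have "SA (Neg K m) = SA (Neg K (f \<cdot> m'))" using c(4) m' t m by simp
  then have "Neg K m = Neg K (f \<cdot> m')" by (rule susp_faithful) (use m' t m in auto)
  then have "f \<cdot> m' = m" using m' m t Neg_eq_iff[of m "f \<cdot> m'"] by simp
  then show ?thesis using that m' by auto
qed

text \<open>
  The identity of \<open>Cod g\<close> is annihilated by the third arrow, so it lifts along \<open>g\<close>; the identity
  of \<open>\<Sigma>(Dom f)\<close> composed with the third arrow is zero, so it extends along \<open>- \<Sigma>f\<close>, and the
  extension desuspends.
\<close>
lemma tri_split:
  assumes T: "(f, g, Zero K X Y) \<in> Tri K" and h: "X \<in> Obj K" "Y \<in> Obj K"
  shows "\<exists>r. r \<in> Arr K \<and> Dom K r = Cod K f \<and> Cod K r = Dom K f \<and> r \<cdot> f = Id K (Dom K f)"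
    "\<exists>s. s \<in> Arr K \<and> Dom K s = Cod K g \<and> Cod K s = Dom K g \<and> g \<cdot> s = Id K (Cod K g)"
proof -
  note t = triD[OF T]
  obtain s where "s \<in> Arr K" "Dom K s = Cod K g" "Cod K s = Dom K g" "g \<cdot> s = Id K (Cod K g)"
    by (rule tri_weak_kernel[OF tri_rot[OF T], of "Id K (Cod K g)"]) (use t h in auto)
  then show "\<exists>s. s \<in> Arr K \<and> Dom K s = Cod K g \<and> Cod K s = Dom K g \<and> g \<cdot> s = Id K (Cod K g)" by auto
  obtain m where m: "m \<in> Arr K" "Dom K m = S (Cod K f)" "Cod K m = S (Dom K f)"
     "m \<cdot> Neg K (SA f) = Id K (S (Dom K f))"
    by (rule tri_weak_cokernel[OF tri_rot[OF tri_rot[OF T]], of "Id K (S (Dom K f))"]) (use t h in auto)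
  obtain r where r: "r \<in> Arr K" "Dom K r = Cod K f" "Cod K r = Dom K f" "m = SA r"
    using susp_full[of m "Cod K f" "Dom K f"] m t by auto
  have "SA (Neg K r \<cdot> f) = SA (Id K (Dom K f))" using m(4) r t by simp
  then have "Neg K r \<cdot> f = Id K (Dom K f)" by (rule susp_faithful) (use r t in auto)
  then show "\<exists>r. r \<in> Arr K \<and> Dom K r = Cod K f \<and> Cod K r = Dom K f \<and> r \<cdot> f = Id K (Dom K f)"
    using r by (intro exI[of _ "Neg K r"]) auto
qed

text \<open>
  As \<open>\<Sigma>\<close> is only an equivalence, the third object of a triangle is a suspension merely up to an
  isomorphism \<open>\<theta>\<close>. Replacing it along \<open>\<theta>\<close> makes the inverse rotation possible.
\<close>
lemma tri_rot_back:
  assumes T: "(g, h, k) \<in> Tri K"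
  obtains f h' \<theta> where "(f, g, h') \<in> Tri K" "is_iso K \<theta>" "\<theta> \<in> Arr K" "Dom K \<theta> = S (Dom K f)"
    "Cod K \<theta> = Cod K h" "h = \<theta> \<cdot> h'"
proof -
  note t = triD[OF T]
  obtain X \<theta> where \<theta>: "X \<in> Obj K" "is_iso K \<theta>" "\<theta> \<in> Arr K" "Dom K \<theta> = S X" "Cod K \<theta> = Cod K h"
    using susp_ess_surj[of "Cod K h"] t by auto
  obtain \<theta>' where \<theta>': "\<theta>' \<in> Arr K" "Dom K \<theta>' = Cod K h" "Cod K \<theta>' = S X" "is_iso K \<theta>'"
    "\<theta>' \<cdot> \<theta> = Id K (S X)" "\<theta> \<cdot> \<theta>' = Id K (Cod K h)" using is_isoE[OF \<theta>(2)] \<theta> by metis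
  obtain f where f: "f \<in> Arr K" "Dom K f = X" "Cod K f = Dom K g" "k \<cdot> \<theta> = SA f"
    using susp_full[of "k \<cdot> \<theta>" X "Dom K g"] t \<theta> by auto
  have hh: "\<theta> \<cdot> (\<theta>' \<cdot> h) = h" using Comp_assoc[of h \<theta>' \<theta>] \<theta> \<theta>' t by simp
  have kk: "(k \<cdot> \<theta>) \<cdot> \<theta>' = k" using Comp_assoc[of \<theta>' \<theta> k] \<theta> \<theta>' t by simp
  have "(g, \<theta>' \<cdot> h, SA f) \<in> Tri K"
  proof (rule tri_iso_closed[OF T])
    show "(g, \<theta>' \<cdot> h, SA f) \<in> candidates K (Susp K)" using t \<theta>' f by (auto simp: candidates_def)
    show "tri_isomorphic K (Susp K) (g, h, k) (g, \<theta>' \<cdot> h, SA f)"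
      unfolding tri_isomorphic_def
      apply (rule exI[of _ "Id K (Dom K g)"], rule exI[of _ "Id K (Cod K g)"], rule exI[of _ \<theta>'])
      using t \<theta>' f \<theta> kk by (auto simp: in_Hom)
  qed
  then have "(Neg K f, g, \<theta>' \<cdot> h) \<in> Tri K"
    by (subst tri_rot_iff) (use t \<theta>' f in auto)
  from that[OF this] show ?thesis using \<theta> f hh by auto
qed

lemma tri_complete_mid:
  assumes "g \<in> Arr K" obtains f h where "(f, g, h) \<in> Tri K"
  using tri_complete[OF assms] tri_rot_back by metis

end

section \<open>The quotient by the arrows that factor through a class of objects\<close>

text \<open>
  Closure under biproducts is what makes the arrows factoring through \<open>P\<close> closed under addition,
  hence an ideal.
\<close>
locale object_ideal = additive_category C for C :: "('o, 'm, 'z) preadd_scheme" (structure) +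
  fixes P :: "'o set"
  assumes P_Obj: "P \<subseteq> Obj C"
    and P_nonempty: "P \<noteq> {}"
    and P_biproduct: "\<lbrakk>A \<in> P; B \<in> P; biproduct C A B D i j p q\<rbrakk> \<Longrightarrow> D \<in> P"
begin

abbreviation null where "null f \<equiv> factors_through C P f"

lemma nullI:
  assumes "a \<in> Arr C" "b \<in> Arr C" "Cod C a = Dom C b" "Dom C b \<in> P"
  shows "null (b \<cdot> a)"
  using assms unfolding factors_through_def
  by (intro bexI[of _ "Dom C b"] bexI[of _ a] bexI[of _ b]) (auto simp: in_Hom)

lemma nullE:
  assumes "null f"
  obtains a b where "a \<in> Arr C" "b \<in> Arr C" "Cod C a = Dom C b" "Dom C b \<in> P" "Dom C a = Dom C f"
    "Cod C b = Cod C f" "b \<cdot> a = f"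
  using assms unfolding factors_through_def Bex_def in_Hom by metis

lemma null_Zero: assumes "X \<in> Obj C" "Y \<in> Obj C" shows "null (Zero C X Y)"
proof -
  obtain A where A: "A \<in> P" using P_nonempty by auto
  then have AO: "A \<in> Obj C" using P_Obj by auto
  show ?thesis using nullI[of "Zero C X A" "Zero C A Y"] A AO assms by simp
qed

lemma null_Comp_left:
  assumes "null f" "f \<in> Arr C" "g \<in> Arr C" "Cod C f = Dom C g" shows "null (g \<cdot> f)"
proof -
  obtain a b where ab: "a \<in> Arr C" "b \<in> Arr C" "Cod C a = Dom C b" "Dom C b \<in> P" "Dom C a = Dom C f"
    "Cod C b = Cod C f" "b \<cdot> a = f" using assms(1) by (rule nullE)
  have "null ((g \<cdot> b) \<cdot> a)" by (rule nullI) (use ab assms(2-4) in auto)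
  then show ?thesis using ab assms(2-4) by (simp add: Comp_assoc)
qed

lemma null_Comp_right:
  assumes "null f" "f \<in> Arr C" "g \<in> Arr C" "Cod C g = Dom C f" shows "null (f \<cdot> g)"
proof -
  obtain a b where ab: "a \<in> Arr C" "b \<in> Arr C" "Cod C a = Dom C b" "Dom C b \<in> P" "Dom C a = Dom C f"
    "Cod C b = Cod C f" "b \<cdot> a = f" using assms(1) by (rule nullE)
  have "null (b \<cdot> (a \<cdot> g))" by (rule nullI) (use ab assms(2-4) in auto)
  then show ?thesis using ab assms(2-4) Comp_cong_assoc[OF ab(7), of g] by simp
qed

lemma null_Neg:
  assumes "null f" "f \<in> Arr C" shows "null (Neg C f)"
proof -
  obtain a b where ab: "a \<in> Arr C" "b \<in> Arr C" "Cod C a = Dom C b" "Dom C b \<in> P" "Dom C a = Dom C f"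
    "Cod C b = Cod C f" "b \<cdot> a = f" using assms(1) by (rule nullE)
  have "null (Neg C b \<cdot> a)" by (rule nullI) (use ab in auto)
  then show ?thesis using ab by simp
qed

text \<open>\<open>b a + d c\<close> factors through the biproduct of the two intermediate objects.\<close>
lemma null_Add:
  assumes f: "null f" "f \<in> Arr C" and g: "null g" "g \<in> Arr C" "Dom C g = Dom C f" "Cod C g = Cod C f"
  shows "null (f \<oplus> g)"
proof -
  obtain a b where ab: "a \<in> Arr C" "b \<in> Arr C" "Cod C a = Dom C b" "Dom C b \<in> P" "Dom C a = Dom C f"
    "Cod C b = Cod C f" "b \<cdot> a = f" using f(1) by (rule nullE)
  obtain c d where cd: "c \<in> Arr C" "d \<in> Arr C" "Cod C c = Dom C d" "Dom C d \<in> P" "Dom C c = Dom C g"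
    "Cod C d = Cod C g" "d \<cdot> c = g" using g(1) by (rule nullE)
  obtain B i j p q where B: "biproduct C (Dom C b) (Dom C d) B i j p q"
    using ex_biproduct[of "Dom C b" "Dom C d"] ab cd by auto
  then have BP: "B \<in> P" using P_biproduct ab cd by blast
  have bi: "i \<in> Arr C" "j \<in> Arr C" "p \<in> Arr C" "q \<in> Arr C" "Dom C i = Dom C b" "Dom C j = Dom C d"
    "Cod C i = B" "Cod C j = B" "Dom C p = B" "Dom C q = B" "Cod C p = Dom C b" "Cod C q = Dom C d"
    "p \<cdot> i = Id C (Dom C b)" "q \<cdot> j = Id C (Dom C d)" "p \<cdot> j = Zero C (Dom C d) (Dom C b)"
    "q \<cdot> i = Zero C (Dom C b) (Dom C d)"
    using B by (auto simp: biproduct_def in_Hom)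
  let ?u = "(i \<cdot> a) \<oplus> (j \<cdot> c)" and ?v = "(b \<cdot> p) \<oplus> (d \<cdot> q)"
  have T: "?u \<in> Arr C" "?v \<in> Arr C" "Cod C ?u = Dom C ?v" "Dom C ?v = B"
    using ab cd bi f g by auto
  have 1: "p \<cdot> (i \<cdot> a) = a" "p \<cdot> (j \<cdot> c) = Zero C (Dom C c) (Dom C b)"
    "q \<cdot> (i \<cdot> a) = Zero C (Dom C a) (Dom C d)" "q \<cdot> (j \<cdot> c) = c"
    using Comp_cong_assoc[OF bi(13), of a] Comp_cong_assoc[OF bi(14), of c]
      Comp_cong_assoc[OF bi(15), of c] Comp_cong_assoc[OF bi(16), of a] ab cd bi(1-12) by simp_all
  have "?v \<cdot> ?u = f \<oplus> g"
    using ab cd bi(1-12) f g 1 by (simp add: Comp_Add Add_Comp Comp_assoc)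
  then show ?thesis using nullI[OF T(1-3)] T(4) BP by simp
qed

definition cong where
  "cong f g \<longleftrightarrow> f \<in> Arr C \<and> g \<in> Arr C \<and> Dom C g = Dom C f \<and> Cod C g = Cod C f \<and> null (f \<oplus> Neg C g)"

lemma cong_refl [simp]: "f \<in> Arr C \<Longrightarrow> cong f f"
  by (simp add: cong_def null_Zero)

lemma cong_sym: assumes "cong f g" shows "cong g f"
proof -
  have *: "f \<in> Arr C" "g \<in> Arr C" "Dom C g = Dom C f" "Cod C g = Cod C f" "null (f \<oplus> Neg C g)"
    using assms by (auto simp: cong_def)
  have "Neg C (f \<oplus> Neg C g) = g \<oplus> Neg C f"
    using * by (simp add: Neg_Add Add_commute)
  then show ?thesis using * null_Neg[of "f \<oplus> Neg C g"] by (simp add: cong_def)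
qed

lemma cong_trans: assumes "cong f g" "cong g h" shows "cong f h"
proof -
  have *: "f \<in> Arr C" "g \<in> Arr C" "Dom C g = Dom C f" "Cod C g = Cod C f" "null (f \<oplus> Neg C g)"
    "h \<in> Arr C" "Dom C h = Dom C f" "Cod C h = Cod C f" "null (g \<oplus> Neg C h)"
    using assms by (auto simp: cong_def)
  have "(f \<oplus> Neg C g) \<oplus> (g \<oplus> Neg C h) = ((f \<oplus> Neg C g) \<oplus> g) \<oplus> Neg C h"
    by (rule Add_assoc[symmetric]) (use * in auto)
  also have "\<dots> = f \<oplus> Neg C h" using * by simp
  finally show ?thesis using * null_Add[of "f \<oplus> Neg C g" "g \<oplus> Neg C h"] by (simp add: cong_def)
qed

lemma cong_Comp:
  assumes f: "cong f f'" and g: "cong g g'" and fg: "Cod C f = Dom C g"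
  shows "cong (g \<cdot> f) (g' \<cdot> f')"
proof -
  have *: "f \<in> Arr C" "f' \<in> Arr C" "Dom C f' = Dom C f" "Cod C f' = Cod C f" "null (f \<oplus> Neg C f')"
    "g \<in> Arr C" "g' \<in> Arr C" "Dom C g' = Dom C g" "Cod C g' = Cod C g" "null (g \<oplus> Neg C g')"
    using f g by (auto simp: cong_def)
  have "cong (g \<cdot> f) (g \<cdot> f')"
    using * fg null_Comp_left[of "f \<oplus> Neg C f'" g] by (simp add: cong_def Comp_Add)
  moreover have "cong (g \<cdot> f') (g' \<cdot> f')"
    using * fg null_Comp_right[of "g \<oplus> Neg C g'" f'] by (simp add: cong_def Add_Comp)
  ultimately show ?thesis by (rule cong_trans)
qed

lemma cong_Add:
  assumes f: "cong f f'" and g: "cong g g'" and fg: "Dom C g = Dom C f" "Cod C g = Cod C f"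
  shows "cong (f \<oplus> g) (f' \<oplus> g')"
proof -
  have *: "f \<in> Arr C" "f' \<in> Arr C" "Dom C f' = Dom C f" "Cod C f' = Cod C f" "null (f \<oplus> Neg C f')"
    "g \<in> Arr C" "g' \<in> Arr C" "Dom C g' = Dom C g" "Cod C g' = Cod C g" "null (g \<oplus> Neg C g')"
    using f g by (auto simp: cong_def)
  have "(f \<oplus> Neg C f') \<oplus> (g \<oplus> Neg C g') = (f \<oplus> g) \<oplus> Neg C (f' \<oplus> g')"
    using * fg by (simp add: Neg_Add Add_ac)
  then show ?thesis
    using * fg null_Add[of "f \<oplus> Neg C f'" "g \<oplus> Neg C g'"] by (simp add: cong_def)
qed

lemma cong_typed:
  assumes "cong f g"
  shows "f \<in> Arr C" "g \<in> Arr C" "Dom C g = Dom C f" "Cod C g = Cod C f"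
  using assms by (auto simp: cong_def)

lemma null_cong_Zero:
  assumes "f \<in> Arr C" shows "null f \<longleftrightarrow> cong f (Zero C (Dom C f) (Cod C f))"
  using assms by (simp add: cong_def)

abbreviation cls where "cls \<equiv> coset C P"

lemma mem_cls: "f \<in> Arr C \<Longrightarrow> g \<in> cls f \<longleftrightarrow> cong g f"
  by (auto simp: coset_def cong_def in_Hom)

lemma self_mem_cls: "f \<in> Arr C \<Longrightarrow> f \<in> cls f" by (simp add: mem_cls)

lemma cls_eq_iff:
  assumes "f \<in> Arr C" "g \<in> Arr C" shows "cls f = cls g \<longleftrightarrow> cong f g"
proof
  assume "cls f = cls g"
  then have "f \<in> cls g" using self_mem_cls[OF assms(1)] by simp
  then show "cong f g" using mem_cls[OF assms(2)] by simp
next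
  assume "cong f g"
  then show "cls f = cls g"
    using mem_cls[OF assms(1)] mem_cls[OF assms(2)] cong_sym cong_trans by blast
qed

end

text \<open>
  Stated for any record with the data of the additive quotient, so that it applies directly to
  the stable category, which adds a suspension and triangles.
\<close>
locale quotient_by_ideal = object_ideal C P for C :: "('o, 'm, 'z) preadd_scheme" (structure) and P +
  fixes L :: "('o, 'm set, 'y) preadd_scheme"
  assumes L_data: "Obj L = Obj (additive_quotient C P)" "Arr L = Arr (additive_quotient C P)"
    "Dom L = Dom (additive_quotient C P)" "Cod L = Cod (additive_quotient C P)"
    "Id L = Id (additive_quotient C P)" "Comp L = Comp (additive_quotient C P)"
    "Zero L = Zero (additive_quotient C P)" "Add L = Add (additive_quotient C P)"
begin

lemma Obj_L [simp]: "Obj L = Obj C" by (simp add: L_data additive_quotient_def)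
lemma Id_L: "Id L X = cls (Id C X)" by (simp add: L_data additive_quotient_def)

lemma cls_Arr [simp]: "f \<in> Arr C \<Longrightarrow> cls f \<in> Arr L" by (simp add: L_data additive_quotient_def)

lemma cls_Dom [simp]: assumes "f \<in> Arr C" shows "Dom L (cls f) = Dom C f"
  unfolding L_data additive_quotient_def
  by (simp, rule the_equality) (use assms mem_cls cong_typed self_mem_cls in metis)+

lemma cls_Cod [simp]: assumes "f \<in> Arr C" shows "Cod L (cls f) = Cod C f"
  unfolding L_data additive_quotient_def
  by (simp, rule the_equality) (use assms mem_cls cong_typed self_mem_cls in metis)+

lemma cls_Comp [simp]:
  assumes "f \<in> Arr C" "g \<in> Arr C" "Cod C f = Dom C g"
  shows "cls g \<cdot>\<^bsub>L\<^esub> cls f = cls (g \<cdot> f)"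
proof -
  have "(THE H. \<exists>f' \<in> cls f. \<exists>g' \<in> cls g. H = cls (g' \<cdot> f')) = cls (g \<cdot> f)"
  proof (rule the_equality)
    show "\<exists>f' \<in> cls f. \<exists>g' \<in> cls g. cls (g \<cdot> f) = cls (g' \<cdot> f')"
      using assms self_mem_cls by blast
  next
    fix H assume "\<exists>f' \<in> cls f. \<exists>g' \<in> cls g. H = cls (g' \<cdot> f')"
    then obtain f' g' where *: "cong f' f" "cong g' g" "H = cls (g' \<cdot> f')"
      using assms by (auto simp: mem_cls)
    then have "Cod C f' = Dom C g'" using assms(3) cong_typed by metis
    then have "cong (g' \<cdot> f') (g \<cdot> f)" using * by (intro cong_Comp) auto
    then show "H = cls (g \<cdot> f)" using * cls_eq_iff cong_typed by blast
  qed
  then show ?thesis unfolding L_data additive_quotient_def by simp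
qed

lemma cls_Add [simp]:
  assumes "f \<in> Arr C" "g \<in> Arr C" "Dom C g = Dom C f" "Cod C g = Cod C f"
  shows "cls f \<oplus>\<^bsub>L\<^esub> cls g = cls (f \<oplus> g)"
proof -
  have "(THE H. \<exists>f' \<in> cls f. \<exists>g' \<in> cls g. H = cls (f' \<oplus> g')) = cls (f \<oplus> g)"
  proof (rule the_equality)
    show "\<exists>f' \<in> cls f. \<exists>g' \<in> cls g. cls (f \<oplus> g) = cls (f' \<oplus> g')"
      using assms self_mem_cls by blast
  next
    fix H assume "\<exists>f' \<in> cls f. \<exists>g' \<in> cls g. H = cls (f' \<oplus> g')"
    then obtain f' g' where *: "cong f' f" "cong g' g" "H = cls (f' \<oplus> g')"
      using assms by (auto simp: mem_cls)
    then have "Dom C g' = Dom C f'" "Cod C g' = Cod C f'" using assms(3,4) cong_typed by metis+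
    then have "cong (f' \<oplus> g') (f \<oplus> g)" using * by (intro cong_Add) auto
    then show "H = cls (f \<oplus> g)" using * cls_eq_iff cong_typed by blast
  qed
  then show ?thesis unfolding L_data additive_quotient_def by simp
qed

lemma L_ArrE:
  assumes "F \<in> Arr L" obtains f where "f \<in> Arr C" "F = cls f"
  using assms by (auto simp: L_data additive_quotient_def)

lemma category_L: "category L"
proof
  show "\<And>f. f \<in> Arr L \<Longrightarrow> Dom L f \<in> Obj L" "\<And>f. f \<in> Arr L \<Longrightarrow> Cod L f \<in> Obj L"
    by (auto elim!: L_ArrE)
  show "\<And>X. X \<in> Obj L \<Longrightarrow> Id L X \<in> Hom L X X" by (auto simp: in_Hom Id_L)
  show "\<And>f X Y g Z. \<lbrakk>f \<in> Hom L X Y; g \<in> Hom L Y Z\<rbrakk> \<Longrightarrow> g \<cdot>\<^bsub>L\<^esub> f \<in> Hom L X Z"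
    by (auto simp: in_Hom elim!: L_ArrE)
  show "\<And>f W X g Y h Z. \<lbrakk>f \<in> Hom L W X; g \<in> Hom L X Y; h \<in> Hom L Y Z\<rbrakk>
    \<Longrightarrow> h \<cdot>\<^bsub>L\<^esub> (g \<cdot>\<^bsub>L\<^esub> f) = h \<cdot>\<^bsub>L\<^esub> g \<cdot>\<^bsub>L\<^esub> f"
    by (auto simp: in_Hom Comp_assoc elim!: L_ArrE)
  show "\<And>f X Y. f \<in> Hom L X Y \<Longrightarrow> Id L Y \<cdot>\<^bsub>L\<^esub> f = f" "\<And>f X Y. f \<in> Hom L X Y \<Longrightarrow> f \<cdot>\<^bsub>L\<^esub> Id L X = f"
    by (auto simp: in_Hom Id_L elim!: L_ArrE)
qed

lemma is_iso_cls_iff: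
  assumes f: "f \<in> Arr C"
  shows "is_iso L (cls f) \<longleftrightarrow> (\<exists>g. g \<in> Arr C \<and> Dom C g = Cod C f \<and> Cod C g = Dom C f \<and>
    cong (g \<cdot> f) (Id C (Dom C f)) \<and> cong (f \<cdot> g) (Id C (Cod C f)))" (is "_ \<longleftrightarrow> ?R")
proof
  assume "is_iso L (cls f)"
  then obtain G where G: "G \<in> Arr L" "Dom L G = Cod C f" "Cod L G = Dom C f"
    "G \<cdot>\<^bsub>L\<^esub> cls f = Id L (Dom C f)" "cls f \<cdot>\<^bsub>L\<^esub> G = Id L (Cod C f)"
    using f by (auto simp: is_iso_def in_Hom)
  then obtain g where g: "g \<in> Arr C" "G = cls g" by (auto elim: L_ArrE)
  then show ?R using G f by (intro exI[of _ g]) (auto simp: Id_L cls_eq_iff)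
next
  assume ?R
  then obtain g where "g \<in> Arr C" "Dom C g = Cod C f" "Cod C g = Dom C f"
    "cong (g \<cdot> f) (Id C (Dom C f))" "cong (f \<cdot> g) (Id C (Cod C f))" by blast
  then show "is_iso L (cls f)" unfolding is_iso_def using f
    by (intro conjI bexI[of _ "cls g"]) (simp_all add: in_Hom Id_L cls_eq_iff)
qed

end

section \<open>Frobenius classes and the relative stable category\<close>
lemma tri_isomorphic_trans:
  assumes C: "category C" and S: "is_functor C C S"
    and T: "T \<in> candidates C S" "T' \<in> candidates C S" "T'' \<in> candidates C S"
    and 1: "tri_isomorphic C S T T'" and 2: "tri_isomorphic C S T' T''"
  shows "tri_isomorphic C S T T''"
proof -
  interpret category C by fact
  note [simp] = is_functorD[OF S]
  obtain f g h where T1: "T = (f, g, h)" by (cases T)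
  obtain f' g' h' where T2: "T' = (f', g', h')" by (cases T')
  obtain f'' g'' h'' where T3: "T'' = (f'', g'', h'')" by (cases T'')
  have t: "f \<in> Arr C" "g \<in> Arr C" "h \<in> Arr C" "Cod C f = Dom C g" "Cod C g = Dom C h"
    "Cod C h = FObj S (Dom C f)"
     "f' \<in> Arr C" "g' \<in> Arr C" "h' \<in> Arr C" "Cod C f' = Dom C g'" "Cod C g' = Dom C h'"
     "Cod C h' = FObj S (Dom C f')"
     "f'' \<in> Arr C" "g'' \<in> Arr C" "h'' \<in> Arr C" "Cod C f'' = Dom C g''" "Cod C g'' = Dom C h''"
     "Cod C h'' = FObj S (Dom C f'')"
    using T by (auto simp: T1 T2 T3 candidates_def)
  obtain a b c where a: "a \<in> Arr C" "b \<in> Arr C" "c \<in> Arr C" "Dom C a = Dom C f" "Cod C a = Dom C f'"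
    "Dom C b = Dom C g" "Cod C b = Dom C g'" "Dom C c = Dom C h" "Cod C c = Dom C h'"
    "b \<cdot>\<^bsub>C\<^esub> f = f' \<cdot>\<^bsub>C\<^esub> a" "c \<cdot>\<^bsub>C\<^esub> g = g' \<cdot>\<^bsub>C\<^esub> b" "FArr S a \<cdot>\<^bsub>C\<^esub> h = h' \<cdot>\<^bsub>C\<^esub> c"
    "is_iso C a" "is_iso C b" "is_iso C c"
    using 1 t unfolding T1 T2 tri_isomorphic_def by (auto simp: in_Hom)
  obtain a' b' c' where a': "a' \<in> Arr C" "b' \<in> Arr C" "c' \<in> Arr C" "Dom C a' = Dom C f'"
    "Cod C a' = Dom C f''"
    "Dom C b' = Dom C g'" "Cod C b' = Dom C g''" "Dom C c' = Dom C h'" "Cod C c' = Dom C h''"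
    "b' \<cdot>\<^bsub>C\<^esub> f' = f'' \<cdot>\<^bsub>C\<^esub> a'" "c' \<cdot>\<^bsub>C\<^esub> g' = g'' \<cdot>\<^bsub>C\<^esub> b'" "FArr S a' \<cdot>\<^bsub>C\<^esub> h' = h'' \<cdot>\<^bsub>C\<^esub> c'"
    "is_iso C a'" "is_iso C b'" "is_iso C c'"
    using 2 t unfolding T2 T3 tri_isomorphic_def by (auto simp: in_Hom)
  have "(b' \<cdot>\<^bsub>C\<^esub> b) \<cdot>\<^bsub>C\<^esub> f = f'' \<cdot>\<^bsub>C\<^esub> (a' \<cdot>\<^bsub>C\<^esub> a)"
    using t a(1-10) a'(1-10) Comp_cong_assoc[OF a'(10), of a] by (simp add: Comp_assoc)
  moreover have "(c' \<cdot>\<^bsub>C\<^esub> c) \<cdot>\<^bsub>C\<^esub> g = g'' \<cdot>\<^bsub>C\<^esub> (b' \<cdot>\<^bsub>C\<^esub> b)"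
    using t a(1-9,11) a'(1-9,11) Comp_cong_assoc[OF a'(11), of b] by (simp add: Comp_assoc)
  moreover have "FArr S (a' \<cdot>\<^bsub>C\<^esub> a) \<cdot>\<^bsub>C\<^esub> h = h'' \<cdot>\<^bsub>C\<^esub> (c' \<cdot>\<^bsub>C\<^esub> c)"
    using t a(1-9,12) a'(1-9,12) Comp_cong_assoc[OF a'(12), of c] by (simp add: Comp_assoc)
  ultimately show ?thesis unfolding T1 T3 tri_isomorphic_def
    by (intro exI[of _ "a' \<cdot>\<^bsub>C\<^esub> a"] exI[of _ "b' \<cdot>\<^bsub>C\<^esub> b"] exI[of _ "c' \<cdot>\<^bsub>C\<^esub> c"])
      (use t a(1-9,13-15) a'(1-9,13-15) in \<open>simp add: in_Hom is_iso_Comp\<close>)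
qed

text \<open>
  The triangles of a stable category and of a Verdier quotient are defined in terms of the
  underlying preadditive category; this carries them over to the triangulated category on top of
  it.
\<close>
lemma tri_isomorphic_cong:
  assumes "Arr C = Arr D" "Dom C = Dom D" "Cod C = Cod D" "Id C = Id D" "Comp C = Comp D"
  shows "tri_isomorphic C S = tri_isomorphic D S" "candidates C S = candidates D S"
proof -
  have H: "Hom C = Hom D" using assms by (simp add: Hom_def fun_eq_iff)
  have "tri_mor C S T T' a b c = tri_mor D S T T' a b c" for T T' a b c
    by (cases T; cases T') (simp add: H assms)
  moreover have "is_iso C f = is_iso D f" for f by (simp add: is_iso_def H assms)
  ultimately show "tri_isomorphic C S = tri_isomorphic D S" unfolding tri_isomorphic_def fun_eq_iff
    by simp
  show "candidates C S = candidates D S" by (simp add: candidates_def assms)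
qed

context proper_class begin

lemma E_projD:
  assumes "P \<in> E_proj K E" "(f, g, h) \<in> E"
  shows "inj_on (\<lambda>a. f \<cdot> a) (Hom K P (Dom K f))" "(\<lambda>b. g \<cdot> b) ` Hom K P (Dom K g) = Hom K P (Cod K g)"
  using bspec[OF CollectD[OF assms(1)[unfolded E_proj_def], THEN conjunct2] assms(2)] by simp_all

lemma E_injD:
  assumes "P \<in> E_inj K E" "(f, g, h) \<in> E"
  shows "(\<lambda>b. b \<cdot> f) ` Hom K (Dom K g) P = Hom K (Dom K f) P"
  using bspec[OF CollectD[OF assms(1)[unfolded E_inj_def], THEN conjunct2] assms(2)] by simp

text \<open>
  Exactness at the middle term holds for every distinguished triangle, by \<open>tri_weak_kernel\<close>.
\<close>
lemma E_proj_iff: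
  "P \<in> E_proj K E \<longleftrightarrow> P \<in> Obj K \<and> (\<forall>f g h. (f, g, h) \<in> E \<longrightarrow>
     (\<forall>a \<in> Hom K P (Dom K f). f \<cdot> a = Zero K P (Cod K f) \<longrightarrow> a = Zero K P (Dom K f)) \<and>
     (\<forall>c \<in> Hom K P (Cod K g). \<exists>b \<in> Hom K P (Dom K g). g \<cdot> b = c))" (is "?A \<longleftrightarrow> ?B")
proof
  assume A: ?A
  then have P: "P \<in> Obj K" by (simp add: E_proj_def)
  moreover have "a = Zero K P (Dom K f)"
    if e: "(f, g, h) \<in> E" and a: "a \<in> Hom K P (Dom K f)" "f \<cdot> a = Zero K P (Cod K f)" for f g h a
  proof -
    have "inj_on (\<lambda>a. f \<cdot> a) (Hom K P (Dom K f))" using A e by (rule E_projD)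
    moreover have "f \<in> Arr K" using e E_tri triD by blast
    ultimately show ?thesis using a P by (auto simp: in_Hom inj_on_def)
  qed
  moreover have "\<exists>b \<in> Hom K P (Dom K g). g \<cdot> b = c"
    if e: "(f, g, h) \<in> E" and c: "c \<in> Hom K P (Cod K g)" for f g h c
  proof -
    have "(\<lambda>b. g \<cdot> b) ` Hom K P (Dom K g) = Hom K P (Cod K g)" using A e by (rule E_projD)
    then show ?thesis using c by (metis imageE)
  qed
  ultimately show ?B by blast
next
  assume B: ?B
  then have P: "P \<in> Obj K" by simp
  have "inj_on (\<lambda>a. f \<cdot> a) (Hom K P (Dom K f)) \<and>
     (\<lambda>a. f \<cdot> a) ` Hom K P (Dom K f) = {b \<in> Hom K P (Dom K g). g \<cdot> b = Zero K P (Cod K g)} \<and>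
     (\<lambda>b. g \<cdot> b) ` Hom K P (Dom K g) = Hom K P (Cod K g)"
    if e: "(f, g, h) \<in> E" for f g h
  proof (intro conjI)
    have T: "(f, g, h) \<in> Tri K" using e E_tri by auto
    note t = triD[OF T]
    show "inj_on (\<lambda>a. f \<cdot> a) (Hom K P (Dom K f))"
    proof (rule inj_onI)
      fix a a' assume a: "a \<in> Hom K P (Dom K f)" "a' \<in> Hom K P (Dom K f)" "f \<cdot> a = f \<cdot> a'"
      have "f \<cdot> (a \<oplus> Neg K a') = Zero K P (Cod K f)"
        using a t by (auto simp: in_Hom Comp_Add)
      moreover have "a \<oplus> Neg K a' \<in> Hom K P (Dom K f)" using a by (auto simp: in_Hom)
      ultimately have "a \<oplus> Neg K a' = Zero K P (Dom K f)" using B e by blast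
      then show "a = a'" using a diff_eq_Zero_iff[of a a'] by (auto simp: in_Hom)
    qed
    show "(\<lambda>a. f \<cdot> a) ` Hom K P (Dom K f) = {b \<in> Hom K P (Dom K g). g \<cdot> b = Zero K P (Cod K g)}"
    proof (intro equalityI subsetI)
      fix b assume "b \<in> (\<lambda>a. f \<cdot> a) ` Hom K P (Dom K f)"
      then obtain a where "a \<in> Arr K" "Dom K a = P" "Cod K a = Dom K f" "b = f \<cdot> a" by (auto simp:
        in_Hom)
      then show "b \<in> {b \<in> Hom K P (Dom K g). g \<cdot> b = Zero K P (Cod K g)}"
        using t Comp_cong_assoc[OF tri_comp_zero[OF T], of a] by (simp add: in_Hom)
    next
      fix b assume b: "b \<in> {b \<in> Hom K P (Dom K g). g \<cdot> b = Zero K P (Cod K g)}"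
      obtain a where "a \<in> Arr K" "Dom K a = Dom K b" "Cod K a = Dom K f" "f \<cdot> a = b"
        by (rule tri_weak_kernel[OF T, of b]) (use b in \<open>auto simp: in_Hom\<close>)
      then show "b \<in> (\<lambda>a. f \<cdot> a) ` Hom K P (Dom K f)" using b by (auto simp: in_Hom)
    qed
    have "(\<lambda>b. g \<cdot> b) ` Hom K P (Dom K g) \<subseteq> Hom K P (Cod K g)" using t by (auto simp: in_Hom)
    moreover have "Hom K P (Cod K g) \<subseteq> (\<lambda>b. g \<cdot> b) ` Hom K P (Dom K g)"
    proof
      fix c assume "c \<in> Hom K P (Cod K g)"
      then obtain b where "b \<in> Hom K P (Dom K g)" "g \<cdot> b = c" using B e by blast
      then show "c \<in> (\<lambda>b. g \<cdot> b) ` Hom K P (Dom K g)" by blast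
    qed
    ultimately show "(\<lambda>b. g \<cdot> b) ` Hom K P (Dom K g) = Hom K P (Cod K g)" by blast
  qed
  then have "case T of (f, g, h) \<Rightarrow> inj_on (\<lambda>a. f \<cdot> a) (Hom K P (Dom K f)) \<and>
     (\<lambda>a. f \<cdot> a) ` Hom K P (Dom K f) = {b \<in> Hom K P (Dom K g). g \<cdot> b = Zero K P (Cod K g)} \<and>
     (\<lambda>b. g \<cdot> b) ` Hom K P (Dom K g) = Hom K P (Cod K g)" if "T \<in> E" for T
    using that by (cases T) simp
  then show ?A using P unfolding E_proj_def by blast
qed

text \<open>
  Each arrow \<open>a\<close> out of \<open>X\<close> equals \<open>(a s) r + (a s') r'\<close>, and \<open>a s\<close>, \<open>a s'\<close> have projective
  domains. The lemma covers biproducts and, with one summand zero, retracts.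
\<close>
lemma E_proj_sum_retract:
  assumes r: "r \<in> Arr K" "Dom K r = X" "Cod K r = Dom K s" "Dom K s \<in> E_proj K E" "s \<in> Arr K"
    "Cod K s = X"
    and r': "r' \<in> Arr K" "Dom K r' = X" "Cod K r' = Dom K s'" "Dom K s' \<in> E_proj K E" "s' \<in> Arr K"
      "Cod K s' = X"
    and sum: "(s \<cdot> r) \<oplus> (s' \<cdot> r') = Id K X"
  shows "X \<in> E_proj K E"
  unfolding E_proj_iff
proof (intro conjI allI impI ballI)
  show "X \<in> Obj K" using r by auto
  fix f g h assume e: "(f, g, h) \<in> E"
  then have t: "f \<in> Arr K" "g \<in> Arr K" using E_tri triD by blast+
  have decomp: "a = ((a \<cdot> s) \<cdot> r) \<oplus> ((a \<cdot> s') \<cdot> r')" if "a \<in> Arr K" "Dom K a = X" for a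
  proof -
    have "a = a \<cdot> ((s \<cdot> r) \<oplus> (s' \<cdot> r'))" using that sum by simp
    then show ?thesis using that r r' by (simp add: Comp_Add Comp_assoc)
  qed
  {
    fix a assume a: "a \<in> Hom K X (Dom K f)" "f \<cdot> a = Zero K X (Cod K f)"
    then have a1: "a \<in> Arr K" "Dom K a = X" "Cod K a = Dom K f" by (auto simp: in_Hom)
    have O: "X \<in> Obj K" using r by auto
    have "f \<cdot> (a \<cdot> s) = Zero K (Dom K s) (Cod K f)" "f \<cdot> (a \<cdot> s') = Zero K (Dom K s') (Cod K f)"
      using Comp_cong_assoc[OF a(2), of s] Comp_cong_assoc[OF a(2), of s'] a1 t r r' O by simp_all
    moreover have "a \<cdot> s \<in> Hom K (Dom K s) (Dom K f)" "a \<cdot> s' \<in> Hom K (Dom K s') (Dom K f)"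
      using a1 r r' by (auto simp: in_Hom)
    ultimately have "a \<cdot> s = Zero K (Dom K s) (Dom K f)" "a \<cdot> s' = Zero K (Dom K s') (Dom K f)"
      using r(4) r'(4) e unfolding E_proj_iff by blast+
    then show "a = Zero K X (Dom K f)" using decomp[OF a1(1,2)] r r' t O by simp
  next
    fix c assume "c \<in> Hom K X (Cod K g)"
    then have c: "c \<in> Arr K" "Dom K c = X" "Cod K c = Cod K g" by (auto simp: in_Hom)
    then have "c \<cdot> s \<in> Hom K (Dom K s) (Cod K g)" "c \<cdot> s' \<in> Hom K (Dom K s') (Cod K g)"
      using r r' by (auto simp: in_Hom)
    then obtain b b' where "b \<in> Hom K (Dom K s) (Dom K g)" "g \<cdot> b = c \<cdot> s"
      "b' \<in> Hom K (Dom K s') (Dom K g)" "g \<cdot> b' = c \<cdot> s'"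
      using r(4) r'(4) e unfolding E_proj_iff by blast
    then have b: "b \<in> Arr K" "Dom K b = Dom K s" "Cod K b = Dom K g" "g \<cdot> b = c \<cdot> s"
      "b' \<in> Arr K" "Dom K b' = Dom K s'" "Cod K b' = Dom K g" "g \<cdot> b' = c \<cdot> s'" by (auto simp: in_Hom)
    have "g \<cdot> ((b \<cdot> r) \<oplus> (b' \<cdot> r')) = c"
      using b t r r' c Comp_cong_assoc[OF b(4), of r] Comp_cong_assoc[OF b(8), of r'] decomp[OF c(1,2)]
      by (simp add: Comp_Add)
    moreover have "(b \<cdot> r) \<oplus> (b' \<cdot> r') \<in> Hom K X (Dom K g)" using b r r' by (auto simp: in_Hom)
    ultimately show "\<exists>b \<in> Hom K X (Dom K g). g \<cdot> b = c" by blast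
  }
qed

end

text \<open>
  A Frobenius class with the choice of triangles that determines the suspension of its stable
  category.
\<close>
locale frobenius_stable = frobenius_class K E for K :: "('o, 'm) tri_cat" (structure) and E +
  fixes \<tau> :: "'o \<Rightarrow> 'm triangle"
  assumes choice: "injective_choice K E \<tau>"
begin

abbreviation J where "J \<equiv> E_proj K E"
abbreviation L where "L \<equiv> stable_category K E \<tau>"

lemma J_Obj [simp]: "A \<in> J \<Longrightarrow> A \<in> Obj K" by (simp add: E_proj_def)

lemma J_lift:
  assumes "c \<in> Arr K" "Dom K c \<in> J" "(f, p, h) \<in> E" "Cod K c = Cod K p"
  obtains b where "b \<in> Arr K" "Dom K b = Dom K c" "Cod K b = Dom K p" "p \<cdot> b = c"
proof -
  have "c \<in> Hom K (Dom K c) (Cod K p)" using assms by (simp add: in_Hom)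
  then obtain b where "b \<in> Hom K (Dom K c) (Dom K p)" "p \<cdot> b = c"
    using assms(2,3) unfolding E_proj_iff by blast
  then show ?thesis using that by (auto simp: in_Hom)
qed

lemma J_extend:
  assumes "a \<in> Arr K" "Cod K a \<in> J" "E_mono E i" "Dom K a = Dom K i"
  obtains b where "b \<in> Arr K" "Dom K b = Cod K i" "Cod K b = Cod K a" "b \<cdot> i = a"
proof -
  obtain g h where e: "(i, g, h) \<in> E" using assms by (auto simp: E_mono_def)
  then have i: "i \<in> Arr K" "Cod K i = Dom K g" using E_tri triD by blast+
  have "(\<lambda>b. b \<cdot> i) ` Hom K (Dom K g) (Cod K a) = Hom K (Dom K i) (Cod K a)"
    using assms(2) e unfolding proj_eq_inj by (rule E_injD)
  moreover have "a \<in> Hom K (Dom K i) (Cod K a)" using assms by (simp add: in_Hom)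
  ultimately obtain b where "b \<in> Hom K (Dom K g) (Cod K a)" "b \<cdot> i = a" by (metis imageE)
  then show ?thesis using that i by (auto simp: in_Hom)
qed

sublocale object_ideal K J
proof
  show "J \<subseteq> Obj K" by auto
  obtain Z where "zero_object K Z" using ex_zero_object by auto
  then show "J \<noteq> {}" using enough_proj[of Z] by (auto dest: zero_object_Obj)
  show "D \<in> J" if "A \<in> J" "B \<in> J" "biproduct K A B D i j p q" for A B D i j p q
    by (rule E_proj_sum_retract[of p D i q j]) (use that in \<open>auto simp: biproduct_def in_Hom\<close>)
qed

sublocale quotient_by_ideal K J L
  by unfold_locales (simp_all add: stable_category_def Let_def preadd.extend_def)

lemma null_Id_J: assumes "X \<in> Obj K" "null (Id K X)" shows "X \<in> J"
proof -
  obtain a b where ab: "a \<in> Arr K" "b \<in> Arr K" "Cod K a = Dom K b" "Dom K b \<in> J" "Dom K a = X"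
    "Cod K b = X" "b \<cdot> a = Id K X" using nullE[OF assms(2)] assms(1) by (metis Id_simps)
  show ?thesis
    by (rule E_proj_sum_retract[of a X b "Zero K X (Dom K b)" "Zero K (Dom K b) X"])
      (use ab assms in auto)
qed

lemma retract_J:
  assumes "a \<in> Arr K" "b \<in> Arr K" "Cod K a = Dom K b" "Dom K b \<in> J" "Dom K a = X" "b \<cdot> a = Id K X"
  shows "X \<in> J"
  using null_Id_J[of X] nullI[of a b] assms by auto

lemma cong_null: assumes "cong f g" "null f" shows "null g"
proof -
  have "cong f (Zero K (Dom K f) (Cod K f))" using assms null_cong_Zero cong_typed by blast
  then have "cong g (Zero K (Dom K f) (Cod K f))" using assms(1) cong_sym cong_trans by blast
  then show ?thesis using null_cong_Zero[of g] cong_typed[OF assms(1)] by simp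
qed

lemma cong_Id_J:
  assumes "cong f (Id K X)" "null f" "X \<in> Obj K" shows "X \<in> J"
  using assms cong_null null_Id_J by blast

text \<open>Modulo arrows through \<open>J\<close>, the identity of each end factors through the other end.\<close>
lemma iso_L_J:
  assumes "is_iso L (cls f)" "f \<in> Arr K" shows "Dom K f \<in> J \<longleftrightarrow> Cod K f \<in> J"
proof -
  obtain g where g: "g \<in> Arr K" "Dom K g = Cod K f" "Cod K g = Dom K f"
    "cong (g \<cdot> f) (Id K (Dom K f))" "cong (f \<cdot> g) (Id K (Cod K f))"
    using assms is_iso_cls_iff by blast
  show ?thesis
  proof
    assume "Dom K f \<in> J"
    then have "null (f \<cdot> g)" using nullI[of g f] g assms by simp
    then show "Cod K f \<in> J" using cong_Id_J g assms by auto
  next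
    assume "Cod K f \<in> J"
    then have "null (g \<cdot> f)" using nullI[of f g] g assms by simp
    then show "Dom K f \<in> J" using cong_Id_J g assms by auto
  qed
qed

definition ti where "ti X = fst (\<tau> X)"
definition tp where "tp X = fst (snd (\<tau> X))"
definition tq where "tq X = snd (snd (\<tau> X))"

lemma tau_eq: "\<tau> X = (ti X, tp X, tq X)" by (simp add: ti_def tp_def tq_def)

lemma tau_Tri: "X \<in> Obj K \<Longrightarrow> (ti X, tp X, tq X) \<in> Tri K"
  using choice by (auto simp: injective_choice_def tau_eq)

lemma tau_simps [simp]:
  assumes "X \<in> Obj K"
  shows "ti X \<in> Arr K" "tp X \<in> Arr K" "tq X \<in> Arr K" "Dom K (ti X) = X" "Dom K (tp X) = Cod K (ti X)"
    "Dom K (tq X) = Cod K (tp X)" "Cod K (tq X) = S X"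
  using choice assms triD[OF tau_Tri[OF assms]] by (auto simp: injective_choice_def tau_eq)

lemma tau_J: "X \<in> Obj K \<Longrightarrow> Cod K (ti X) \<in> J"
  using choice by (auto simp: injective_choice_def tau_eq proj_eq_inj)

lemma tau_mono: "X \<in> Obj K \<Longrightarrow> E_mono E (ti X)"
  using choice by (auto simp: injective_choice_def tau_eq)

abbreviation SL where "SL \<equiv> stable_susp K E \<tau>"
abbreviation tau_mor where "tau_mor f f' f'' \<equiv> tri_mor K (Susp K) (\<tau> (Dom K f)) (\<tau> (Cod K f)) f f' f''"

lemma FObj_SL: "FObj SL X = Cod K (tp X)" by (simp add: stable_susp_def tau_eq)
lemma Susp_L [simp]: "Susp L = SL" by (simp add: stable_category_def Let_def preadd.extend_def
  tri_cat.fields_def)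

lemma tau_mor_iff:
  assumes "f \<in> Arr K"
  shows "tau_mor f f' f'' \<longleftrightarrow> f' \<in> Arr K \<and> f'' \<in> Arr K \<and> Dom K f' = Cod K (ti (Dom K f)) \<and>
    Cod K f' = Cod K (ti (Cod K f)) \<and> Dom K f'' = Cod K (tp (Dom K f)) \<and> Cod K f'' = Cod K (tp (Cod
      K f)) \<and>
    f' \<cdot> ti (Dom K f) = ti (Cod K f) \<cdot> f \<and> f'' \<cdot> tp (Dom K f) = tp (Cod K f) \<cdot> f' \<and>
    SA f \<cdot> tq (Dom K f) = tq (Cod K f) \<cdot> f''"
  using assms by (auto simp: tau_eq in_Hom)

text \<open>
  Arrows into \<open>Y\<^sub>E\<close> extend along the \<open>E\<close>-monomorphism \<open>X \<rightarrow> X\<^sub>E\<close>, because \<open>Y\<^sub>E\<close> is injective.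
\<close>
lemma tau_mor_exists:
  assumes f: "f \<in> Arr K" shows "\<exists>f' f''. tau_mor f f' f''"
proof -
  obtain f' where f': "f' \<in> Arr K" "Dom K f' = Cod K (ti (Dom K f))" "Cod K f' = Cod K (ti (Cod K f))"
    "f' \<cdot> ti (Dom K f) = ti (Cod K f) \<cdot> f"
    by (rule J_extend[of "ti (Cod K f) \<cdot> f" "ti (Dom K f)"]) (use f tau_J tau_mono in auto)
  obtain f'' where "f'' \<in> Arr K" "Dom K f'' = Cod K (tp (Dom K f))" "Cod K f'' = Cod K (tp (Cod K f))"
    "f'' \<cdot> tp (Dom K f) = tp (Cod K f) \<cdot> f'" "SA f \<cdot> tq (Dom K f) = tq (Cod K f) \<cdot> f''"
    by (rule tri_fillE[OF tau_Tri[of "Dom K f"] tau_Tri[of "Cod K f"], of f f']) (use f f' in auto)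
  then show ?thesis using f f' unfolding tau_mor_iff[OF f] by blast
qed

text \<open>
  This makes \<open>\<Sigma>\<^sub>E\<close> well defined on classes. If \<open>f - g = b a\<close> passes through \<open>J\<close>, then \<open>a\<close>
  extends along \<open>X \<rightarrow> X\<^sub>E\<close>, so \<open>\<Sigma>(f - g)\<close> kills \<open>X' \<rightarrow> \<Sigma>X\<close>. Therefore \<open>f'' - g''\<close> is killed by
  \<open>Y' \<rightarrow> \<Sigma>Y\<close> and lifts to \<open>Y\<^sub>E \<in> J\<close>.
\<close>
lemma tau_mor_cong:
  assumes fg: "cong f g" and f: "tau_mor f f' f''" and g: "tau_mor g g' g''"
  shows "cong f'' g''"
proof -
  have fgA: "f \<in> Arr K" "g \<in> Arr K" "Dom K g = Dom K f" "Cod K g = Cod K f" using cong_typed[OF fg]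
    by auto
  define X where "X = Dom K f"
  define Y where "Y = Cod K f"
  have XY: "X \<in> Obj K" "Y \<in> Obj K" "Dom K f = X" "Cod K f = Y" "Dom K g = X" "Cod K g = Y"
    using fgA by (auto simp: X_def Y_def)
  have ff: "f'' \<in> Arr K" "Dom K f'' = Cod K (tp X)" "Cod K f'' = Cod K (tp Y)"
    "SA f \<cdot> tq X = tq Y \<cdot> f''"
    using f[unfolded tau_mor_iff[OF fgA(1)]] XY by auto
  have gg: "g'' \<in> Arr K" "Dom K g'' = Cod K (tp X)" "Cod K g'' = Cod K (tp Y)"
    "SA g \<cdot> tq X = tq Y \<cdot> g''"
    using g[unfolded tau_mor_iff[OF fgA(2)]] XY by auto
  have "null (f \<oplus> Neg K g)" using fg by (simp add: cong_def)
  then obtain a b where ab: "a \<in> Arr K" "b \<in> Arr K" "Cod K a = Dom K b" "Dom K b \<in> J" "Dom K a = X"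
    "Cod K b = Y" "b \<cdot> a = f \<oplus> Neg K g" using nullE[of "f \<oplus> Neg K g"] fgA XY by (metis Add_simps
    Neg_simps)
  obtain a' where a': "a' \<in> Arr K" "Dom K a' = Cod K (ti X)" "Cod K a' = Cod K a" "a' \<cdot> ti X = a"
    by (rule J_extend[of a "ti X"]) (use ab XY tau_mono in auto)
  have 0: "SA (ti X) \<cdot> tq X = Zero K (Cod K (tp X)) (S (Cod K (ti X)))"
    using tri_comp_zero3[OF tau_Tri[OF XY(1)]] XY by simp
  have "tq Y \<cdot> (f'' \<oplus> Neg K g'') = SA (f \<oplus> Neg K g) \<cdot> tq X"
    using ff gg fgA XY by (simp add: Comp_Add Add_Comp)
  also have "\<dots> = SA (b \<cdot> (a' \<cdot> ti X)) \<cdot> tq X" using ab a' by simp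
  also have "\<dots> = SA b \<cdot> (SA a' \<cdot> (SA (ti X) \<cdot> tq X))"
    using ab(1-6) a'(1-3) XY by (simp add: Comp_assoc)
  also have "\<dots> = Zero K (Cod K (tp X)) (S Y)"
    unfolding 0 using ab(1-6) a'(1-3) XY by simp
  finally have z: "tq Y \<cdot> (f'' \<oplus> Neg K g'') = Zero K (Cod K (tp X)) (S Y)" .
  obtain w where w: "w \<in> Arr K" "Dom K w = Cod K (tp X)" "Cod K w = Cod K (ti Y)"
      "tp Y \<cdot> w = f'' \<oplus> Neg K g''"
    by (rule tri_weak_kernel[OF tri_rot[OF tau_Tri[OF XY(2)]], of "f'' \<oplus> Neg K g''"])
      (use z ff(1-3) gg(1-3) XY in auto)
  have "null (f'' \<oplus> Neg K g'')"
    using nullI[of w "tp Y"] w XY tau_J[of Y] by simp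
  then show ?thesis using ff gg by (simp add: cong_def)
qed

lemma SL_cls:
  assumes f: "f \<in> Arr K" "tau_mor f f' f''" shows "FArr SL (cls f) = cls f''"
proof -
  have A: "h'' \<in> Arr K" if "h \<in> Arr K" "tau_mor h h' h''" for h h' h''
    using that tau_mor_iff by blast
  have "(THE G. \<exists>h \<in> cls f. \<exists>h' h''. tau_mor h h' h'' \<and> G = cls h'') = cls f''"
  proof (rule the_equality)
    show "\<exists>h \<in> cls f. \<exists>h' h''. tau_mor h h' h'' \<and> cls f'' = cls h''"
      using f self_mem_cls by blast
  next
    fix G assume "\<exists>h \<in> cls f. \<exists>h' h''. tau_mor h h' h'' \<and> G = cls h''"
    then obtain h h' h'' where h: "cong h f" "tau_mor h h' h''" "G = cls h''"
      using f(1) by (auto simp: mem_cls)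
    then have "cong h'' f''" using tau_mor_cong f by blast
    then show "G = cls f''" using h cls_eq_iff cong_typed by blast
  qed
  then show ?thesis by (simp add: stable_susp_def)
qed

lemma functor_SL: "is_functor L L SL"
  unfolding is_functor_def
proof (intro conjI ballI impI)
  show "FObj SL X \<in> Obj L" if "X \<in> Obj L" for X using that by (simp add: FObj_SL)
  show "FArr SL F \<in> Hom L (FObj SL (Dom L F)) (FObj SL (Cod L F))" if F: "F \<in> Arr L" for F
  proof -
    obtain f where f: "f \<in> Arr K" "F = cls f" using F by (rule L_ArrE)
    obtain f' f'' where "tau_mor f f' f''" using tau_mor_exists[OF f(1)] by blast
    then show ?thesis using f SL_cls[of f f' f''] tau_mor_iff[OF f(1)] by (simp add: in_Hom FObj_SL)
  qed
  show "FArr SL (Id L X) = Id L (FObj SL X)" if "X \<in> Obj L" for X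
  proof -
    have X: "X \<in> Obj K" using that by simp
    have "tau_mor (Id K X) (Id K (Cod K (ti X))) (Id K (Cod K (tp X)))"
      by (subst tau_mor_iff) (use X in auto)
    then show ?thesis using SL_cls X by (simp add: Id_L FObj_SL)
  qed
  show "FArr SL (G \<cdot>\<^bsub>L\<^esub> F) = FArr SL G \<cdot>\<^bsub>L\<^esub> FArr SL F" if FG: "F \<in> Arr L" "G \<in> Arr L"
    "Cod L F = Dom L G" for F G
  proof -
    obtain f where f: "f \<in> Arr K" "F = cls f" using FG by (auto elim: L_ArrE)
    obtain g where g: "g \<in> Arr K" "G = cls g" using FG by (auto elim: L_ArrE)
    have fg: "Dom K g = Cod K f" using FG f g by simp
    obtain f' f'' where ft: "tau_mor f f' f''" using tau_mor_exists[OF f(1)] by blast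
    obtain g' g'' where gt: "tau_mor g g' g''" using tau_mor_exists[OF g(1)] by blast
    note F = ft[unfolded tau_mor_iff[OF f(1)]] and G = gt[unfolded tau_mor_iff[OF g(1)]]
    have gf: "g \<cdot> f \<in> Arr K" using f g fg by simp
    have "tau_mor (g \<cdot> f) (g' \<cdot> f') (g'' \<cdot> f'')"
      unfolding tau_mor_iff[OF gf]
    proof (intro conjI)
      have "g' \<cdot> ti (Cod K f) = ti (Cod K g) \<cdot> g" using G fg by simp
      note 1 = Comp_cong_assoc[OF this, of f]
      show "(g' \<cdot> f') \<cdot> ti (Dom K (g \<cdot> f)) = ti (Cod K (g \<cdot> f)) \<cdot> (g \<cdot> f)"
        using F G f g fg 1 by (simp add: Comp_assoc)
      have "g'' \<cdot> tp (Cod K f) = tp (Cod K g) \<cdot> g'" using G fg by simp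
      note 2 = Comp_cong_assoc[OF this, of f']
      show "(g'' \<cdot> f'') \<cdot> tp (Dom K (g \<cdot> f)) = tp (Cod K (g \<cdot> f)) \<cdot> (g' \<cdot> f')"
        using F G f g fg 2 by (simp add: Comp_assoc)
      have "SA g \<cdot> tq (Cod K f) = tq (Cod K g) \<cdot> g''" using G fg by simp
      note 3 = Comp_cong_assoc[OF this, of f'']
      show "SA (g \<cdot> f) \<cdot> tq (Dom K (g \<cdot> f)) = tq (Cod K (g \<cdot> f)) \<cdot> (g'' \<cdot> f'')"
        using F G f g fg 3 by (simp add: Comp_assoc)
    qed (use F G f g fg in auto)
    then show ?thesis using SL_cls[OF f(1) ft] SL_cls[OF g(1) gt] SL_cls[OF gf] f g fg F G by simp
  qed
qed

lemma tri_isomorphic_L: "tri_isomorphic (additive_quotient K J) SL = tri_isomorphic L SL"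
  by (rule tri_isomorphic_cong) (simp_all add: L_data)

lemma candidates_L: "candidates (additive_quotient K J) SL = candidates L SL"
  by (rule tri_isomorphic_cong) (simp_all add: L_data)

lemma Tri_L: "T \<in> Tri L \<longleftrightarrow> T \<in> candidates L SL \<and>
    (\<exists>f g h. standard_triangle K \<tau> f g h \<and> tri_isomorphic L SL (cls f, cls g, cls h) T)"
proof -
  have "Tri L = {T \<in> candidates (additive_quotient K J) SL. \<exists>f g h. standard_triangle K \<tau> f g h \<and>
           tri_isomorphic (additive_quotient K J) SL (cls f, cls g, cls h) T}"
    by (simp add: stable_category_def Let_def preadd.extend_def tri_cat.fields_def stable_functor_def)
  then show ?thesis unfolding tri_isomorphic_L candidates_L by simp
qed

lemma standard_triangleD:
  assumes "standard_triangle K \<tau> f g h"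
  shows "f \<in> Arr K" "(g, h, SA f \<cdot> tq (Dom K f)) \<in> Tri K" "Cod K f = Dom K g"
    "Cod K h = Cod K (tp (Dom K f))"
    "g \<in> Arr K" "h \<in> Arr K" "Cod K g = Dom K h"
proof -
  show f: "f \<in> Arr K" using assms by (simp add: standard_triangle_def)
  show T: "(g, h, SA f \<cdot> tq (Dom K f)) \<in> Tri K"
    using assms by (auto simp: standard_triangle_def tau_eq)
  show "g \<in> Arr K" "h \<in> Arr K" "Cod K g = Dom K h" using triD[OF T] by auto
  show "Cod K f = Dom K g"
    using assms by (auto simp: standard_triangle_def tau_eq homotopy_cartesian_def)
  show "Cod K h = Cod K (tp (Dom K f))" using triD[OF T] f by simp
qed

text \<open>
  Closure is built into the definition, up to composing isomorphisms of triangles; this needs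
  \<open>\<Sigma>\<^sub>E\<close> to be a functor.
\<close>
lemma Tri_L_iso_closed:
  assumes "T \<in> Tri L" "T' \<in> candidates L SL" "tri_isomorphic L SL T T'" shows "T' \<in> Tri L"
proof -
  obtain f g h where s: "standard_triangle K \<tau> f g h" "tri_isomorphic L SL (cls f, cls g, cls h) T"
    and T: "T \<in> candidates L SL" using assms(1) Tri_L by blast
  have "(cls f, cls g, cls h) \<in> candidates L SL"
    using standard_triangleD[OF s(1)] by (simp add: candidates_def FObj_SL)
  then have "tri_isomorphic L SL (cls f, cls g, cls h) T'"
    using tri_isomorphic_trans[OF category_L functor_SL _ T assms(2)] s assms(3) by blast
  then show ?thesis using s assms(2) Tri_L by blast
qed

abbreviation pi where "pi \<equiv> stable_functor K E"

lemma pi_simps [simp]: "FObj pi X = X" "FArr pi f = cls f" by (simp_all add: stable_functor_def)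

lemma pi_functor: "is_functor K L pi"
  by (simp add: is_functor_def in_Hom Id_L)

lemma pi_additive: "additive_functor K L pi"
  by (simp add: additive_functor_def pi_functor) (simp add: in_Hom)

end

section \<open>Verdier quotients\<close>

text \<open>
  \<open>W\<close> is the class of denominators and \<open>q\<close> the functor to the quotient \<open>V\<close>. Operations of \<open>V\<close>
  are computed on arrows in the image of \<open>q\<close> only: in the quotient by \<open>J\<close> these are all arrows
  when \<open>\<pi>\<close> is exact (\<open>q_full\<close>).
\<close>
locale verdier = triangulated_category K for K :: "('o, 'm) tri_cat" (structure) +
  fixes N :: "'o set"
  assumes N: "triangulated_subcategory K N"
begin

abbreviation W where "W \<equiv> cone_in K N"
abbreviation V where "V \<equiv> verdier_quotient K N"

lemma N_iso: assumes "is_iso K f" "Dom K f \<in> N" shows "Cod K f \<in> N"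
proof -
  have f: "f \<in> Arr K" using assms by (simp add: is_iso_def)
  then have "isomorphic K (Dom K f) (Cod K f)" unfolding isomorphic_def using assms by (auto simp:
    in_Hom)
  then show ?thesis using N assms f unfolding triangulated_subcategory_def by (meson Cod_Obj)
qed
lemma N_zero: "zero_object K Z \<Longrightarrow> Z \<in> N" using N by (auto simp: triangulated_subcategory_def)
lemma N_susp: "X \<in> Obj K \<Longrightarrow> S X \<in> N \<longleftrightarrow> X \<in> N" using N by (auto simp: triangulated_subcategory_def)
lemma N_cone: "\<lbrakk>(f, g, h) \<in> Tri K; Dom K f \<in> N; Cod K f \<in> N\<rbrakk> \<Longrightarrow> Cod K g \<in> N"
  using N by (auto simp: triangulated_subcategory_def)

lemma W_I: "\<lbrakk>(s, g, h) \<in> Tri K; Cod K g \<in> N\<rbrakk> \<Longrightarrow> s \<in> W" by (auto simp: cone_in_def)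

lemma W_E:
  assumes "s \<in> W" obtains g h where "(s, g, h) \<in> Tri K" "Cod K g \<in> N"
  using assms by (auto simp: cone_in_def)

lemma W_Arr [simp]: "s \<in> W \<Longrightarrow> s \<in> Arr K" by (auto simp: cone_in_def dest: triD)

lemma W_Id [simp]: assumes "X \<in> Obj K" shows "Id K X \<in> W"
proof -
  obtain Z where Z: "zero_object K Z" using ex_zero_object by auto
  show ?thesis by (rule W_I[OF tri_id[OF assms Z]]) (use N_zero[OF Z] Z assms in \<open>auto dest:
    zero_object_Obj\<close>)
qed

text \<open>
  By the octahedral axiom the cone of \<open>t s\<close> is an extension of the cones of \<open>t\<close> and \<open>s\<close>.
\<close>
lemma W_Comp:
  assumes s: "s \<in> W" and t: "t \<in> W" and st: "Cod K s = Dom K t" shows "t \<cdot> s \<in> W"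
proof -
  obtain u u' where u: "(s, u, u') \<in> Tri K" "Cod K u \<in> N" using s by (rule W_E)
  obtain v v' where v: "(t, v, v') \<in> Tri K" "Cod K v \<in> N" using t by (rule W_E)
  obtain w w' where w: "(t \<cdot> s, w, w') \<in> Tri K" using tri_complete[of "t \<cdot> s"] s t st by auto
  obtain a b where a: "a \<in> Hom K (Cod K u) (Cod K w)" and b: "b \<in> Hom K (Cod K w) (Cod K v)"
    and T: "(a, b, SA u \<cdot> v') \<in> Tri K" using octahedral[OF u(1) v(1) st w] by blast
  note T' = tri_rot[OF tri_rot[OF T]]
  have "S (Cod K w) \<in> N"
    using N_cone[OF T'] u v a b triD[OF u(1)] triD[OF v(1)] triD[OF w] st N_susp[of "Cod K u"]
    by (auto simp: in_Hom)
  then have "Cod K w \<in> N" using N_susp[of "Cod K w"] triD[OF w] by auto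
  then show ?thesis using w by (rule W_I[rotated])
qed

text \<open>
  With \<open>u\<close> the arrow from \<open>Cod s\<close> to the cone of \<open>s\<close>, the fibre \<open>t\<close> of \<open>u f\<close> has the same cone
  as \<open>s\<close>, and the square comes from a morphism between the two triangles.
\<close>
lemma W_ore:
  assumes s: "s \<in> W" and f: "f \<in> Arr K" "Cod K f = Cod K s"
  obtains t g where "t \<in> W" "g \<in> Arr K" "Dom K t = Dom K g" "Cod K t = Dom K f" "Cod K g = Dom K s"
    "f \<cdot> t = s \<cdot> g"
proof -
  obtain u h where u: "(s, u, h) \<in> Tri K" "Cod K u \<in> N" using s by (rule W_E)
  note tu = triD[OF u(1)]
  have uf: "u \<cdot> f \<in> Arr K" using f tu by simp
  obtain t k where t: "(t, u \<cdot> f, k) \<in> Tri K" using tri_complete_mid[OF uf] by blast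
  note tt = triD[OF t]
  have tW: "t \<in> W" using W_I[OF t] u f tu by simp
  obtain c where c: "c \<in> Arr K" "Dom K c = S (Dom K t)" "Cod K c = S (Dom K s)"
    "SA f \<cdot> Neg K (SA t) = Neg K (SA s) \<cdot> c"
    by (rule tri_fillE[OF tri_rot[OF t] tri_rot[OF u(1)], of f "Id K (Cod K u)"]) (use tt tu f uf in
      auto)
  obtain g where g: "g \<in> Arr K" "Dom K g = Dom K t" "Cod K g = Dom K s" "c = SA g"
    using susp_full[of c "Dom K t" "Dom K s"] c tt tu by auto
  have "SA (Neg K (f \<cdot> t)) = SA (Neg K (s \<cdot> g))" using c g tt tu f by simp
  then have "Neg K (f \<cdot> t) = Neg K (s \<cdot> g)" by (rule susp_faithful) (use g tt tu f in auto)
  then have "f \<cdot> t = s \<cdot> g" using Neg_eq_iff[of "f \<cdot> t" "s \<cdot> g"] g tt tu f by simp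
  then show ?thesis using that[of t g] tW g tt tu f by simp
qed

text \<open>
  \<open>x - y\<close> factors as \<open>e m\<close> through the fibre of \<open>s\<close>, which lies in \<open>N\<close>; the fibre \<open>t\<close> of \<open>m\<close> is
  therefore a denominator, and it equalizes \<open>x\<close> and \<open>y\<close>.
\<close>
lemma W_cancel:
  assumes s: "s \<in> W" and xy: "x \<in> Arr K" "y \<in> Arr K" "Dom K y = Dom K x" "Cod K x = Dom K s"
    "Cod K y = Dom K s"
    and eq: "s \<cdot> x = s \<cdot> y"
  obtains t where "t \<in> W" "Cod K t = Dom K x" "x \<cdot> t = y \<cdot> t"
proof -
  obtain u h where u: "(s, u, h) \<in> Tri K" "Cod K u \<in> N" using s by (rule W_E)
  note tu = triD[OF u(1)]
  obtain e u' \<theta> where e: "(e, s, u') \<in> Tri K" "is_iso K \<theta>" "\<theta> \<in> Arr K" "Dom K \<theta> = S (Dom K e)"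
    "Cod K \<theta> = Cod K u" using tri_rot_back[OF u(1)] by metis
  note te = triD[OF e(1)]
  obtain \<theta>' where "Dom K \<theta>' = Cod K \<theta>" "Cod K \<theta>' = Dom K \<theta>" "is_iso K \<theta>'" by (rule is_isoE[OF e(2)])
  then have "S (Dom K e) \<in> N" using N_iso[of \<theta>'] e u by simp
  then have eN: "Dom K e \<in> N" using N_susp[of "Dom K e"] te by simp
  have "s \<cdot> (x \<oplus> Neg K y) = Zero K (Dom K x) (Cod K s)" using xy tu eq by (simp add: Comp_Add)
  then have z: "s \<cdot> (x \<oplus> Neg K y) = Zero K (Dom K (x \<oplus> Neg K y)) (Cod K s)" using xy by simp
  obtain m where m: "m \<in> Arr K" "Dom K m = Dom K (x \<oplus> Neg K y)" "Cod K m = Dom K e"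
    "e \<cdot> m = x \<oplus> Neg K y"
    by (rule tri_weak_kernel[OF e(1) _ _ z]) (use xy in auto)
  have m2: "Dom K m = Dom K x" using m(2) xy by simp
  obtain t k where t: "(t, m, k) \<in> Tri K" using tri_complete_mid[OF m(1)] by blast
  note tt = triD[OF t]
  have "(x \<oplus> Neg K y) \<cdot> t = e \<cdot> (m \<cdot> t)" using m(1,3) m2 te tt Comp_cong_assoc[OF m(4), of t] by simp
  also have "\<dots> = Zero K (Dom K t) (Dom K s)" using tri_comp_zero[OF t] te tt m(1,3) m2 by simp
  finally have "(x \<cdot> t) \<oplus> Neg K (y \<cdot> t) = Zero K (Dom K t) (Dom K s)" using xy tt m2 by (simp add:
    Add_Comp)
  then have "x \<cdot> t = y \<cdot> t" using diff_eq_Zero_iff[of "x \<cdot> t" "y \<cdot> t"] xy tt m2 by simp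
  then show ?thesis using that[of t] W_I[OF t] eN m(1,3) m2 tt by simp
qed

text \<open>
  A threefold rotation yields the suspended triangle with three signs; two of them can be moved
  away.
\<close>
lemma W_susp: assumes "s \<in> W" shows "SA s \<in> W"
proof -
  obtain u h where u: "(s, u, h) \<in> Tri K" "Cod K u \<in> N" using assms by (rule W_E)
  note tu = triD[OF u(1)]
  have T: "(Neg K (SA s), Neg K (SA u), Neg K (SA h)) \<in> Tri K"
    by (rule tri_rot[OF tri_rot[OF tri_rot[OF u(1)]]])
  \<comment> \<open>The isomorphism is \<open>-1\<close> on the middle object and the identity on the other two.\<close>
  have "(SA s, SA u, Neg K (SA h)) \<in> Tri K"
  proof (rule tri_iso_closed[OF T])
    show "(SA s, SA u, Neg K (SA h)) \<in> candidates K (Susp K)" using tu by (auto simp: candidates_def)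
    show "tri_isomorphic K (Susp K) (Neg K (SA s), Neg K (SA u), Neg K (SA h)) (SA s, SA u, Neg K (SA h))"
      unfolding tri_isomorphic_def
      by (rule exI[of _ "Id K (S (Dom K s))"], rule exI[of _ "Neg K (Id K (S (Cod K s)))"],
          rule exI[of _ "Id K (S (Cod K u))"]) (use tu in \<open>auto simp: in_Hom is_iso_Neg\<close>)
  qed
  then show ?thesis by (rule W_I) (use u tu N_susp[of "Cod K u"] in auto)
qed

lemma roofs_iff: "(s, f) \<in> roofs K N \<longleftrightarrow> s \<in> W \<and> f \<in> Arr K \<and> Dom K s = Dom K f"
  by (simp add: roofs_def)

text \<open>
  A constant in place of the pattern-matching predicate, whose equation is a rewrite rule, keeps
  the existential opaque to the simplifier.
\<close>
definition req where "req s f t g \<longleftrightarrow> roof_equiv K N (s, f) (t, g)"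

lemma reqE:
  assumes "req s f t g"
  obtains u v where "u \<in> Arr K" "v \<in> Arr K" "Dom K u = Dom K v" "Cod K u = Dom K s" "Cod K v = Dom K t"
      "s \<cdot> u \<in> W" "s \<cdot> u = t \<cdot> v" "f \<cdot> u = g \<cdot> v" "Cod K s = Cod K t" "Cod K f = Cod K g"
  using assms unfolding req_def roof_equiv.simps by blast

lemma req_Cod:
  assumes "req s f t g" shows "Cod K t = Cod K s" "Cod K g = Cod K f"
  using assms by (auto simp: req_def)

text \<open>
  The workhorse for equivalent roofs: whenever \<open>x\<close> and \<open>x'\<close> equalize the denominators, they
  equalize the numerators after a further denominator \<open>r\<close>. The witnesses \<open>u\<close>, \<open>v\<close> of the
  equivalence give this for one such pair; the Ore condition compares \<open>s x\<close> with \<open>s u\<close>, and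
  cancelling \<open>s\<close> and \<open>s'\<close> costs the two further factors of \<open>r\<close>.
\<close>
lemma req_transfer:
  assumes eq: "req s f s' f'" and r: "s \<in> W" "f \<in> Arr K" "Dom K s = Dom K f" "s' \<in> W" "f' \<in> Arr K"
    "Dom K s' = Dom K f'"
    and x: "x \<in> Arr K" "x' \<in> Arr K" "Dom K x' = Dom K x" "Cod K x = Dom K f" "Cod K x' = Dom K f'"
    "s \<cdot> x = s' \<cdot> x'"
  obtains r where "r \<in> W" "Cod K r = Dom K x" "f \<cdot> (x \<cdot> r) = f' \<cdot> (x' \<cdot> r)"
proof -
  obtain u v where u: "u \<in> Arr K" "v \<in> Arr K" "Dom K u = Dom K v" "Cod K u = Dom K f"
    "Cod K v = Dom K f'"
      "s \<cdot> u \<in> W" "s \<cdot> u = s' \<cdot> v" "f \<cdot> u = f' \<cdot> v" "Cod K s = Cod K s'" "Cod K f = Cod K f'"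
    using eq r by (auto elim: reqE)
  note r' = r(1-2,4-5) r(3)[symmetric] r(6)[symmetric] W_Arr[OF r(1)] W_Arr[OF r(4)]
  have rr: "Dom K f = Dom K s" "Dom K f' = Dom K s'" using r by auto
  obtain r1 q where q: "r1 \<in> W" "q \<in> Arr K" "Dom K r1 = Dom K q" "Cod K r1 = Dom K x"
    "Cod K q = Dom K v"
    "(s \<cdot> x) \<cdot> r1 = (s \<cdot> u) \<cdot> q"
    using W_ore[OF u(6), of "s \<cdot> x"] u x r rr W_Arr[OF r(1)] by (smt (verit) Comp_simps)
  note qa = W_Arr[OF q(1)]
  have e1: "s \<cdot> (x \<cdot> r1) = s \<cdot> (u \<cdot> q)"
    using q(6) Comp_assoc[of r1 x s] Comp_assoc[of q u s] q(2-5) qa x(1-5) r' u(1-5) by simp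
  obtain r2 where r2: "r2 \<in> W" "Cod K r2 = Dom K q" "(x \<cdot> r1) \<cdot> r2 = (u \<cdot> q) \<cdot> r2"
    by (rule W_cancel[OF r(1) _ _ _ _ _ e1]) (use q(2-5) qa x(1-5) r' u(1-5) in auto)
  note r2a = W_Arr[OF r2(1)]
  have e2: "s' \<cdot> (x' \<cdot> r1) = s' \<cdot> (v \<cdot> q)"
    using q(6) Comp_assoc[of r1 x' s'] Comp_assoc[of q v s'] x(6) u(7) q(2-5) qa x(1-5) r' u(1-5) by
      simp
  have e3: "s' \<cdot> ((x' \<cdot> r1) \<cdot> r2) = s' \<cdot> ((v \<cdot> q) \<cdot> r2)"
    using Comp_cong_assoc[OF e2, of r2] Comp_assoc[of r2 "x' \<cdot> r1" s'] Comp_assoc[of r2 "v \<cdot> q" s']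
      q(2-5) qa x(1-5) r' u(1-5) r2(2) r2a by simp
  obtain r3 where r3: "r3 \<in> W" "Cod K r3 = Dom K r2" "((x' \<cdot> r1) \<cdot> r2) \<cdot> r3 = ((v \<cdot> q) \<cdot> r2) \<cdot> r3"
    by (rule W_cancel[OF r(4) _ _ _ _ _ e3]) (use q(2-5) qa x(1-5) r' u(1-5) r2(2) r2a in auto)
  note r3a = W_Arr[OF r3(1)]
  note ty = q(2-5) qa x(1-5) r' u(1-5) r2(2) r2a r3(2) r3a
  have "f \<cdot> (x \<cdot> (r1 \<cdot> (r2 \<cdot> r3))) = f \<cdot> (((x \<cdot> r1) \<cdot> r2) \<cdot> r3)" using ty by (simp add: Comp_assoc)
  also have "\<dots> = (f \<cdot> u) \<cdot> (q \<cdot> (r2 \<cdot> r3))" unfolding r2(3) using ty by (simp add: Comp_assoc)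
  also have "\<dots> = f' \<cdot> (((v \<cdot> q) \<cdot> r2) \<cdot> r3)" unfolding u(8) using ty by (simp add: Comp_assoc)
  also have "\<dots> = f' \<cdot> (x' \<cdot> (r1 \<cdot> (r2 \<cdot> r3)))" unfolding r3(3)[symmetric] using ty by (simp add:
    Comp_assoc)
  finally have fin: "f \<cdot> (x \<cdot> (r1 \<cdot> (r2 \<cdot> r3))) = f' \<cdot> (x' \<cdot> (r1 \<cdot> (r2 \<cdot> r3)))" .
  have "r1 \<cdot> (r2 \<cdot> r3) \<in> W" using q r2 r3 qa r2a r3a by (intro W_Comp) auto
  then show ?thesis using that[OF _ _ fin] ty by simp
qed

lemma reqI:
  assumes "u \<in> Arr K" "v \<in> Arr K" "Dom K u = Dom K v" "Cod K u = Dom K s" "Cod K v = Dom K t"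
      "s \<cdot> u \<in> W" "s \<cdot> u = t \<cdot> v" "f \<cdot> u = g \<cdot> v" "Cod K s = Cod K t" "Cod K f = Cod K g"
  shows "req s f t g"
  unfolding req_def roof_equiv.simps using assms by blast

lemma req_refl: assumes "(s, f) \<in> roofs K N" shows "req s f s f"
  by (rule reqI[of "Id K (Dom K s)" "Id K (Dom K s)"]) (use assms in \<open>auto simp: roofs_iff\<close>)

lemma req_sym: assumes "req s f t g" shows "req t g s f"
proof -
  obtain u v where u: "u \<in> Arr K" "v \<in> Arr K" "Dom K u = Dom K v" "Cod K u = Dom K s"
    "Cod K v = Dom K t"
      "s \<cdot> u \<in> W" "s \<cdot> u = t \<cdot> v" "f \<cdot> u = g \<cdot> v" "Cod K s = Cod K t" "Cod K f = Cod K g"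
    using assms by (rule reqE)
  then show ?thesis by (intro reqI[of v u]) auto
qed

text \<open>
  Bring the three denominators to a common one by \<open>W_ore\<close> and transfer along both equivalences.
\<close>
lemma req_trans:
  assumes 1: "req s f t g" and 2: "req t g r h"
    and R: "(s, f) \<in> roofs K N" "(t, g) \<in> roofs K N" "(r, h) \<in> roofs K N"
  shows "req s f r h"
proof -
  have s: "s \<in> W" "f \<in> Arr K" "Dom K f = Dom K s" and t: "t \<in> W" "g \<in> Arr K" "Dom K g = Dom K t"
    and r: "r \<in> W" "h \<in> Arr K" "Dom K h = Dom K r" using R by (auto simp: roofs_iff)
  have C: "Cod K t = Cod K s" "Cod K r = Cod K s" "Cod K g = Cod K f" "Cod K h = Cod K f"
    using req_Cod[OF 1] req_Cod[OF 2] by auto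
  note a = W_Arr[OF s(1)] W_Arr[OF t(1)] W_Arr[OF r(1)]
  obtain x y where x: "x \<in> W" "y \<in> Arr K" "Dom K x = Dom K y" "Cod K x = Dom K s"
    "Cod K y = Dom K t" "s \<cdot> x = t \<cdot> y"
    by (rule W_ore[OF t(1) a(1)]) (use C in auto)
  note xa = W_Arr[OF x(1)]
  obtain w z where w: "w \<in> W" "z \<in> Arr K" "Dom K w = Dom K z" "Cod K w = Dom K y" "Cod K z = Dom K r"
     "(t \<cdot> y) \<cdot> w = r \<cdot> z"
    by (rule W_ore[OF r(1), of "t \<cdot> y"]) (use C a x t in auto)
  note wa = W_Arr[OF w(1)]
  have e1: "s \<cdot> (x \<cdot> w) = t \<cdot> (y \<cdot> w)"
    using Comp_cong_assoc[OF x(6), of w] Comp_assoc[of w y t] a xa wa x(2-5) w(2-5) by simp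
  have e2: "t \<cdot> (y \<cdot> w) = r \<cdot> z"
    using w(6) Comp_assoc[of w y t] a xa wa x(2-5) w(2-5) by simp
  obtain k where k: "k \<in> W" "Cod K k = Dom K z" "f \<cdot> ((x \<cdot> w) \<cdot> k) = g \<cdot> ((y \<cdot> w) \<cdot> k)"
    by (rule req_transfer[OF 1, of "x \<cdot> w" "y \<cdot> w"]) (use s t a xa wa x(2-5) w(2-5) e1 in auto)
  note ka = W_Arr[OF k(1)]
  have e3: "t \<cdot> ((y \<cdot> w) \<cdot> k) = r \<cdot> (z \<cdot> k)"
    using Comp_cong_assoc[OF e2, of k] Comp_assoc[of k z r] a xa wa ka x(2-5) w(2-5) k(2) by simp
  obtain l where l: "l \<in> W" "Cod K l = Dom K k" "g \<cdot> (((y \<cdot> w) \<cdot> k) \<cdot> l) = h \<cdot> ((z \<cdot> k) \<cdot> l)"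
    by (rule req_transfer[OF 2, of "(y \<cdot> w) \<cdot> k" "z \<cdot> k"]) (use r t a xa wa ka x(2-5) w(2-5) k(2) e3
      in auto)
  note la = W_Arr[OF l(1)]
  note ty = a s(2-3) t(2-3) r(2-3) xa wa ka la x(2-5) w(2-5) k(2) l(2) C
  show ?thesis
  proof (rule reqI[of "((x \<cdot> w) \<cdot> k) \<cdot> l" "(z \<cdot> k) \<cdot> l"])
    show "s \<cdot> (((x \<cdot> w) \<cdot> k) \<cdot> l) \<in> W"
      using ty s x w k l by (intro W_Comp) auto
    have "s \<cdot> (((x \<cdot> w) \<cdot> k) \<cdot> l) = (s \<cdot> (x \<cdot> w)) \<cdot> (k \<cdot> l)" using ty by (simp add: Comp_assoc)
    also have "\<dots> = r \<cdot> ((z \<cdot> k) \<cdot> l)" unfolding e1 e2 using ty by (simp add: Comp_assoc)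
    finally show "s \<cdot> (((x \<cdot> w) \<cdot> k) \<cdot> l) = r \<cdot> ((z \<cdot> k) \<cdot> l)" .
    have "f \<cdot> (((x \<cdot> w) \<cdot> k) \<cdot> l) = (f \<cdot> ((x \<cdot> w) \<cdot> k)) \<cdot> l" using ty by (simp add: Comp_assoc)
    also have "\<dots> = g \<cdot> (((y \<cdot> w) \<cdot> k) \<cdot> l)" unfolding k(3) using ty by (simp add: Comp_assoc)
    finally show "f \<cdot> (((x \<cdot> w) \<cdot> k) \<cdot> l) = h \<cdot> ((z \<cdot> k) \<cdot> l)" using l(3) by simp
  qed (use ty in auto)
qed

lemma mem_frac: "(t, g) \<in> frac K N s f \<longleftrightarrow> (t, g) \<in> roofs K N \<and> req s f t g"
  by (simp add: frac_def req_def)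

lemma frac_eq_iff:
  assumes "(s, f) \<in> roofs K N" "(t, g) \<in> roofs K N"
  shows "frac K N s f = frac K N t g \<longleftrightarrow> req s f t g"
proof
  assume "frac K N s f = frac K N t g"
  then show "req s f t g" using mem_frac[of t g s f] mem_frac[of t g t g] req_refl assms by simp
next
  assume e: "req s f t g"
  have "(r, h) \<in> frac K N s f \<longleftrightarrow> (r, h) \<in> frac K N t g" for r h
    unfolding mem_frac using e req_sym[OF e] req_trans assms by blast
  then show "frac K N s f = frac K N t g" by auto
qed

abbreviation q where "q \<equiv> FArr (verdier_functor K N)"

lemma q_def: "q f = frac K N (Id K (Dom K f)) f" by (simp add: verdier_functor_def)

lemma verdier_functor_FObj [simp]: "FObj (verdier_functor K N) X = X" by (simp add: verdier_functor_def)

lemma roof_Id [simp]: "f \<in> Arr K \<Longrightarrow> (Id K (Dom K f), f) \<in> roofs K N" by (simp add: roofs_iff)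

lemma frac_eq_q:
  assumes "(s, g) \<in> roofs K N" "f \<in> Arr K" "req s g (Id K (Dom K f)) f" shows "frac K N s g = q f"
  using frac_eq_iff[OF assms(1) roof_Id[OF assms(2)]] assms(3) by (simp add: q_def)

lemma mem_q:
  assumes "f \<in> Arr K"
  shows "(s, f') \<in> q f \<longleftrightarrow> s \<in> W \<and> f' \<in> Arr K \<and> Dom K f' = Dom K s \<and> req (Id K (Dom K f)) f s f'"
  by (auto simp: q_def mem_frac roofs_iff)

lemma q_cong:
  assumes f: "f \<in> Arr K" "g \<in> Arr K" "Dom K g = Dom K f" "Cod K g = Cod K f" and u: "u \<in> W"
    "Cod K u = Dom K f" "f \<cdot> u = g \<cdot> u"
  shows "q f = q g"
proof -
  have "req (Id K (Dom K f)) f (Id K (Dom K g)) g" by (rule reqI[of u u]) (use f u in auto)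
  then show ?thesis using frac_eq_iff[OF roof_Id[OF f(1)] roof_Id[OF f(2)]] by (simp add: q_def)
qed

lemma q_eqD:
  assumes f: "f \<in> Arr K" "g \<in> Arr K" and e: "q f = q g"
  obtains u where "u \<in> W" "Cod K u = Dom K f" "f \<cdot> u = g \<cdot> u" "Dom K g = Dom K f" "Cod K g = Cod K f"
proof -
  have "req (Id K (Dom K f)) f (Id K (Dom K g)) g" using e frac_eq_iff[OF roof_Id[OF f(1)]
    roof_Id[OF f(2)]] by (simp add: q_def)
  note r = this
  obtain u v where u: "u \<in> Arr K" "v \<in> Arr K" "Cod K u = Dom K (Id K (Dom K f))"
    "Cod K v = Dom K (Id K (Dom K g))"
      "Id K (Dom K f) \<cdot> u \<in> W" "Id K (Dom K f) \<cdot> u = Id K (Dom K g) \<cdot> v" "f \<cdot> u = g \<cdot> v"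
    using r by (rule reqE) blast
  have "u = v" "u \<in> W" using u f by simp_all
  then show ?thesis using that[of u] u(3,7) req_Cod[OF r] f by simp
qed

lemma V_simps:
  "Obj V = Obj K" "Arr V = {frac K N s f | s f. (s, f) \<in> roofs K N}"
  "Id V X = frac K N (Id K X) (Id K X)" "Susp V = verdier_susp K N"
  by (simp_all add: verdier_quotient_def Let_def preadd.extend_def tri_cat.fields_def
    verdier_preadd_def)

lemma frac_Dom: assumes "(s, f) \<in> roofs K N" shows "Dom V (frac K N s f) = Cod K s"
proof -
  have "(THE X. \<forall>(s', f') \<in> frac K N s f. Cod K s' = X) = Cod K s"
  proof (rule the_equality)
    show "\<forall>(s', f') \<in> frac K N s f. Cod K s' = Cod K s" by (auto simp: frac_def)
    have "(s, f) \<in> frac K N s f" using assms req_refl mem_frac by blast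
    then show "X = Cod K s" if "\<forall>(s', f') \<in> frac K N s f. Cod K s' = X" for X using that by auto
  qed
  then show ?thesis by (simp add: verdier_quotient_def Let_def preadd.extend_def tri_cat.fields_def
    verdier_preadd_def)
qed

lemma frac_Cod: assumes "(s, f) \<in> roofs K N" shows "Cod V (frac K N s f) = Cod K f"
proof -
  have "(THE X. \<forall>(s', f') \<in> frac K N s f. Cod K f' = X) = Cod K f"
  proof (rule the_equality)
    show "\<forall>(s', f') \<in> frac K N s f. Cod K f' = Cod K f" by (auto simp: frac_def)
    have "(s, f) \<in> frac K N s f" using assms req_refl mem_frac by blast
    then show "X = Cod K f" if "\<forall>(s', f') \<in> frac K N s f. Cod K f' = X" for X using that by auto
  qed
  then show ?thesis by (simp add: verdier_quotient_def Let_def preadd.extend_def tri_cat.fields_def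
    verdier_preadd_def)
qed

lemma q_simps [simp]:
  assumes "f \<in> Arr K" shows "q f \<in> Arr V" "Dom V (q f) = Dom K f" "Cod V (q f) = Cod K f"
  using assms roof_Id[OF assms] frac_Dom[of "Id K (Dom K f)" f] frac_Cod[of "Id K (Dom K f)" f]
  unfolding q_def V_simps by (blast, simp_all)

lemma q_Id: "X \<in> Obj K \<Longrightarrow> Id V X = q (Id K X)" by (simp add: V_simps q_def)

text \<open>
  Any representatives of the two fractions and any Ore square between them give the same class:
  two transfers show that the resulting roof is equivalent to \<open>(1, g f)\<close>.
\<close>
lemma q_Comp:
  assumes f: "f \<in> Arr K" "g \<in> Arr K" "Cod K f = Dom K g"
  shows "q g \<cdot>\<^bsub>V\<^esub> q f = q (g \<cdot> f)"
proof -
  have "(THE H. \<exists>s f' t g' u v. (s, f') \<in> q f \<and> (t, g') \<in> q g \<and> u \<in> W \<and> v \<in> Arr K \<and>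
        Dom K u = Dom K v \<and> Cod K u = Dom K f' \<and> Cod K v = Dom K t \<and>
        f' \<cdot> u = t \<cdot> v \<and> H = frac K N (s \<cdot> u) (g' \<cdot> v)) = q (g \<cdot> f)" (is "(THE H. ?P H) = _")
  proof (rule the_equality)
    show "?P (q (g \<cdot> f))"
      apply (rule exI[of _ "Id K (Dom K f)"], rule exI[of _ f], rule exI[of _ "Id K (Dom K g)"],
        rule exI[of _ g],
         rule exI[of _ "Id K (Dom K f)"], rule exI[of _ f])
      using f req_refl by (simp add: mem_q q_def[of "g \<cdot> f"])
  next
    fix H assume "?P H"
    then obtain s f' t g' u v where *: "(s, f') \<in> q f" "(t, g') \<in> q g" "u \<in> W" "v \<in> Arr K"
      "Dom K u = Dom K v" "Cod K u = Dom K f'" "Cod K v = Dom K t" "f' \<cdot> u = t \<cdot> v"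
      "H = frac K N (s \<cdot> u) (g' \<cdot> v)"
      by blast
    have s: "s \<in> W" "f' \<in> Arr K" "Dom K f' = Dom K s" "req (Id K (Dom K f)) f s f'"
      and t: "t \<in> W" "g' \<in> Arr K" "Dom K g' = Dom K t" "req (Id K (Dom K g)) g t g'"
      using * f by (auto simp: mem_q)
    have C: "Cod K s = Dom K f" "Cod K f' = Cod K f" "Cod K t = Dom K g" "Cod K g' = Cod K g"
      using req_Cod[OF s(4)] req_Cod[OF t(4)] f by auto
    note a = W_Arr[OF s(1)] W_Arr[OF t(1)] W_Arr[OF *(3)]
    obtain r where r: "r \<in> W" "Cod K r = Dom K v" "f \<cdot> ((s \<cdot> u) \<cdot> r) = f' \<cdot> (u \<cdot> r)"
      by (rule req_transfer[OF s(4), of "s \<cdot> u" u]) (use a s(1-3) t(1-3) C f *(3-7) in auto)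
    note ra = W_Arr[OF r(1)]
    obtain r' where r': "r' \<in> W" "Cod K r' = Dom K r" "g \<cdot> ((t \<cdot> (v \<cdot> r)) \<cdot> r') = g' \<cdot> ((v \<cdot> r) \<cdot> r')"
      by (rule req_transfer[OF t(4), of "t \<cdot> (v \<cdot> r)" "v \<cdot> r"]) (use a ra r(2) s(1-3) t(1-3) C f
        *(3-7) in auto)
    note ra' = W_Arr[OF r'(1)]
    note ty = a ra ra' r(2) r'(2) s(2-3) t(2-3) C f *(4-7)
    have "req (s \<cdot> u) (g' \<cdot> v) (Id K (Dom K (g \<cdot> f))) (g \<cdot> f)"
    proof (rule reqI[of "r \<cdot> r'" "(s \<cdot> u) \<cdot> (r \<cdot> r')"])
      show "(s \<cdot> u) \<cdot> (r \<cdot> r') \<in> W" using ty s(1) *(3) r(1) r'(1) by (intro W_Comp) auto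
      have "(g' \<cdot> v) \<cdot> (r \<cdot> r') = g' \<cdot> ((v \<cdot> r) \<cdot> r')" using ty by (simp add: Comp_assoc)
      also have "\<dots> = g \<cdot> ((t \<cdot> v) \<cdot> (r \<cdot> r'))" unfolding r'(3)[symmetric] using ty by (simp add:
        Comp_assoc)
      also have "\<dots> = g \<cdot> ((f' \<cdot> (u \<cdot> r)) \<cdot> r')" unfolding *(8)[symmetric] using ty by (simp add:
        Comp_assoc)
      also have "\<dots> = (g \<cdot> f) \<cdot> ((s \<cdot> u) \<cdot> (r \<cdot> r'))" unfolding r(3)[symmetric] using ty by (simp
        add: Comp_assoc)
      finally show "(g' \<cdot> v) \<cdot> (r \<cdot> r') = (g \<cdot> f) \<cdot> ((s \<cdot> u) \<cdot> (r \<cdot> r'))" .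
    qed (use ty in auto)
    moreover have "(s \<cdot> u, g' \<cdot> v) \<in> roofs K N"
      unfolding roofs_iff using ty W_Comp[OF *(3) s(1)] by simp
    ultimately have "frac K N (s \<cdot> u) (g' \<cdot> v) = q (g \<cdot> f)"
      by (intro frac_eq_q) (use f in auto)
    then show "H = q (g \<cdot> f)" using *(9) by simp
  qed
  then show ?thesis
    by (simp add: verdier_quotient_def Let_def preadd.extend_def tri_cat.fields_def verdier_preadd_def)
qed

lemma q_Add:
  assumes f: "f \<in> Arr K" "g \<in> Arr K" "Dom K g = Dom K f" "Cod K g = Cod K f"
  shows "q f \<oplus>\<^bsub>V\<^esub> q g = q (f \<oplus> g)"
proof -
  have "(THE H. \<exists>s f' g'. (s, f') \<in> q f \<and> (s, g') \<in> q g \<and> H = frac K N s (f' \<oplus> g')) = q (f \<oplus> g)"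
    (is "(THE H. ?P H) = _")
  proof (rule the_equality)
    show "?P (q (f \<oplus> g))"
      apply (rule exI[of _ "Id K (Dom K f)"], rule exI[of _ f], rule exI[of _ g])
      using f req_refl[OF roof_Id[of f]] req_refl[OF roof_Id[of g]] by (simp add: mem_q q_def[of
        "f \<oplus> g"])
  next
    fix H assume "?P H"
    then obtain s f' g' where *: "(s, f') \<in> q f" "(s, g') \<in> q g" "H = frac K N s (f' \<oplus> g')" by blast
    have s: "s \<in> W" "f' \<in> Arr K" "Dom K f' = Dom K s" "req (Id K (Dom K f)) f s f'"
      "g' \<in> Arr K" "Dom K g' = Dom K s" "req (Id K (Dom K g)) g s g'"
      using * f by (auto simp: mem_q)
    have C: "Cod K s = Dom K f" "Cod K f' = Cod K f" "Cod K g' = Cod K f"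
      using req_Cod[OF s(4)] req_Cod[OF s(7)] f by auto
    note a = W_Arr[OF s(1)]
    obtain r where r: "r \<in> W" "Cod K r = Dom K s" "f \<cdot> (s \<cdot> r) = f' \<cdot> (Id K (Dom K s) \<cdot> r)"
      by (rule req_transfer[OF s(4), of s "Id K (Dom K s)"]) (use a s(1-3) C f in auto)
    note ra = W_Arr[OF r(1)]
    obtain r' where r': "r' \<in> W" "Cod K r' = Dom K r" "g \<cdot> ((s \<cdot> r) \<cdot> r') = g' \<cdot> (r \<cdot> r')"
      by (rule req_transfer[OF s(7), of "s \<cdot> r" r]) (use a ra r(2) s(1) s(5-6) C f in auto)
    note ra' = W_Arr[OF r'(1)]
    note ty = a ra ra' r(2) r'(2) s(2-3) s(5-6) C f
    have "f' \<cdot> (r \<cdot> r') = (f' \<cdot> (Id K (Dom K s) \<cdot> r)) \<cdot> r'" using ty by (simp add: Comp_assoc)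
    also have "\<dots> = f \<cdot> (s \<cdot> (r \<cdot> r'))" unfolding r(3)[symmetric] using ty by (simp add: Comp_assoc)
    finally have 1: "f' \<cdot> (r \<cdot> r') = f \<cdot> (s \<cdot> (r \<cdot> r'))" .
    have 2: "g' \<cdot> (r \<cdot> r') = g \<cdot> (s \<cdot> (r \<cdot> r'))" unfolding r'(3)[symmetric] using ty by (simp add:
      Comp_assoc)
    have "req s (f' \<oplus> g') (Id K (Dom K (f \<oplus> g))) (f \<oplus> g)"
    proof (rule reqI[of "r \<cdot> r'" "s \<cdot> (r \<cdot> r')"])
      show "s \<cdot> (r \<cdot> r') \<in> W" using ty s(1) r(1) r'(1) by (intro W_Comp) auto
      show "(f' \<oplus> g') \<cdot> (r \<cdot> r') = (f \<oplus> g) \<cdot> (s \<cdot> (r \<cdot> r'))"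
        using ty 1 2 by (simp add: Add_Comp)
    qed (use ty in auto)
    moreover have "(s, f' \<oplus> g') \<in> roofs K N" unfolding roofs_iff using ty s(1) by simp
    ultimately have "frac K N s (f' \<oplus> g') = q (f \<oplus> g)"
      by (intro frac_eq_q) (use f in auto)
    then show "H = q (f \<oplus> g)" using *(3) by simp
  qed
  then show ?thesis
    by (simp add: verdier_quotient_def Let_def preadd.extend_def tri_cat.fields_def verdier_preadd_def)
qed

lemma q_susp:
  assumes f: "f \<in> Arr K" shows "FArr (verdier_susp K N) (q f) = q (SA f)"
proof -
  have "(THE G. \<exists>(s, f') \<in> q f. G = frac K N (SA s) (SA f')) = q (SA f)"
  proof (rule the_equality)
    show "\<exists>(s, f') \<in> q f. q (SA f) = frac K N (SA s) (SA f')"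
      by (rule bexI[of _ "(Id K (Dom K f), f)"]) (use f req_refl in \<open>auto simp: mem_q q_def[of "SA f"]\<close>)
  next
    fix G assume "\<exists>(s, f') \<in> q f. G = frac K N (SA s) (SA f')"
    then obtain s f' where *: "(s, f') \<in> q f" "G = frac K N (SA s) (SA f')" by auto
    then have s: "s \<in> W" "f' \<in> Arr K" "Dom K f' = Dom K s" "req (Id K (Dom K f)) f s f'"
      using f by (auto simp: mem_q)
    note a = W_Arr[OF s(1)]
    have C: "Cod K s = Dom K f" "Cod K f' = Cod K f" using req_Cod[OF s(4)] f by auto
    obtain u v where uv: "u \<in> Arr K" "v \<in> Arr K" "Dom K u = Dom K v"
      "Cod K u = Dom K (Id K (Dom K f))" "Cod K v = Dom K s"
      "Id K (Dom K f) \<cdot> u \<in> W" "Id K (Dom K f) \<cdot> u = s \<cdot> v" "f \<cdot> u = f' \<cdot> v"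
      using s(4) by (rule reqE) blast
    have u: "u \<in> Arr K" "v \<in> Arr K" "Dom K v = Dom K u" "Cod K u = Dom K f" "Cod K v = Dom K s"
      "u \<in> W" "s \<cdot> v = u" "f' \<cdot> v = f \<cdot> u" using uv f by simp_all
    have r: "req (Id K (Dom K (SA f))) (SA f) (SA s) (SA f')"
    proof (rule reqI[of "SA u" "SA v"])
      show "Id K (Dom K (SA f)) \<cdot> SA u \<in> W" using f u(1-5) W_susp[OF u(6)] by simp
      show "Id K (Dom K (SA f)) \<cdot> SA u = SA s \<cdot> SA v"
        using susp_simps(6)[of v s] u f a C by simp
      show "SA f \<cdot> SA u = SA f' \<cdot> SA v"
        using susp_simps(6)[of v f'] susp_simps(6)[of u f] u f a s(2,3) by simp
    qed (use u(1-5) f a s(2,3) C in auto)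
    have "(SA s, SA f') \<in> roofs K N" using W_susp[OF s(1)] s a by (simp add: roofs_iff)
    then have "frac K N (SA s) (SA f') = q (SA f)"
      by (rule frac_eq_q) (use f req_sym[OF r] in auto)
    then show "G = q (SA f)" using *(2) by simp
  qed
  then show ?thesis by (simp add: verdier_susp_def)
qed

lemma Susp_V_FObj [simp]: "FObj (verdier_susp K N) X = S X" by (simp add: verdier_susp_def)

lemma Tri_V: "T \<in> Tri V \<longleftrightarrow> T \<in> candidates V (verdier_susp K N) \<and>
   (\<exists>f g h. (f, g, h) \<in> Tri K \<and> tri_isomorphic V (verdier_susp K N) (q f, q g, q h) T)"
proof -
  let ?C = "verdier_preadd K N"
  have 1: "Arr ?C = Arr V" "Dom ?C = Dom V" "Cod ?C = Cod V" "Id ?C = Id V" "Comp ?C = Comp V"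
    by (simp_all add: verdier_quotient_def Let_def preadd.extend_def tri_cat.fields_def)
  have "Tri V = {T \<in> candidates ?C (verdier_susp K N). \<exists>(f, g, h) \<in> Tri K.
     tri_isomorphic ?C (verdier_susp K N) (q f, q g, q h) T}"
    by (simp add: verdier_quotient_def Let_def preadd.extend_def tri_cat.fields_def)
  then show ?thesis unfolding tri_isomorphic_cong[OF 1] by auto
qed

end

section \<open>Localizations are exact\<close>
lemma inverse_choice:
  assumes "category L" and "\<And>X. X \<in> A \<Longrightarrow> is_iso L (\<alpha> X)"
  obtains \<beta> where "\<And>X. X \<in> A \<Longrightarrow> \<beta> X \<in> Arr L \<and> Dom L (\<beta> X) = Cod L (\<alpha> X) \<and> Cod L (\<beta> X) = Dom L (\<alpha> X) \<and>
    \<beta> X \<cdot>\<^bsub>L\<^esub> \<alpha> X = Id L (Dom L (\<alpha> X)) \<and> \<alpha> X \<cdot>\<^bsub>L\<^esub> \<beta> X = Id L (Cod L (\<alpha> X)) \<and> is_iso L (\<beta> X)"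
proof -
  interpret category L by fact
  have "\<forall>X\<in>A. \<exists>b. b \<in> Arr L \<and> Dom L b = Cod L (\<alpha> X) \<and> Cod L b = Dom L (\<alpha> X) \<and>
    b \<cdot>\<^bsub>L\<^esub> \<alpha> X = Id L (Dom L (\<alpha> X)) \<and> \<alpha> X \<cdot>\<^bsub>L\<^esub> b = Id L (Cod L (\<alpha> X)) \<and> is_iso L b"
    using assms(2) by (metis is_isoE)
  from bchoice[OF this] show ?thesis using that by blast
qed

text \<open>
  With \<open>\<alpha> : F \<cong> G\<close> and \<open>\<phi> : G \<Sigma> \<cong> \<Sigma> G\<close>, the functor \<open>F\<close> commutes with the suspensions through
  \<open>\<Sigma>(\<alpha>\<^sup>-\<^sup>1) \<circ> \<phi> \<circ> \<alpha>\<Sigma>\<close>.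
\<close>
lemma (in triangulated_category) exact_functor_cong:
  assumes L: "category L" and SL: "is_functor L L (Susp L)"
    and Tri: "Tri L \<subseteq> candidates L (Susp L)"
    and closed: "\<And>T T'. \<lbrakk>T \<in> Tri L; T' \<in> candidates L (Susp L); tri_isomorphic L (Susp L) T T'\<rbrakk> \<Longrightarrow>
      T' \<in> Tri L"
    and F: "additive_functor K L F" and G: "is_functor K L G"
    and \<alpha>: "natural_iso K L F G \<alpha>"
    and \<phi>: "natural_iso K L (fcomp G (Susp K)) (fcomp (Susp L) G) \<phi>"
    and GT: "\<And>f g h. (f, g, h) \<in> Tri K \<Longrightarrow> (FArr G f, FArr G g, \<phi> (Dom K f) \<cdot>\<^bsub>L\<^esub> FArr G h) \<in> Tri L"
  shows "exact_functor K L F"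
proof -
  interpret L: category L by fact
  have FF: "is_functor K L F" using F by (simp add: additive_functor_def)
  note sl = is_functorD[OF SL] and ff = is_functorD[OF FF] and gg = is_functorD[OF G]
  have al: "\<alpha> X \<in> Arr L" "Dom L (\<alpha> X) = FObj F X" "Cod L (\<alpha> X) = FObj G X" "is_iso L (\<alpha> X)" if
    "X \<in> Obj K" for X
    using \<alpha> that by (auto simp: natural_iso_def in_Hom)
  have aln: "FArr G f \<cdot>\<^bsub>L\<^esub> \<alpha> (Dom K f) = \<alpha> (Cod K f) \<cdot>\<^bsub>L\<^esub> FArr F f" if "f \<in> Arr K" for f
    using \<alpha> that by (auto simp: natural_iso_def)
  have ph: "\<phi> X \<in> Arr L" "Dom L (\<phi> X) = FObj G (S X)" "Cod L (\<phi> X) = FObj (Susp L) (FObj G X)"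
    "is_iso L (\<phi> X)" if "X \<in> Obj K" for X
    using \<phi> that by (auto simp: natural_iso_def in_Hom fcomp_def)
  have phn: "FArr (Susp L) (FArr G f) \<cdot>\<^bsub>L\<^esub> \<phi> (Dom K f) = \<phi> (Cod K f) \<cdot>\<^bsub>L\<^esub> FArr G (SA f)" if
    "f \<in> Arr K" for f
    using \<phi> that by (auto simp: natural_iso_def fcomp_def)
  obtain \<beta> where be0: "\<And>X. X \<in> Obj K \<Longrightarrow> \<beta> X \<in> Arr L \<and> Dom L (\<beta> X) = Cod L (\<alpha> X) \<and> Cod L (\<beta> X) =
    Dom L (\<alpha> X) \<and>
    \<beta> X \<cdot>\<^bsub>L\<^esub> \<alpha> X = Id L (Dom L (\<alpha> X)) \<and> \<alpha> X \<cdot>\<^bsub>L\<^esub> \<beta> X = Id L (Cod L (\<alpha> X)) \<and> is_iso L (\<beta> X)"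
    using inverse_choice[OF L, of "Obj K" \<alpha>] al(4) by blast
  have be: "\<beta> X \<in> Arr L" "Dom L (\<beta> X) = FObj G X" "Cod L (\<beta> X) = FObj F X" "is_iso L (\<beta> X)"
    "\<alpha> X \<cdot>\<^bsub>L\<^esub> \<beta> X = Id L (FObj G X)" "\<beta> X \<cdot>\<^bsub>L\<^esub> \<alpha> X = Id L (FObj F X)" if "X \<in> Obj K" for X
    using be0[OF that] al[OF that] by auto
  note ty = al(1-3) be(1-3) ph(1-3) sl(1-4) ff(1-4) gg(1-4)
  have ben: "FArr F f \<cdot>\<^bsub>L\<^esub> \<beta> (Dom K f) = \<beta> (Cod K f) \<cdot>\<^bsub>L\<^esub> FArr G f" if f: "f \<in> Arr K" for f
  proof -
    have "\<beta> (Cod K f) \<cdot>\<^bsub>L\<^esub> FArr G f = \<beta> (Cod K f) \<cdot>\<^bsub>L\<^esub> ((FArr G f \<cdot>\<^bsub>L\<^esub> \<alpha> (Dom K f)) \<cdot>\<^bsub>L\<^esub> \<beta> (Dom K f))"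
      using f ty L.Comp_cong_assoc[OF be(5)[of "Dom K f"]] by (simp add: L.Comp_assoc be(5))
    also have "\<dots> = (\<beta> (Cod K f) \<cdot>\<^bsub>L\<^esub> \<alpha> (Cod K f)) \<cdot>\<^bsub>L\<^esub> (FArr F f \<cdot>\<^bsub>L\<^esub> \<beta> (Dom K f))"
      unfolding aln[OF f] using f ty by (simp add: L.Comp_assoc)
    also have "\<dots> = FArr F f \<cdot>\<^bsub>L\<^esub> \<beta> (Dom K f)" using f ty by (simp add: be(6))
    finally show ?thesis by simp
  qed
  define \<psi> where "\<psi> X = FArr (Susp L) (\<beta> X) \<cdot>\<^bsub>L\<^esub> (\<phi> X \<cdot>\<^bsub>L\<^esub> \<alpha> (S X))" for X
  have ps: "\<psi> X \<in> Arr L" "Dom L (\<psi> X) = FObj F (S X)" "Cod L (\<psi> X) = FObj (Susp L) (FObj F X)" if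
    "X \<in> Obj K" for X
    using that ty by (auto simp: \<psi>_def)
  have psi: "is_iso L (\<psi> X)" if X: "X \<in> Obj K" for X
    unfolding \<psi>_def using X ty functor_is_iso[OF L SL be(4)[OF X]] al(4)[of "S X"] ph(4)[OF X]
    by (intro L.is_iso_Comp) auto
  have psn: "FArr (Susp L) (FArr F f) \<cdot>\<^bsub>L\<^esub> \<psi> (Dom K f) = \<psi> (Cod K f) \<cdot>\<^bsub>L\<^esub> FArr F (SA f)" if f:
    "f \<in> Arr K" for f
  proof -
    have an: "FArr G (SA f) \<cdot>\<^bsub>L\<^esub> \<alpha> (S (Dom K f)) = \<alpha> (S (Cod K f)) \<cdot>\<^bsub>L\<^esub> FArr F (SA f)"
      using aln[of "SA f"] f by simp
    have "FArr (Susp L) (FArr F f) \<cdot>\<^bsub>L\<^esub> \<psi> (Dom K f) =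
      FArr (Susp L) (FArr F f \<cdot>\<^bsub>L\<^esub> \<beta> (Dom K f)) \<cdot>\<^bsub>L\<^esub> (\<phi> (Dom K f) \<cdot>\<^bsub>L\<^esub> \<alpha> (S (Dom K f)))"
      using f ty by (simp add: \<psi>_def L.Comp_assoc sl(6))
    also have "\<dots> =
      FArr (Susp L) (\<beta> (Cod K f)) \<cdot>\<^bsub>L\<^esub> ((FArr (Susp L) (FArr G f) \<cdot>\<^bsub>L\<^esub> \<phi> (Dom K f)) \<cdot>\<^bsub>L\<^esub> \<alpha> (S (Dom K
        f)))"
      unfolding ben[OF f] using f ty by (simp add: L.Comp_assoc sl(6))
    also have "\<dots> =
      FArr (Susp L) (\<beta> (Cod K f)) \<cdot>\<^bsub>L\<^esub> (\<phi> (Cod K f) \<cdot>\<^bsub>L\<^esub> (FArr G (SA f) \<cdot>\<^bsub>L\<^esub> \<alpha> (S (Dom K f))))"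
      unfolding phn[OF f] using f ty by (simp add: L.Comp_assoc)
    also have "\<dots> = \<psi> (Cod K f) \<cdot>\<^bsub>L\<^esub> FArr F (SA f)"
      unfolding an using f ty by (simp add: \<psi>_def L.Comp_assoc)
    finally show ?thesis .
  qed
  have "natural_iso K L (fcomp F (Susp K)) (fcomp (Susp L) F) \<psi>"
    using ps psi psn by (simp add: natural_iso_def fcomp_def in_Hom)
  moreover have "(FArr F f, FArr F g, \<psi> (Dom K f) \<cdot>\<^bsub>L\<^esub> FArr F h) \<in> Tri L" if T: "(f, g, h) \<in> Tri K"
    for f g h
  proof (rule closed[OF GT[OF T]])
    note t = triD[OF T]
    show "(FArr F f, FArr F g, \<psi> (Dom K f) \<cdot>\<^bsub>L\<^esub> FArr F h) \<in> candidates L (Susp L)"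
      using t ps ty by (simp add: candidates_def)
    have b1: "\<beta> (Dom K g) \<cdot>\<^bsub>L\<^esub> FArr G f = FArr F f \<cdot>\<^bsub>L\<^esub> \<beta> (Dom K f)" using ben[of f] t by simp
    have b2: "\<beta> (Cod K g) \<cdot>\<^bsub>L\<^esub> FArr G g = FArr F g \<cdot>\<^bsub>L\<^esub> \<beta> (Dom K g)" using ben[of g] t by simp
    have an: "FArr G h \<cdot>\<^bsub>L\<^esub> \<alpha> (Dom K h) = \<alpha> (S (Dom K f)) \<cdot>\<^bsub>L\<^esub> FArr F h"
      using aln[of h] t by simp
    have "(\<psi> (Dom K f) \<cdot>\<^bsub>L\<^esub> FArr F h) \<cdot>\<^bsub>L\<^esub> \<beta> (Dom K h) =
      FArr (Susp L) (\<beta> (Dom K f)) \<cdot>\<^bsub>L\<^esub> (\<phi> (Dom K f) \<cdot>\<^bsub>L\<^esub> ((\<alpha> (S (Dom K f)) \<cdot>\<^bsub>L\<^esub> FArr F h) \<cdot>\<^bsub>L\<^esub> \<beta>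
        (Dom K h)))"
      using t ty by (simp add: \<psi>_def L.Comp_assoc)
    also have "\<dots> = FArr (Susp L) (\<beta> (Dom K f)) \<cdot>\<^bsub>L\<^esub> (\<phi> (Dom K f) \<cdot>\<^bsub>L\<^esub> FArr G h)"
      unfolding an[symmetric] using t ty by (simp add: L.Comp_assoc be(5))
    finally have b3: "FArr (Susp L) (\<beta> (Dom K f)) \<cdot>\<^bsub>L\<^esub> (\<phi> (Dom K f) \<cdot>\<^bsub>L\<^esub> FArr G h) =
      (\<psi> (Dom K f) \<cdot>\<^bsub>L\<^esub> FArr F h) \<cdot>\<^bsub>L\<^esub> \<beta> (Dom K h)" by simp
    show "tri_isomorphic L (Susp L) (FArr G f, FArr G g, \<phi> (Dom K f) \<cdot>\<^bsub>L\<^esub> FArr G h)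
      (FArr F f, FArr F g, \<psi> (Dom K f) \<cdot>\<^bsub>L\<^esub> FArr F h)"
      unfolding tri_isomorphic_def
      by (rule exI[of _ "\<beta> (Dom K f)"], rule exI[of _ "\<beta> (Dom K g)"], rule exI[of _ "\<beta> (Cod K g)"])
        (use t ty b1 b2 b3 be(4) in \<open>simp add: in_Hom\<close>)
  qed
  ultimately show ?thesis using F unfolding exact_functor_def by blast
qed

context verdier begin

lemma is_iso_q_Id: "X \<in> Obj K \<Longrightarrow> is_iso V (q (Id K X))"
  unfolding is_iso_def by (auto simp: in_Hom q_Comp q_Id intro!: bexI[of _ "q (Id K X)"])

lemma q_Tri:
  assumes T: "(f, g, h) \<in> Tri K" shows "(q f, q g, q h) \<in> Tri V"
proof -
  note t = triD[OF T]
  have "(q f, q g, q h) \<in> candidates V (verdier_susp K N)" using t by (simp add: candidates_def)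
  moreover have "tri_isomorphic V (verdier_susp K N) (q f, q g, q h) (q f, q g, q h)"
    unfolding tri_isomorphic_def
    by (rule exI[of _ "q (Id K (Dom K f))"], rule exI[of _ "q (Id K (Dom K g))"], rule exI[of _
      "q (Id K (Dom K h))"])
      (use t in \<open>simp add: in_Hom q_Comp q_susp is_iso_q_Id\<close>)
  ultimately show ?thesis unfolding Tri_V using T by blast
qed

end

context frobenius_stable begin

lemma exact_if_localization:
  assumes "localization K L pi" shows "exact_functor K L pi"
proof -
  obtain N G where N: "thick_subcategory K N" and G: "exact_equivalence (verdier_quotient K N) L G"
    and iso: "naturally_isomorphic K L pi (fcomp G (verdier_functor K N))"
    using assms unfolding localization_def by blast
  interpret v: verdier K N by unfold_locales (use N in \<open>simp add: thick_subcategory_def\<close>)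
  let ?F = "fcomp G (verdier_functor K N)"
  obtain \<alpha> where F: "is_functor K L ?F" and \<alpha>: "natural_iso K L pi ?F \<alpha>"
    using iso unfolding naturally_isomorphic_def by blast
  obtain \<phi> where \<phi>: "natural_iso v.V L (fcomp G (Susp v.V)) (fcomp (Susp L) G) \<phi>"
    and T: "\<forall>(f, g, h) \<in> Tri v.V. (FArr G f, FArr G g, \<phi> (Dom v.V f) \<cdot>\<^bsub>L\<^esub> FArr G h) \<in> Tri L"
    using G unfolding exact_equivalence_def exact_functor_def by blast
  have nat: "FArr SL (FArr G (v.q f)) \<cdot>\<^bsub>L\<^esub> \<phi> (Dom K f) = \<phi> (Cod K f) \<cdot>\<^bsub>L\<^esub> FArr G (v.q (SA f))"
    if "f \<in> Arr K" for f
  proof -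
    have "\<forall>F \<in> Arr v.V. FArr (fcomp (Susp L) G) F \<cdot>\<^bsub>L\<^esub> \<phi> (Dom v.V F) =
      \<phi> (Cod v.V F) \<cdot>\<^bsub>L\<^esub> FArr (fcomp G (Susp v.V)) F"
      using \<phi> unfolding natural_iso_def by blast
    from bspec[OF this, of "v.q f"] show ?thesis using that by (simp add: fcomp_def v.V_simps(4)
      v.q_susp)
  qed
  have "natural_iso K L (fcomp ?F (Susp K)) (fcomp (Susp L) ?F) \<phi>"
    unfolding natural_iso_def
  proof (intro conjI ballI)
    fix X assume X: "X \<in> Obj K"
    then have "X \<in> Obj v.V" by (simp add: v.V_simps)
    then have "\<phi> X \<in> Hom L (FObj (fcomp G (Susp v.V)) X) (FObj (fcomp (Susp L) G) X)" "is_iso L (\<phi> X)"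
      using \<phi> unfolding natural_iso_def by blast+
    then show "\<phi> X \<in> Hom L (FObj (fcomp ?F (Susp K)) X) (FObj (fcomp (Susp L) ?F) X)" "is_iso L (\<phi> X)"
      by (simp_all add: fcomp_def v.V_simps)
  qed (use nat in \<open>simp add: fcomp_def\<close>)
  moreover have "(FArr ?F f, FArr ?F g, \<phi> (Dom K f) \<cdot>\<^bsub>L\<^esub> FArr ?F h) \<in> Tri L" if t:
    "(f, g, h) \<in> Tri K" for f g h
    using bspec[OF T v.q_Tri[OF t]] triD[OF t] by (simp add: fcomp_def)
  moreover have "Tri L \<subseteq> candidates L (Susp L)" using Tri_L by auto
  ultimately show ?thesis
    by (intro exact_functor_cong[OF category_L _ _ _ pi_additive F \<alpha>])
      (use functor_SL Tri_L_iso_closed in auto)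
qed

section \<open>Exact stable functors are localizations\<close>

text \<open>
  Write \<open>i : X \<rightarrow> X\<^sub>E\<close> and \<open>t : X' \<rightarrow> \<Sigma>X\<close> for the first and third arrow. If \<open>X\<close> is injective, the
  \<open>E\<close>-monomorphism \<open>i\<close> has a retraction \<open>r\<close>, and \<open>t = \<Sigma>r \<circ> \<Sigma>i \<circ> t = 0\<close>.
\<close>
lemma tq_zero:
  assumes "X \<in> J" shows "tq X = Zero K (Cod K (tp X)) (S X)"
proof -
  have X: "X \<in> Obj K" using assms by simp
  obtain r where r: "r \<in> Arr K" "Dom K r = Cod K (ti X)" "Cod K r = X" "r \<cdot> ti X = Id K X"
    by (rule J_extend[of "Id K X" "ti X"]) (use X assms tau_mono in auto)
  have 0: "SA (ti X) \<cdot> tq X = Zero K (Cod K (tp X)) (S (Cod K (ti X)))"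
    using tri_comp_zero3[OF tau_Tri[OF X]] X by simp
  have "tq X = SA (r \<cdot> ti X) \<cdot> tq X" using r(4) X by simp
  also have "\<dots> = SA r \<cdot> (SA (ti X) \<cdot> tq X)" using r(1-3) X by (simp add: Comp_assoc)
  also have "\<dots> = Zero K (Cod K (tp X)) (S X)" unfolding 0 using r(1-3) X by simp
  finally show ?thesis .
qed

text \<open>
  If \<open>X\<close> or \<open>X'\<close> lies in \<open>J\<close>, then \<open>X \<rightarrow> X\<^sub>E \<rightarrow> X' \<rightarrow> \<Sigma>X\<close> has zero third arrow, so that both are
  retracts of \<open>X\<^sub>E \<in> J\<close>. For \<open>X'\<close> projective the third arrow vanishes because \<open>X'\<close> lifts along
  the \<open>E\<close>-epimorphism of a triangle in \<open>E\<close> that starts with \<open>X \<rightarrow> X\<^sub>E\<close>.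
\<close>
lemma cosyzygy_J_iff:
  assumes X: "X \<in> Obj K" shows "Cod K (tp X) \<in> J \<longleftrightarrow> X \<in> J"
proof
  assume XJ: "X \<in> J"
  have T: "(ti X, tp X, Zero K (Cod K (tp X)) (S X)) \<in> Tri K" using tau_Tri[OF X] unfolding
    tq_zero[OF XJ] .
  have O: "Cod K (tp X) \<in> Obj K" "S X \<in> Obj K" using X by auto
  obtain s where s: "s \<in> Arr K" "Dom K s = Cod K (tp X)" "Cod K s = Dom K (tp X)"
    "tp X \<cdot> s = Id K (Cod K (tp X))"
    using tri_split(2)[OF T O] by blast
  have "Dom K (tp X) \<in> J" using X tau_J by simp
  then show "Cod K (tp X) \<in> J" using retract_J[OF s(1) tau_simps(2)[OF X] s(3) _ s(2,4)] by blast
next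
  assume TJ: "Cod K (tp X) \<in> J"
  obtain p1 q1 where e: "(ti X, p1, q1) \<in> E" using tau_mono[OF X] by (auto simp: E_mono_def)
  then have T1: "(ti X, p1, q1) \<in> Tri K" using E_tri by auto
  note t1 = triD[OF T1]
  obtain c where c: "c \<in> Arr K" "Dom K c = Cod K (tp X)" "Cod K c = Cod K p1"
    "c \<cdot> tp X = p1 \<cdot> Id K (Dom K p1)" "SA (Id K X) \<cdot> tq X = q1 \<cdot> c"
    by (rule tri_fillE[OF tau_Tri[OF X] T1, of "Id K X" "Id K (Dom K p1)"]) (use X t1 in auto)
  obtain b where b: "b \<in> Arr K" "Dom K b = Dom K c" "Cod K b = Dom K p1" "p1 \<cdot> b = c"
    by (rule J_lift[OF c(1) _ e]) (use c TJ in auto)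
  have "tq X = q1 \<cdot> (p1 \<cdot> b)" using c(5) b(4) X by simp
  also have "\<dots> = Zero K (Cod K (tp X)) (S X)"
    using Comp_cong_assoc[OF tri_comp_zero2[OF T1], of b] b(1-3) t1 c(1-3) X by simp
  finally have z: "tq X = Zero K (Cod K (tp X)) (S X)" .
  have T: "(ti X, tp X, Zero K (Cod K (tp X)) (S X)) \<in> Tri K" using tau_Tri[OF X] unfolding z .
  have O: "Cod K (tp X) \<in> Obj K" "S X \<in> Obj K" using X by auto
  obtain r where r: "r \<in> Arr K" "Dom K r = Cod K (ti X)" "r \<cdot> ti X = Id K X"
    using tri_split(1)[OF T O] X by auto
  show "X \<in> J" by (rule retract_J[of "ti X" r]) (use X r tau_J in auto)
qed

end

locale exact_stable = frobenius_stable +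
  assumes exact: "exact_functor K L pi"
begin

text \<open>A witness of exactness, fixed once and for all.\<close>
definition phi where "phi = (SOME \<phi>. natural_iso K L (fcomp pi (Susp K)) (fcomp (Susp L) pi) \<phi> \<and>
       (\<forall>(f, g, h) \<in> Tri K. (FArr pi f, FArr pi g, \<phi> (Dom K f) \<cdot>\<^bsub>L\<^esub> FArr pi h) \<in> Tri L))"

lemma phi: "natural_iso K L (fcomp pi (Susp K)) (fcomp (Susp L) pi) phi"
    "\<forall>(f, g, h) \<in> Tri K. (FArr pi f, FArr pi g, phi (Dom K f) \<cdot>\<^bsub>L\<^esub> FArr pi h) \<in> Tri L"
  using someI_ex[OF conjunct2[OF exact[unfolded exact_functor_def]]] unfolding phi_def by blast+

lemma phi_simps [simp]:
  assumes "X \<in> Obj K"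
  shows "phi X \<in> Arr L" "Dom L (phi X) = S X" "Cod L (phi X) = Cod K (tp X)" "is_iso L (phi X)"
  using phi(1) assms by (auto simp: natural_iso_def fcomp_def in_Hom FObj_SL)

lemma phi_natural:
  "f \<in> Arr K \<Longrightarrow> FArr SL (cls f) \<cdot>\<^bsub>L\<^esub> phi (Dom K f) = phi (Cod K f) \<cdot>\<^bsub>L\<^esub> cls (SA f)"
  using phi(1) by (auto simp: natural_iso_def fcomp_def)

lemma phi_Tri: "(f, g, h) \<in> Tri K \<Longrightarrow> (cls f, cls g, phi (Dom K f) \<cdot>\<^bsub>L\<^esub> cls h) \<in> Tri L"
  using bspec[OF phi(2), of "(f, g, h)"] by simp

text \<open>
  In \<open>L\<close> the suspension \<open>\<Sigma>X\<close> is isomorphic to \<open>X'\<close>, and \<open>J\<close> is closed under isomorphism in \<open>L\<close>.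
\<close>
lemma susp_J_iff: assumes X: "X \<in> Obj K" shows "S X \<in> J \<longleftrightarrow> X \<in> J"
proof -
  have "phi X \<in> Arr L" using X by simp
  then obtain p where p: "p \<in> Arr K" "phi X = cls p" by (rule L_ArrE)
  have "Dom K p = S X" "Cod K p = Cod K (tp X)" "is_iso L (cls p)" using phi_simps[OF X] p by auto
  then show ?thesis using iso_L_J[of p] p cosyzygy_J_iff[OF X] by simp
qed

text \<open>
  The heart of the proof. The image triangle is isomorphic to a standard triangle on some \<open>f\<^sub>0\<close>,
  and then \<open>Dom f\<^sub>0 \<in> J\<close> too. The triangle \<open>g\<^sub>0, h\<^sub>0, \<Sigma>f\<^sub>0 \<circ> tq\<close> of \<open>K\<close> has zero third arrow by
  \<open>tq_zero\<close>, so \<open>g\<^sub>0\<close> has a retraction \<open>r\<close>, and \<open>1 - g\<^sub>0 r\<close> factors over \<open>h\<^sub>0\<close>, whose codomain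
  is in \<open>J\<close>.
\<close>
lemma cone_of_J_iso:
  assumes T: "(f, g, h) \<in> Tri K" and f: "Dom K f \<in> J" shows "is_iso L (cls g)"
proof -
  interpret L: category L by (rule category_L)
  note t = triD[OF T]
  obtain f0 g0 h0 where s: "standard_triangle K \<tau> f0 g0 h0"
    and i: "tri_isomorphic L SL (cls f0, cls g0, cls h0) (cls f, cls g, phi (Dom K f) \<cdot>\<^bsub>L\<^esub> cls h)"
    using phi_Tri[OF T] Tri_L by blast
  note s' = standard_triangleD[OF s]
  note s0 = s'(1,3-7)
  obtain a b c where a: "a \<in> Arr L" "Dom L a = Dom K f0" "Cod L a = Dom K f" "is_iso L a"
    and b: "b \<in> Arr L" "Dom L b = Dom K g0" "Cod L b = Dom K g" "is_iso L b"
    and c: "c \<in> Arr L" "Dom L c = Cod K g0" "Cod L c = Cod K g" "is_iso L c"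
    and e: "c \<cdot>\<^bsub>L\<^esub> cls g0 = cls g \<cdot>\<^bsub>L\<^esub> b"
    using i s' t unfolding tri_isomorphic_def by (auto simp: in_Hom)
  obtain a' where a': "a' \<in> Arr K" "a = cls a'" using a(1) by (rule L_ArrE)
  have X: "Dom K f0 \<in> J" using iso_L_J[of a'] a a' f by simp
  have z: "SA f0 \<cdot> tq (Dom K f0) = Zero K (Cod K h0) (S (Dom K g0))"
    unfolding tq_zero[OF X] using s'(1,3-7) by simp
  have T0: "(g0, h0, Zero K (Cod K h0) (S (Dom K g0))) \<in> Tri K" using s'(2) unfolding z .
  obtain r where r: "r \<in> Arr K" "Dom K r = Cod K g0" "Cod K r = Dom K g0" "r \<cdot> g0 = Id K (Dom K g0)"
    using tri_split(1)[OF T0] s0 by auto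
  let ?d = "Id K (Cod K g0) \<oplus> Neg K (g0 \<cdot> r)"
  have "?d \<cdot> g0 = Zero K (Dom K g0) (Cod K ?d)" using r s0 by (simp add: Add_Comp Comp_assoc)
  then obtain m where m: "m \<in> Arr K" "Dom K m = Cod K h0" "Cod K m = Cod K ?d" "m \<cdot> h0 = ?d"
    by (elim tri_weak_cokernel[OF T0, rotated 2]) (use r s0 in auto)
  have "null ?d" using nullI[of h0 m] m s0 X cosyzygy_J_iff[of "Dom K f0"] by simp
  then have "cong (Id K (Cod K g0)) (g0 \<cdot> r)" using r s0 by (simp add: cong_def)
  then have "is_iso L (cls g0)" using is_iso_cls_iff[OF s'(5)] r s0 cong_sym by auto
  then have 1: "is_iso L (cls g \<cdot>\<^bsub>L\<^esub> b)" unfolding e[symmetric] using c s0 by (intro L.is_iso_Comp) auto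
  obtain b' where b': "b' \<in> Arr L" "Dom L b' = Cod L b" "b \<cdot>\<^bsub>L\<^esub> b' = Id L (Cod L b)" "is_iso L b'"
    "Cod L b' = Dom L b"
    by (rule L.is_isoE[OF b(4)])
  have "is_iso L ((cls g \<cdot>\<^bsub>L\<^esub> b) \<cdot>\<^bsub>L\<^esub> b')" by (rule L.is_iso_Comp[OF b'(4) 1]) (use b b' t in auto)
  moreover have "(cls g \<cdot>\<^bsub>L\<^esub> b) \<cdot>\<^bsub>L\<^esub> b' = cls g" using b b' t by (simp add: L.Comp_assoc)
  ultimately show ?thesis by simp
qed

lemma J_triangulated: "triangulated_subcategory K J"
  unfolding triangulated_subcategory_def
proof (intro conjI ballI allI impI)
  show "J \<subseteq> Obj K" by auto
  show "Y \<in> J" if X: "X \<in> J" and Y: "Y \<in> Obj K" "isomorphic K X Y" for X Y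
  proof -
    obtain f where f: "f \<in> Arr K" "Dom K f = X" "Cod K f = Y" "is_iso K f"
      using Y by (auto simp: isomorphic_def in_Hom)
    obtain g where "g \<in> Arr K" "Dom K g = Cod K f" "Cod K g = Dom K f" "f \<cdot> g = Id K (Cod K f)"
      by (rule is_isoE[OF f(4)])
    then show ?thesis using retract_J[of g f] f X by simp
  qed
  show "Z \<in> J" if "zero_object K Z" for Z
    using that null_Id_J[of Z] null_Zero[of Z Z] by (simp add: zero_object_iff)
  show "X \<in> J \<longleftrightarrow> S X \<in> J" if "X \<in> Obj K" for X using susp_J_iff[OF that] by simp
  show "case T of (f, g, h) \<Rightarrow> Dom K f \<in> J \<and> Cod K f \<in> J \<longrightarrow> Cod K g \<in> J" if "T \<in> Tri K" for T
  proof -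
    obtain f g h where T: "T = (f, g, h)" by (cases T)
    have "Cod K g \<in> J" if "Dom K f \<in> J" "Cod K f \<in> J"
      using iso_L_J[OF cone_of_J_iso[of f g h]] that \<open>T \<in> Tri K\<close> triD[of f g h] T by auto
    then show ?thesis by (simp add: T)
  qed
qed

lemma J_thick: "thick_subcategory K J"
  unfolding thick_subcategory_def
proof (intro conjI ballI impI J_triangulated)
  fix X Y assume "X \<in> Obj K" "Y \<in> J" "is_retract K X Y"
  then obtain s r where "s \<in> Arr K" "r \<in> Arr K" "Dom K s = X" "Cod K s = Dom K r" "Dom K r \<in> J"
    "r \<cdot> s = Id K X"
    unfolding is_retract_def by (auto simp: in_Hom)
  then show "X \<in> J" using retract_J by blast
qed

sublocale v: verdier K J by unfold_locales (rule J_triangulated)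

text \<open>Rotated backwards, the triangle of a denominator starts with an object of \<open>J\<close>.\<close>
lemma W_iso: assumes "s \<in> v.W" shows "is_iso L (cls s)"
proof -
  obtain u h where u: "(s, u, h) \<in> Tri K" "Cod K u \<in> J" using assms by (rule v.W_E)
  obtain e u' \<theta> where e: "(e, s, u') \<in> Tri K" "is_iso K \<theta>" "\<theta> \<in> Arr K" "Dom K \<theta> = S (Dom K e)"
    "Cod K \<theta> = Cod K u" using tri_rot_back[OF u(1)] by metis
  obtain \<theta>' where "Dom K \<theta>' = Cod K \<theta>" "Cod K \<theta>' = Dom K \<theta>" "is_iso K \<theta>'" by (rule is_isoE[OF e(2)])
  then have "S (Dom K e) \<in> J" using v.N_iso[of \<theta>'] e u by simp
  then have "Dom K e \<in> J" using susp_J_iff[of "Dom K e"] triD[OF e(1)] by simp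
  then show ?thesis by (rule cone_of_J_iso[OF e(1)])
qed

text \<open>
  If \<open>d = b a\<close> with \<open>a\<close> ending in \<open>J\<close>, the fibre of \<open>a\<close> is a denominator that \<open>d\<close> annihilates.
\<close>
lemma null_killed:
  assumes "null d" "d \<in> Arr K"
  obtains t where "t \<in> v.W" "Cod K t = Dom K d" "d \<cdot> t = Zero K (Dom K t) (Cod K d)"
proof -
  obtain a b where ab: "a \<in> Arr K" "b \<in> Arr K" "Cod K a = Dom K b" "Dom K b \<in> J" "Dom K a = Dom K d"
    "Cod K b = Cod K d" "b \<cdot> a = d" using assms(1) by (rule nullE)
  obtain t k where t: "(t, a, k) \<in> Tri K" using tri_complete_mid[OF ab(1)] by blast
  note tt = triD[OF t]
  have "d \<cdot> t = b \<cdot> (a \<cdot> t)" using Comp_cong_assoc[OF ab(7), of t] ab tt by simp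
  then have "d \<cdot> t = Zero K (Dom K t) (Cod K d)" using tri_comp_zero[OF t] ab tt by simp
  then show ?thesis using that[of t] v.W_I[OF t] ab tt by simp
qed

lemma cong_killed:
  assumes "cong f g"
  obtains t where "t \<in> v.W" "Cod K t = Dom K f" "f \<cdot> t = g \<cdot> t"
proof -
  note c = cong_typed[OF assms]
  have "null (f \<oplus> Neg K g)" using assms by (simp add: cong_def)
  then obtain t where t: "t \<in> v.W" "Cod K t = Dom K (f \<oplus> Neg K g)"
    "(f \<oplus> Neg K g) \<cdot> t = Zero K (Dom K t) (Cod K (f \<oplus> Neg K g))" by (rule null_killed) (use c in auto)
  have "f \<cdot> t = g \<cdot> t" using diff_eq_Zero_iff[of "f \<cdot> t" "g \<cdot> t"] c t by (simp add: Add_Comp)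
  then show ?thesis using that[of t] t c by simp
qed

lemma q_eq_iff:
  assumes f: "f \<in> Arr K" "g \<in> Arr K" shows "v.q f = v.q g \<longleftrightarrow> cls f = cls g"
proof
  assume "v.q f = v.q g"
  then obtain u where u: "u \<in> v.W" "Cod K u = Dom K f" "f \<cdot> u = g \<cdot> u" "Dom K g = Dom K f"
    "Cod K g = Cod K f"
    by (rule v.q_eqD[OF f])
  interpret L: category L by (rule category_L)
  obtain y where y: "y \<in> Arr L" "Dom L y = Cod L (cls u)" "Cod L y = Dom L (cls u)"
    "cls u \<cdot>\<^bsub>L\<^esub> y = Id L (Cod L (cls u))"
    by (rule L.is_isoE[OF W_iso[OF u(1)]])
  have uA: "u \<in> Arr K" using u(1) by (rule v.W_Arr)
  have "cls f = cls f \<cdot>\<^bsub>L\<^esub> (cls u \<cdot>\<^bsub>L\<^esub> y)" using y u f uA by simp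
  also have "\<dots> = (cls f \<cdot>\<^bsub>L\<^esub> cls u) \<cdot>\<^bsub>L\<^esub> y" using y(1-3) u f uA by (intro L.Comp_assoc[symmetric]) auto
  also have "\<dots> = (cls g \<cdot>\<^bsub>L\<^esub> cls u) \<cdot>\<^bsub>L\<^esub> y" using u f uA by simp
  also have "\<dots> = cls g \<cdot>\<^bsub>L\<^esub> (cls u \<cdot>\<^bsub>L\<^esub> y)" using y(1-3) u f uA by (intro L.Comp_assoc) auto
  also have "\<dots> = cls g" using y u f uA by simp
  finally show "cls f = cls g" .
next
  assume "cls f = cls g"
  then have c: "cong f g" using cls_eq_iff[OF f] by simp
  obtain t where "t \<in> v.W" "Cod K t = Dom K f" "f \<cdot> t = g \<cdot> t" using c by (rule cong_killed)
  then show "v.q f = v.q g" using v.q_cong[OF f] cong_typed[OF c] by blast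
qed

text \<open>
  For a fraction of \<open>f\<close> by \<open>s\<close> choose \<open>t\<close> with \<open>t s \<equiv> 1\<close> modulo \<open>J\<close>. Then \<open>f t s \<equiv> f\<close>, so some
  denominator equalizes the two, and the fraction equals \<open>q (f t)\<close>.
\<close>
lemma q_full:
  assumes "F \<in> Arr v.V" obtains f where "f \<in> Arr K" "F = v.q f"
proof -
  obtain s f where F: "F = frac K J s f" and r: "(s, f) \<in> roofs K J" using assms by (auto simp:
    v.V_simps)
  then have s: "s \<in> v.W" "f \<in> Arr K" "Dom K f = Dom K s" by (auto simp: v.roofs_iff)
  note sA = v.W_Arr[OF s(1)]
  obtain t where t: "t \<in> Arr K" "Dom K t = Cod K s" "Cod K t = Dom K s" "cong (t \<cdot> s) (Id K (Dom K s))"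
    using W_iso[OF s(1)] is_iso_cls_iff[OF sA] by blast
  have "cong (f \<cdot> (t \<cdot> s)) (f \<cdot> Id K (Dom K s))" by (rule cong_Comp) (use t s sA in auto)
  then have c: "cong (f \<cdot> (t \<cdot> s)) f" using s by simp
  obtain w where w: "w \<in> v.W" "Cod K w = Dom K (f \<cdot> (t \<cdot> s))" "(f \<cdot> (t \<cdot> s)) \<cdot> w = f \<cdot> w"
    using c by (rule cong_killed)
  note wA = v.W_Arr[OF w(1)]
  have ft: "f \<cdot> t \<in> Arr K" using s t by simp
  have w2: "Cod K w = Dom K s" using w(2) s t sA by simp
  have e: "f \<cdot> w = (f \<cdot> t) \<cdot> (s \<cdot> w)"
    unfolding w(3)[symmetric] using s t(1-3) sA wA w2 by (simp add: Comp_assoc)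
  have "v.req s f (Id K (Dom K (f \<cdot> t))) (f \<cdot> t)"
    by (rule v.reqI[of w "s \<cdot> w"]) (use s t(1-3) sA wA w2 e v.W_Comp[OF w(1) s(1)] in auto)
  then have "frac K J s f = v.q (f \<cdot> t)" by (rule v.frac_eq_q[OF r ft])
  then show ?thesis using that ft F by blast
qed

text \<open>
  The comparison functor \<open>K/J \<rightarrow> L\<close>. The representative is arbitrary: by \<open>q_eq_iff\<close> its class in
  \<open>L\<close> does not depend on the choice.
\<close>
definition G where "G = \<lparr>FObj = \<lambda>X. X, FArr = \<lambda>F. cls (SOME f. f \<in> Arr K \<and> F = v.q f)\<rparr>"

lemma G_FObj [simp]: "FObj G X = X" by (simp add: G_def)

lemma G_q [simp]: assumes "f \<in> Arr K" shows "FArr G (v.q f) = cls f"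
proof -
  let ?g = "SOME g. g \<in> Arr K \<and> v.q f = v.q g"
  have "?g \<in> Arr K \<and> v.q f = v.q ?g" by (rule someI[of _ f]) (use assms in simp)
  then have "cls ?g = cls f" using q_eq_iff[of f ?g] assms by simp
  then show ?thesis by (simp add: G_def)
qed

lemma category_V: "category v.V"
proof
  show "\<And>f. f \<in> Arr v.V \<Longrightarrow> Dom v.V f \<in> Obj v.V" "\<And>f. f \<in> Arr v.V \<Longrightarrow> Cod v.V f \<in> Obj v.V"
    by (auto simp: v.V_simps(1) elim!: q_full)
  show "\<And>X. X \<in> Obj v.V \<Longrightarrow> Id v.V X \<in> Hom v.V X X" by (auto simp: in_Hom v.q_Id v.V_simps(1))
  show "\<And>f X Y g Z. \<lbrakk>f \<in> Hom v.V X Y; g \<in> Hom v.V Y Z\<rbrakk> \<Longrightarrow> g \<cdot>\<^bsub>v.V\<^esub> f \<in> Hom v.V X Z"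
    by (auto simp: in_Hom v.q_Comp elim!: q_full)
  show "\<And>f W X g Y h Z. \<lbrakk>f \<in> Hom v.V W X; g \<in> Hom v.V X Y; h \<in> Hom v.V Y Z\<rbrakk>
    \<Longrightarrow> h \<cdot>\<^bsub>v.V\<^esub> (g \<cdot>\<^bsub>v.V\<^esub> f) = h \<cdot>\<^bsub>v.V\<^esub> g \<cdot>\<^bsub>v.V\<^esub> f"
    by (auto simp: in_Hom Comp_assoc v.q_Comp elim!: q_full)
  show "\<And>f X Y. f \<in> Hom v.V X Y \<Longrightarrow> Id v.V Y \<cdot>\<^bsub>v.V\<^esub> f = f"
    "\<And>f X Y. f \<in> Hom v.V X Y \<Longrightarrow> f \<cdot>\<^bsub>v.V\<^esub> Id v.V X = f"
    by (auto simp: in_Hom v.q_Id v.q_Comp elim!: q_full)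
qed

lemma G_functor: "is_functor v.V L G"
  unfolding is_functor_def
proof (intro conjI ballI impI)
  show "FObj G X \<in> Obj L" if "X \<in> Obj v.V" for X using that by (simp add: v.V_simps(1))
  show "FArr G F \<in> Hom L (FObj G (Dom v.V F)) (FObj G (Cod v.V F))" if "F \<in> Arr v.V" for F
    using that by (auto simp: in_Hom elim!: q_full)
  show "FArr G (Id v.V X) = Id L (FObj G X)" if "X \<in> Obj v.V" for X
    using that by (simp add: v.q_Id v.V_simps(1) Id_L)
  show "FArr G (G' \<cdot>\<^bsub>v.V\<^esub> F) = FArr G G' \<cdot>\<^bsub>L\<^esub> FArr G F" if "F \<in> Arr v.V" "G' \<in> Arr v.V"
    "Cod v.V F = Dom v.V G'" for F G'
    using that by (auto simp: v.q_Comp elim!: q_full)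
qed

lemma G_Tri:
  assumes "(F1, F2, F3) \<in> Tri v.V"
  shows "(FArr G F1, FArr G F2, phi (Dom v.V F1) \<cdot>\<^bsub>L\<^esub> FArr G F3) \<in> Tri L"
proof -
  interpret L: category L by (rule category_L)
  obtain f g h where T: "(f, g, h) \<in> Tri K" and cand: "(F1, F2, F3) \<in> candidates v.V (verdier_susp K J)"
    and iso: "tri_isomorphic v.V (verdier_susp K J) (v.q f, v.q g, v.q h) (F1, F2, F3)"
    using assms v.Tri_V by blast
  note t = triD[OF T]
  have "F1 \<in> Arr v.V" "F2 \<in> Arr v.V" "F3 \<in> Arr v.V" using cand by (auto simp: candidates_def)
  then obtain f1 f2 f3 where F: "F1 = v.q f1" "F2 = v.q f2" "F3 = v.q f3"
    and fA: "f1 \<in> Arr K" "f2 \<in> Arr K" "f3 \<in> Arr K" using q_full by metis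
  have ft: "Cod K f1 = Dom K f2" "Cod K f2 = Dom K f3" "Cod K f3 = S (Dom K f1)"
    using cand fA by (auto simp: F candidates_def)
  obtain A B C where ABC: "A \<in> Arr v.V" "B \<in> Arr v.V" "C \<in> Arr v.V" "Dom v.V A = Dom K f"
    "Cod v.V A = Dom K f1"
    "Dom v.V B = Dom K g" "Cod v.V B = Dom K f2" "Dom v.V C = Dom K h" "Cod v.V C = Dom K f3"
    "B \<cdot>\<^bsub>v.V\<^esub> v.q f = F1 \<cdot>\<^bsub>v.V\<^esub> A" "C \<cdot>\<^bsub>v.V\<^esub> v.q g = F2 \<cdot>\<^bsub>v.V\<^esub> B"
    "FArr (verdier_susp K J) A \<cdot>\<^bsub>v.V\<^esub> v.q h = F3 \<cdot>\<^bsub>v.V\<^esub> C"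
    "is_iso v.V A" "is_iso v.V B" "is_iso v.V C"
    using iso t fA ft unfolding tri_isomorphic_def F by (auto simp: in_Hom)
  obtain a b c where abc: "A = v.q a" "B = v.q b" "C = v.q c" and abcA: "a \<in> Arr K" "b \<in> Arr K"
    "c \<in> Arr K"
    using ABC(1-3) q_full by metis
  have ty: "Dom K a = Dom K f" "Cod K a = Dom K f1"
    "Dom K b = Dom K g" "Cod K b = Dom K f2" "Dom K c = Dom K h" "Cod K c = Dom K f3"
    using ABC(4-9) abcA by (simp_all add: abc)
  have 1: "cls (b \<cdot> f) = cls (f1 \<cdot> a)"
    using ABC(10) abcA ty t fA ft by (subst q_eq_iff[symmetric]) (simp_all add: abc F v.q_Comp)
  have 2: "cls (c \<cdot> g) = cls (f2 \<cdot> b)"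
    using ABC(11) abcA ty t fA ft by (subst q_eq_iff[symmetric]) (simp_all add: abc F v.q_Comp)
  have 3: "cls (SA a \<cdot> h) = cls (f3 \<cdot> c)"
    using ABC(12) abcA ty t fA ft by (subst q_eq_iff[symmetric]) (simp_all add: abc F v.q_Comp v.q_susp)
  have isos: "is_iso L (cls a)" "is_iso L (cls b)" "is_iso L (cls c)"
    using functor_is_iso[OF category_V G_functor] ABC(13-15) abcA abc G_q by metis+
  note sl = is_functorD[OF functor_SL]
  have "FArr SL (cls a) \<cdot>\<^bsub>L\<^esub> (phi (Dom K f) \<cdot>\<^bsub>L\<^esub> cls h) =
    (FArr SL (cls a) \<cdot>\<^bsub>L\<^esub> phi (Dom K a)) \<cdot>\<^bsub>L\<^esub> cls h"
    using abcA ty t sl(1-4) by (simp add: L.Comp_assoc FObj_SL)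
  also have "\<dots> = phi (Dom K f1) \<cdot>\<^bsub>L\<^esub> (cls (SA a) \<cdot>\<^bsub>L\<^esub> cls h)"
    unfolding phi_natural[OF abcA(1)] using abcA ty t fA by (simp add: L.Comp_assoc del: cls_Comp)
  also have "\<dots> = (phi (Dom K f1) \<cdot>\<^bsub>L\<^esub> cls f3) \<cdot>\<^bsub>L\<^esub> cls c"
    using 3 abcA ty t fA ft by (simp add: L.Comp_assoc)
  finally have 4: "FArr SL (cls a) \<cdot>\<^bsub>L\<^esub> (phi (Dom K f) \<cdot>\<^bsub>L\<^esub> cls h) =
    (phi (Dom K f1) \<cdot>\<^bsub>L\<^esub> cls f3) \<cdot>\<^bsub>L\<^esub> cls c" .
  have "(cls f1, cls f2, phi (Dom K f1) \<cdot>\<^bsub>L\<^esub> cls f3) \<in> Tri L"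
  proof (rule Tri_L_iso_closed[OF phi_Tri[OF T]])
    show "(cls f1, cls f2, phi (Dom K f1) \<cdot>\<^bsub>L\<^esub> cls f3) \<in> candidates L SL"
      using fA ft by (simp add: candidates_def FObj_SL)
    show "tri_isomorphic L SL (cls f, cls g, phi (Dom K f) \<cdot>\<^bsub>L\<^esub> cls h) (cls f1, cls f2, phi (Dom K f1) \<cdot>\<^bsub>L\<^esub> cls f3)"
      unfolding tri_isomorphic_def
      by (rule exI[of _ "cls a"], rule exI[of _ "cls b"], rule exI[of _ "cls c"])
        (use abcA ty t fA ft 1 2 4 isos in \<open>simp add: in_Hom\<close>)
  qed
  then show ?thesis using fA by (simp add: F)
qed

lemma G_exact: "exact_functor v.V L G"
proof -
  have "additive_functor v.V L G"
    unfolding additive_functor_def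
    by (auto simp: G_functor in_Hom v.q_Add elim!: q_full)
  moreover have "natural_iso v.V L (fcomp G (Susp v.V)) (fcomp (Susp L) G) phi"
    unfolding natural_iso_def
    by (auto simp: v.V_simps(1,4) fcomp_def in_Hom FObj_SL v.q_susp phi_natural elim!: q_full)
  moreover have "\<forall>(f, g, h) \<in> Tri v.V. (FArr G f, FArr G g, phi (Dom v.V f) \<cdot>\<^bsub>L\<^esub> FArr G h) \<in> Tri L"
    using G_Tri by auto
  ultimately show ?thesis unfolding exact_functor_def by blast
qed

lemma G_equivalence: "is_equivalence v.V L G"
  unfolding is_equivalence_def
proof (intro conjI ballI G_functor)
  fix X Y assume XY: "X \<in> Obj v.V" "Y \<in> Obj v.V"
  show "bij_betw (FArr G) (Hom v.V X Y) (Hom L (FObj G X) (FObj G Y))"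
    unfolding bij_betw_def
  proof
    show "inj_on (FArr G) (Hom v.V X Y)"
    proof (rule inj_onI)
      fix F F' assume F: "F \<in> Hom v.V X Y" "F' \<in> Hom v.V X Y" and e: "FArr G F = FArr G F'"
      obtain f where f: "f \<in> Arr K" "F = v.q f" using F(1) q_full by (auto simp: in_Hom)
      obtain f' where f': "f' \<in> Arr K" "F' = v.q f'" using F(2) q_full by (auto simp: in_Hom)
      show "F = F'" using q_eq_iff[OF f(1) f'(1)] e f f' by simp
    qed
    show "FArr G ` Hom v.V X Y = Hom L (FObj G X) (FObj G Y)"
    proof (intro equalityI subsetI)
      fix F assume "F \<in> FArr G ` Hom v.V X Y"
      then show "F \<in> Hom L (FObj G X) (FObj G Y)" by (auto simp: in_Hom elim!: q_full)
    next
      fix F assume "F \<in> Hom L (FObj G X) (FObj G Y)"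
      then have F: "F \<in> Arr L" "Dom L F = X" "Cod L F = Y" by (auto simp: in_Hom)
      obtain f where f: "f \<in> Arr K" "F = cls f" using F(1) by (rule L_ArrE)
      then show "F \<in> FArr G ` Hom v.V X Y" using F by (intro image_eqI[of _ _ "v.q f"]) (auto simp:
        in_Hom)
    qed
  qed
next
  interpret L: category L by (rule category_L)
  fix Z assume Z: "Z \<in> Obj L"
  show "\<exists>X \<in> Obj v.V. isomorphic L (FObj G X) Z"
    using Z by (intro bexI[of _ Z]) (auto simp: isomorphic_def in_Hom v.V_simps(1) intro!: bexI[of _
      "Id L Z"] L.is_iso_Id)
qed

lemma localization_pi: "localization K L pi"
proof -
  interpret L: category L by (rule category_L)
  have "is_functor K L (fcomp G (verdier_functor K J))"
    by (auto simp: is_functor_def fcomp_def in_Hom Id_L)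
  moreover have "natural_iso K L pi (fcomp G (verdier_functor K J)) (Id L)"
    by (auto simp: natural_iso_def fcomp_def in_Hom)
  ultimately have "naturally_isomorphic K L pi (fcomp G (verdier_functor K J))"
    unfolding naturally_isomorphic_def using pi_functor by blast
  then show ?thesis unfolding localization_def exact_equivalence_def
    using J_thick G_exact G_equivalence by blast
qed

end

context exact_stable begin

section \<open>Splitting off the projective objects\<close>

text \<open>
  Take \<open>e = s h\<close>, where \<open>h\<close> follows an \<open>E\<close>-epimorphism \<open>P \<rightarrow> X\<close> in its triangle and \<open>\<pi> s\<close> is
  inverse to \<open>\<pi> h\<close>. Arrows from \<open>J\<close> lift to \<open>P\<close>, so \<open>h\<close> kills them.
\<close>
lemma stable_idempotent:
  assumes X: "X \<in> Obj K"
  obtains e where "e \<in> Arr K" "Dom K e = X" "Cod K e = X" "e \<cdot> e = e" "null (Id K X \<oplus> Neg K e)"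
    "\<And>a. \<lbrakk>a \<in> Arr K; Dom K a \<in> J; Cod K a = X\<rbrakk> \<Longrightarrow> e \<cdot> a = Zero K (Dom K a) X"
proof -
  obtain P p where P: "P \<in> J" "p \<in> Hom K P X" "E_epi E p" using enough_proj[OF X] by blast
  then obtain f h where fh: "(f, p, h) \<in> E" by (auto simp: E_epi_def)
  then have T: "(f, p, h) \<in> Tri K" using E_tri by auto
  note t = triD[OF T]
  have p: "p \<in> Arr K" "Dom K p = P" "Cod K p = X" using P by (auto simp: in_Hom)
  have hX: "h \<in> Arr K" "Dom K h = X" using t p by auto
  have "is_iso L (cls h)" by (rule cone_of_J_iso[OF tri_rot[OF T]]) (use p P in simp)
  then obtain s where s: "s \<in> Arr K" "Dom K s = Cod K h" "Cod K s = X" "cong (s \<cdot> h) (Id K X)"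
    using is_iso_cls_iff[OF hX(1)] hX by auto
  let ?e = "s \<cdot> h"
  have e: "?e \<in> Arr K" "Dom K ?e = X" "Cod K ?e = X" using s hX by auto
  have kill: "?e \<cdot> a = Zero K (Dom K a) X" if a: "a \<in> Arr K" "Dom K a \<in> J" "Cod K a = X" for a
  proof -
    obtain b where b: "b \<in> Arr K" "Dom K b = Dom K a" "Cod K b = Dom K p" "p \<cdot> b = a"
      by (rule J_lift[OF a(1,2) fh]) (use a p in auto)
    have "h \<cdot> a = (h \<cdot> p) \<cdot> b" unfolding b(4)[symmetric] using b(1-3) t by (simp add: Comp_assoc)
    also have "\<dots> = Zero K (Dom K a) (Cod K h)" unfolding tri_comp_zero2[OF T] using b(1-3) t by simp
    finally have "h \<cdot> a = Zero K (Dom K a) (Cod K h)" .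
    then show ?thesis using s(1-3) hX a by (simp add: Comp_assoc)
  qed
  have "cong (Id K X) ?e" using s(4) by (rule cong_sym)
  then have n: "null (Id K X \<oplus> Neg K ?e)" by (simp add: cong_def)
  then obtain a b where ab: "a \<in> Arr K" "b \<in> Arr K" "Cod K a = Dom K b" "Dom K b \<in> J"
    "Dom K a = Dom K (Id K X \<oplus> Neg K ?e)" "Cod K b = Cod K (Id K X \<oplus> Neg K ?e)"
    "b \<cdot> a = Id K X \<oplus> Neg K ?e"
    by (rule nullE)
  have ab2: "Dom K a = X" "Cod K b = X" using ab(5,6) e X by auto
  \<comment> \<open>\<open>1 - e\<close> ends with an arrow \<open>b\<close> from \<open>J\<close>, and \<open>e b = 0\<close>.\<close>
  have "?e \<oplus> Neg K (?e \<cdot> ?e) = ?e \<cdot> (Id K X \<oplus> Neg K ?e)" using e X by (simp add: Comp_Add)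
  also have "\<dots> = (?e \<cdot> b) \<cdot> a" unfolding ab(7)[symmetric] using ab(1-4) ab2 e by (intro
    Comp_assoc[symmetric]) auto
  also have "\<dots> = Zero K X X" unfolding kill[OF ab(2,4) ab2(2)] using ab(1-4) ab2 X by simp
  finally have "?e = ?e \<cdot> ?e" using diff_eq_Zero_iff[of ?e "?e \<cdot> ?e"] e by simp
  then show ?thesis using that[of ?e] e n kill by metis
qed

text \<open>
  Only arrows from \<open>J\<close> are required to vanish; arrows to \<open>J\<close> follow in \<open>J_perp_orthogonal\<close>.
\<close>
definition J_perp where
  "J_perp = {B \<in> Obj K. \<forall>a \<in> Arr K. Dom K a \<in> J \<and> Cod K a = B \<longrightarrow> a = Zero K (Dom K a) B}"

lemma J_perp_Obj [simp]: "B \<in> J_perp \<Longrightarrow> B \<in> Obj K" by (simp add: J_perp_def)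

lemma J_perpD: "\<lbrakk>a \<in> Arr K; Dom K a \<in> J; Cod K a \<in> J_perp\<rbrakk> \<Longrightarrow> a = Zero K (Dom K a) (Cod K a)"
  unfolding J_perp_def by blast

lemma J_perpI:
  assumes "B \<in> Obj K" "\<And>a. \<lbrakk>a \<in> Arr K; Dom K a \<in> J; Cod K a = B\<rbrakk> \<Longrightarrow> a = Zero K (Dom K a) B"
  shows "B \<in> J_perp"
  unfolding J_perp_def using assms by blast

text \<open>
  Split \<open>e\<close> of \<open>stable_idempotent\<close> by \<open>s r\<close> and the complementary idempotent \<open>d = 1 - e\<close> by
  \<open>v u\<close>; as \<open>d\<close> factors through \<open>J\<close>, so does the identity of its image.
\<close>
lemma decomposition:
  assumes ic: "idempotent_complete K" and X: "X \<in> Obj K"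
  shows "\<exists>A B i j p q. A \<in> J \<and> B \<in> J_perp \<and> biproduct K A B X i j p q"
proof -
  obtain e where e: "e \<in> Arr K" "Dom K e = X" "Cod K e = X" "e \<cdot> e = e" "null (Id K X \<oplus> Neg K e)"
    and kill: "\<And>a. \<lbrakk>a \<in> Arr K; Dom K a \<in> J; Cod K a = X\<rbrakk> \<Longrightarrow> e \<cdot> a = Zero K (Dom K a) X"
    using stable_idempotent[OF X] by metis
  let ?d = "Id K X \<oplus> Neg K e"
  have d: "?d \<in> Arr K" "Dom K ?d = X" "Cod K ?d = X" using e X by auto
  have ed: "e \<cdot> ?d = Zero K X X" and de: "?d \<cdot> e = Zero K X X" using e X by (simp_all add: Comp_Add
    Add_Comp)
  have dd: "?d \<cdot> ?d = ?d"
  proof -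
    have "?d \<cdot> ?d = ?d \<oplus> Neg K (e \<cdot> ?d)" using e X d by (subst Add_Comp) simp_all
    then show ?thesis unfolding ed using d X by simp
  qed
  have split: "\<exists>Y r s. Y \<in> Obj K \<and> r \<in> Arr K \<and> Dom K r = X \<and> Cod K r = Y \<and> s \<in> Arr K \<and> Dom K s = Y \<and>
    Cod K s = X \<and>
     r \<cdot> s = Id K Y \<and> s \<cdot> r = x" if x: "x \<in> Arr K" "Dom K x = X" "Cod K x = X" "x \<cdot> x = x" for x
  proof -
    have "x \<in> Hom K X X" using x by (simp add: in_Hom)
    then obtain Y r s where "Y \<in> Obj K" "r \<in> Hom K X Y" "s \<in> Hom K Y X" "r \<cdot> s = Id K Y" "s \<cdot> r = x"
      using ic X x(4) unfolding idempotent_complete_def by blast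
    then show ?thesis by (auto simp: in_Hom)
  qed
  obtain B r s where B: "B \<in> Obj K" "r \<in> Arr K" "Dom K r = X" "Cod K r = B" "s \<in> Arr K"
    "Dom K s = B" "Cod K s = X"
    "r \<cdot> s = Id K B" "s \<cdot> r = e" using split[OF e(1-4)] by blast
  obtain A u v where A: "A \<in> Obj K" "u \<in> Arr K" "Dom K u = X" "Cod K u = A" "v \<in> Arr K"
    "Dom K v = A" "Cod K v = X"
    "u \<cdot> v = Id K A" "v \<cdot> u = ?d" using split[OF d dd] by blast
  have "Id K A = u \<cdot> (?d \<cdot> v)"
    unfolding A(9)[symmetric] using A(1-8) by (simp add: Comp_assoc)
  moreover have "null (u \<cdot> (?d \<cdot> v))"
    using A(1-7) d null_Comp_left[of "?d \<cdot> v" u] null_Comp_right[OF e(5), of v] by simp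
  ultimately have "null (Id K A)" by simp
  then have AJ: "A \<in> J" using null_Id_J A by blast
  have rse: "r = r \<cdot> e" unfolding B(9)[symmetric] using Comp_cong_assoc[OF B(8), of r] B(1-7) by simp
  have ses: "s = e \<cdot> s" unfolding B(9)[symmetric] using B(1-8) by (simp add: Comp_assoc)
  have vd: "v = ?d \<cdot> v" unfolding A(9)[symmetric] using A(1-8) by (simp add: Comp_assoc)
  have ud: "u = u \<cdot> ?d" unfolding A(9)[symmetric] using Comp_cong_assoc[OF A(8), of u] A(1-7) by simp
  have "r \<cdot> v = (r \<cdot> e) \<cdot> (?d \<cdot> v)" using rse vd by simp
  also have "\<dots> = r \<cdot> ((e \<cdot> ?d) \<cdot> v)" using A(1-7) B(1-7) e(1-3) d by (simp add: Comp_assoc)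
  also have "\<dots> = Zero K A B" unfolding ed using A(1-7) B(1-7) X by simp
  finally have rv: "r \<cdot> v = Zero K A B" .
  have "u \<cdot> s = (u \<cdot> ?d) \<cdot> (e \<cdot> s)" using ud ses by simp
  also have "\<dots> = u \<cdot> ((?d \<cdot> e) \<cdot> s)" using A(1-7) B(1-7) e(1-3) d by (simp add: Comp_assoc)
  also have "\<dots> = Zero K B A" unfolding de using A(1-7) B(1-7) X by simp
  finally have us: "u \<cdot> s = Zero K B A" .
  have "B \<in> J_perp"
  proof (rule J_perpI[OF B(1)])
    fix a assume a: "a \<in> Arr K" "Dom K a \<in> J" "Cod K a = B"
    have "a = (r \<cdot> e) \<cdot> (s \<cdot> a)" unfolding rse[symmetric] using Comp_cong_assoc[OF B(8), of a] a
      B(1-7) by simp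
    also have "\<dots> = r \<cdot> (e \<cdot> (s \<cdot> a))" using a B(1-7) e by (simp add: Comp_assoc)
    also have "\<dots> = Zero K (Dom K a) B" using kill[of "s \<cdot> a"] a B(1-7) X by simp
    finally show "a = Zero K (Dom K a) B" .
  qed
  moreover have "biproduct K A B X v s u r"
    unfolding biproduct_def using A(1-8) B(1-8) rv us X e A(9) B(9) by (simp add: in_Hom)
  ultimately show ?thesis using AJ by blast
qed

text \<open>
  The fibre \<open>w\<close> of \<open>f\<close> is a denominator, so \<open>\<pi> w\<close> has an inverse \<open>\<pi> s\<close>. The difference \<open>1 - w s\<close>
  factors through \<open>J\<close> and ends in \<open>J_perp\<close>, hence vanishes: \<open>w\<close> is a genuine split epimorphism,
  and \<open>f w = 0\<close>.
\<close>
lemma J_perp_orthogonal: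
  assumes f: "f \<in> Arr K" "Dom K f \<in> J_perp" "Cod K f \<in> J"
  shows "f = Zero K (Dom K f) (Cod K f)"
proof -
  obtain w k where T: "(w, f, k) \<in> Tri K" using tri_complete_mid[OF f(1)] by blast
  note t = triD[OF T]
  have wW: "w \<in> v.W" by (rule v.W_I[OF T f(3)])
  obtain s where s: "s \<in> Arr K" "Dom K s = Cod K w" "Cod K s = Dom K w" "cong (w \<cdot> s) (Id K (Cod K w))"
    using W_iso[OF wW] is_iso_cls_iff[OF t(1)] by blast
  have wA: "w \<in> Arr K" "Cod K w = Dom K f" using t by auto
  have c: "cong (Id K (Dom K f)) (w \<cdot> s)" using cong_sym[OF s(4)] wA by simp
  let ?d = "Id K (Dom K f) \<oplus> Neg K (w \<cdot> s)"
  have "null ?d" using c by (simp add: cong_def)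
  then obtain a b where ab: "a \<in> Arr K" "b \<in> Arr K" "Cod K a = Dom K b" "Dom K b \<in> J"
    "Dom K a = Dom K ?d"
    "Cod K b = Cod K ?d" "b \<cdot> a = ?d" by (rule nullE)
  have d: "Dom K ?d = Dom K f" "Cod K ?d = Dom K f" "?d \<in> Arr K" using f(1) s(1-3) wA by auto
  have bz: "b = Zero K (Dom K b) (Dom K f)" using J_perpD[of b] ab(2,4,6) d f(2) by metis
  have "?d = Zero K (Dom K b) (Dom K f) \<cdot> a" using ab(7) bz by simp
  also have "\<dots> = Zero K (Dom K f) (Dom K f)" using ab(1-5) d f(1) by simp
  finally have "?d = Zero K (Dom K f) (Dom K f)" .
  then have id: "Id K (Dom K f) = w \<cdot> s" using diff_eq_Zero_iff[of "Id K (Dom K f)" "w \<cdot> s"] f(1)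
    s(1-3) wA by simp
  have "f = f \<cdot> (w \<cdot> s)" unfolding id[symmetric] using f(1) by simp
  also have "\<dots> = (f \<cdot> w) \<cdot> s" using f(1) wA s(1-3) by (simp add: Comp_assoc)
  also have "\<dots> = Zero K (Dom K f) (Cod K f)" unfolding tri_comp_zero[OF T] using f(1) wA s(1-3) by simp
  finally show ?thesis .
qed

lemma J_perp_triangulated: "triangulated_subcategory K J_perp"
  unfolding triangulated_subcategory_def
proof (intro conjI ballI allI impI)
  show "J_perp \<subseteq> Obj K" by auto
  show "Y \<in> J_perp" if X: "X \<in> J_perp" and Y: "Y \<in> Obj K" "isomorphic K X Y" for X Y
  proof (rule J_perpI[OF Y(1)])
    obtain f where f: "f \<in> Arr K" "Dom K f = X" "Cod K f = Y" "is_iso K f"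
      using Y by (auto simp: isomorphic_def in_Hom)
    obtain g where g: "g \<in> Arr K" "Dom K g = Cod K f" "Cod K g = Dom K f" "f \<cdot> g = Id K (Cod K f)"
      by (rule is_isoE[OF f(4)])
    fix a assume a: "a \<in> Arr K" "Dom K a \<in> J" "Cod K a = Y"
    have z: "g \<cdot> a = Zero K (Dom K a) X" using J_perpD[of "g \<cdot> a"] a f g X by simp
    have "a = f \<cdot> (g \<cdot> a)" using Comp_cong_assoc[OF g(4), of a] f g a by simp
    also have "\<dots> = Zero K (Dom K a) Y" unfolding z using f a by simp
    finally show "a = Zero K (Dom K a) Y" .
  qed
  show "Z \<in> J_perp" if Z: "zero_object K Z" for Z
  proof (rule J_perpI)
    have ZO: "Z \<in> Obj K" "Id K Z = Zero K Z Z" using Z by (auto simp: zero_object_iff)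
    then show "Z \<in> Obj K" by simp
    fix a assume a: "a \<in> Arr K" "Cod K a = Z"
    have "a = Id K Z \<cdot> a" using a by simp
    also have "\<dots> = Zero K (Dom K a) Z" unfolding ZO(2) using a ZO(1) by simp
    finally show "a = Zero K (Dom K a) Z" .
  qed
  show "X \<in> J_perp \<longleftrightarrow> S X \<in> J_perp" if X: "X \<in> Obj K" for X
  proof
    assume XP: "X \<in> J_perp"
    show "S X \<in> J_perp"
    proof (rule J_perpI)
      show "S X \<in> Obj K" using X by simp
      fix a assume a: "a \<in> Arr K" "Dom K a \<in> J" "Cod K a = S X"
      \<comment> \<open>Up to isomorphism the domain is a suspension \<open>\<Sigma>A\<close>, so that the arrow itself desuspends.\<close>
      obtain A \<theta> where A: "A \<in> Obj K" "is_iso K \<theta>" "\<theta> \<in> Arr K" "Dom K \<theta> = S A" "Cod K \<theta> = Dom K a"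
        using susp_ess_surj[of "Dom K a"] a by auto
      obtain \<theta>' where \<theta>': "\<theta>' \<in> Arr K" "Dom K \<theta>' = Cod K \<theta>" "Cod K \<theta>' = Dom K \<theta>" "is_iso K \<theta>'"
        "\<theta> \<cdot> \<theta>' = Id K (Cod K \<theta>)" by (rule is_isoE[OF A(2)])
      have "S A \<in> J" using v.N_iso[OF \<theta>'(4)] \<theta>' A a by simp
      then have AJ: "A \<in> J" using susp_J_iff[OF A(1)] by simp
      obtain b where b: "b \<in> Arr K" "Dom K b = A" "Cod K b = X" "a \<cdot> \<theta> = SA b"
        using susp_full[of "a \<cdot> \<theta>" A X] a A X by auto
      have "b = Zero K A X" using J_perpD[of b] b(1-3) AJ XP by simp
      then have z: "a \<cdot> \<theta> = Zero K (S A) (S X)" using b(4) A X by simp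
      have "a = a \<cdot> (\<theta> \<cdot> \<theta>')" using \<theta>' A a by simp
      also have "\<dots> = (a \<cdot> \<theta>) \<cdot> \<theta>'" using \<theta>'(1-3) A a by (simp add: Comp_assoc)
      also have "\<dots> = Zero K (Dom K a) (S X)" unfolding z using \<theta>'(1-3) A X by simp
      finally show "a = Zero K (Dom K a) (S X)" .
    qed
  next
    assume SX: "S X \<in> J_perp"
    show "X \<in> J_perp"
    proof (rule J_perpI[OF X])
      fix b assume b: "b \<in> Arr K" "Dom K b \<in> J" "Cod K b = X"
      have "SA b = Zero K (S (Dom K b)) (S X)"
        using J_perpD[of "SA b"] b SX susp_J_iff[of "Dom K b"] by simp
      then have "SA b = SA (Zero K (Dom K b) X)" using b X by simp
      then show "b = Zero K (Dom K b) X" by (rule susp_faithful) (use b X in auto)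
    qed
  qed
  show "case T of (f, g, h) \<Rightarrow> Dom K f \<in> J_perp \<and> Cod K f \<in> J_perp \<longrightarrow> Cod K g \<in> J_perp" if TT:
    "T \<in> Tri K" for T
  proof -
    obtain f g h where T0: "T = (f, g, h)" by (cases T)
    then have T: "(f, g, h) \<in> Tri K" using TT by simp
    note t = triD[OF T]
    have "Cod K g \<in> J_perp" if fP: "Dom K f \<in> J_perp" "Cod K f \<in> J_perp"
    proof (rule J_perpI)
      show "Cod K g \<in> Obj K" using t by simp
      fix a assume a: "a \<in> Arr K" "Dom K a \<in> J" "Cod K a = Cod K g"
      have SP: "S (Dom K f) \<in> J_perp"
      proof (rule J_perpI)
        show "S (Dom K f) \<in> Obj K" using t by simp
        fix c assume c: "c \<in> Arr K" "Dom K c \<in> J" "Cod K c = S (Dom K f)"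
        show "c = Zero K (Dom K c) (S (Dom K f))"
          using c fP t \<open>\<And>X. X \<in> Obj K \<Longrightarrow> (X \<in> J_perp) = (S X \<in> J_perp)\<close>[of "Dom K f"] J_perpD[of c]
          by simp
      qed
      have z: "h \<cdot> a = Zero K (Dom K a) (S (Dom K f))" using J_perpD[of "h \<cdot> a"] a t SP by simp
      obtain b where b: "b \<in> Arr K" "Dom K b = Dom K a" "Cod K b = Dom K g" "g \<cdot> b = a"
        by (rule tri_weak_kernel[OF tri_rot[OF T], of a]) (use a t z in auto)
      have bz: "b = Zero K (Dom K a) (Dom K g)" using J_perpD[of b] b(1-3) a fP t by simp
      have "a = g \<cdot> Zero K (Dom K a) (Dom K g)" using b(4) bz by simp
      also have "\<dots> = Zero K (Dom K a) (Cod K g)" using t a by simp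
      finally show "a = Zero K (Dom K a) (Cod K g)" .
    qed
    then show ?thesis by (simp add: T0)
  qed
qed

lemma orthogonal_sum_J:
  assumes "idempotent_complete K" shows "orthogonal_sum K J J_perp"
  unfolding orthogonal_sum_def
proof (intro conjI ballI J_triangulated J_perp_triangulated)
  show "\<exists>A \<in> J. \<exists>B \<in> J_perp. \<exists>i j p q. biproduct K A B X i j p q" if "X \<in> Obj K" for X
    using decomposition[OF assms that] by blast
  fix A B assume A: "A \<in> J" and B: "B \<in> J_perp"
  have "f = Zero K A B" if "f \<in> Hom K A B" for f using that A B J_perpD[of f] by (simp add: in_Hom)
  moreover have "Zero K A B \<in> Hom K A B" using A B by (simp add: in_Hom)
  ultimately show "Hom K A B = {Zero K A B}" by blast
  have "f = Zero K B A" if "f \<in> Hom K B A" for f using that A B J_perp_orthogonal[of f] by (simp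
    add: in_Hom)
  moreover have "Zero K B A \<in> Hom K B A" using A B by (simp add: in_Hom)
  ultimately show "Hom K B A = {Zero K B A}" by blast
qed

lemma full_simps:
  "Obj (full_subcategory K Q) = Q" "Arr (full_subcategory K Q) = {f \<in> Arr K. Dom K f \<in> Q \<and> Cod K f \<in> Q}"
  "Dom (full_subcategory K Q) = Dom K" "Cod (full_subcategory K Q) = Cod K"
  "Id (full_subcategory K Q) = Id K" "Comp (full_subcategory K Q) = Comp K"
  "Add (full_subcategory K Q) = Add K" "Susp (full_subcategory K Q) = Susp K"
  "Tri (full_subcategory K Q) \<subseteq> Tri K"
  by (auto simp: full_subcategory_def Let_def)

text \<open>
  This makes \<open>\<pi>\<close> faithful on \<open>J_perp\<close>: the difference factors through an arrow from \<open>J_perp\<close> to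
  \<open>J\<close>, which is zero.
\<close>
lemma cong_on_J_perp:
  assumes "cong f g" "Dom K f \<in> J_perp" shows "f = g"
proof -
  note c = cong_typed[OF assms(1)]
  let ?d = "f \<oplus> Neg K g"
  have "null ?d" using assms by (simp add: cong_def)
  then obtain a b where ab: "a \<in> Arr K" "b \<in> Arr K" "Cod K a = Dom K b" "Dom K b \<in> J"
    "Dom K a = Dom K ?d"
    "Cod K b = Cod K ?d" "b \<cdot> a = ?d" by (rule nullE)
  have az: "a = Zero K (Dom K f) (Dom K b)" using J_perp_orthogonal[of a] ab(1,3,4,5) c assms(2) by simp
  have "?d = b \<cdot> Zero K (Dom K f) (Dom K b)" using ab(7) az by simp
  also have "\<dots> = Zero K (Dom K f) (Cod K f)" using ab(2,6) c by simp
  finally show ?thesis using iffD1[OF diff_eq_Zero_iff[OF c]] by blast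
qed

text \<open>
  The equivalence \<open>J_perp \<rightarrow> L\<close> is the restriction of \<open>\<pi>\<close>: it is full like \<open>\<pi>\<close>, faithful by the
  previous lemma, and essentially surjective since the complement of \<open>B X\<close> in \<open>X\<close> lies in \<open>J\<close>.
  The projections \<open>X \<rightarrow> B X\<close> become invertible in \<open>L\<close> and identify \<open>\<pi>\<close> with its restriction after
  the projection functor.
\<close>
lemma projection_onto_J_perp:
  assumes ic: "idempotent_complete K"
  shows "projection_onto_summand K L pi J J_perp"
proof -
  let ?F = "full_subcategory K J_perp"
  interpret L: category L by (rule category_L)
  have "\<forall>X \<in> Obj K. \<exists>t. case t of (A, B, i, j, p, q) \<Rightarrow> A \<in> J \<and> B \<in> J_perp \<and> biproduct K A B X i j p q"
    using decomposition[OF ic] by auto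
  from bchoice[OF this] obtain D where D: "\<forall>X \<in> Obj K.
     case D X of (A, B, i, j, p, q) \<Rightarrow> A \<in> J \<and> B \<in> J_perp \<and> biproduct K A B X i j p q" ..
  define A where "A X = fst (D X)" for X
  define B where "B X = fst (snd (D X))" for X
  define i where "i X = fst (snd (snd (D X)))" for X
  define j where "j X = fst (snd (snd (snd (D X))))" for X
  define p where "p X = fst (snd (snd (snd (snd (D X)))))" for X
  define q where "q X = snd (snd (snd (snd (snd (D X)))))" for X
  have dec: "A X \<in> J" "B X \<in> J_perp" "biproduct K (A X) (B X) X (i X) (j X) (p X) (q X)" if
    "X \<in> Obj K" for X
    using bspec[OF D that] by (auto simp: A_def B_def i_def j_def p_def q_def split: prod.splits)
  have ty: "i X \<in> Arr K" "j X \<in> Arr K" "p X \<in> Arr K" "q X \<in> Arr K"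
    "Dom K (i X) = A X" "Dom K (j X) = B X" "Dom K (p X) = X" "Dom K (q X) = X"
    "Cod K (i X) = X" "Cod K (j X) = X" "Cod K (p X) = A X" "Cod K (q X) = B X"
    "q X \<cdot> j X = Id K (B X)" "(i X \<cdot> p X) \<oplus> (j X \<cdot> q X) = Id K X" if "X \<in> Obj K" for X
    using dec(3)[OF that] by (auto simp: biproduct_def in_Hom)
  have BO: "B X \<in> Obj K" "A X \<in> Obj K" if "X \<in> Obj K" for X using dec[OF that] by auto
  define R where "R = \<lparr>FObj = B, FArr = \<lambda>f. q (Cod K f) \<cdot> (f \<cdot> j (Dom K f))\<rparr>"
  have R: "FObj R X = B X" "FArr R f = q (Cod K f) \<cdot> (f \<cdot> j (Dom K f))" for X f by (simp_all add: R_def)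
  have nat: "(q (Cod K f) \<cdot> (f \<cdot> j (Dom K f))) \<cdot> q (Dom K f) = q (Cod K f) \<cdot> f" if f: "f \<in> Arr K" for f
  proof -
    let ?X = "Dom K f" and ?Y = "Cod K f"
    have X: "?X \<in> Obj K" "?Y \<in> Obj K" using f by auto
    \<comment> \<open>The part of \<open>f\<close> on the summand in \<open>J\<close> has no component in \<open>J_perp\<close>.\<close>
    have z: "q ?Y \<cdot> (f \<cdot> i ?X) = Zero K (A ?X) (B ?Y)"
      using J_perpD[of "q ?Y \<cdot> (f \<cdot> i ?X)"] ty(1-12)[OF X(1)] ty(1-12)[OF X(2)] f dec[OF X(1)]
        dec[OF X(2)] by simp
    have z2: "(q ?Y \<cdot> (f \<cdot> i ?X)) \<cdot> p ?X = Zero K ?X (B ?Y)"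
      unfolding z using ty(1-12)[OF X(1)] ty(1-12)[OF X(2)] BO[OF X(1)] BO[OF X(2)] by simp
    have "q ?Y \<cdot> f = q ?Y \<cdot> (f \<cdot> ((i ?X \<cdot> p ?X) \<oplus> (j ?X \<cdot> q ?X)))"
      unfolding ty(14)[OF X(1)] using f by simp
    also have "\<dots> = ((q ?Y \<cdot> (f \<cdot> i ?X)) \<cdot> p ?X) \<oplus> ((q ?Y \<cdot> (f \<cdot> j ?X)) \<cdot> q ?X)"
      using f ty(1-12)[OF X(1)] ty(1-12)[OF X(2)] by (simp add: Comp_Add Comp_assoc)
    also have "\<dots> = (q ?Y \<cdot> (f \<cdot> j ?X)) \<cdot> q ?X"
      unfolding z2 using f ty(1-12)[OF X(1)] ty(1-12)[OF X(2)] X by simp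
    finally show ?thesis by simp
  qed
  have Rf: "is_functor K ?F R"
    unfolding is_functor_def full_simps R
  proof (intro conjI ballI impI)
    show "B X \<in> J_perp" if "X \<in> Obj K" for X using dec that by blast
    show "q (Cod K f) \<cdot> (f \<cdot> j (Dom K f)) \<in> Hom ?F (B (Dom K f)) (B (Cod K f))" if f: "f \<in> Arr K" for f
      using f ty(1-12)[of "Dom K f"] ty(1-12)[of "Cod K f"] dec(2) by (simp add: in_Hom full_simps)
    show "q (Cod K (Id K X)) \<cdot> (Id K X \<cdot> j (Dom K (Id K X))) = Id K (B X)" if "X \<in> Obj K" for X
      using that ty[OF that] by simp
    fix f g assume f: "f \<in> Arr K" and g: "g \<in> Arr K" and fg: "Cod K f = Dom K g"
    have X: "Dom K f \<in> Obj K" "Dom K g \<in> Obj K" "Cod K g \<in> Obj K" using f g by auto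
    note y = ty(1-12)[OF X(1)] ty(1-12)[OF X(2)] ty(1-12)[OF X(3)]
    have "q (Cod K g) \<cdot> (g \<cdot> (f \<cdot> j (Dom K f))) = (q (Cod K g) \<cdot> g) \<cdot> (f \<cdot> j (Dom K f))"
      using y f g fg by (simp add: Comp_assoc)
    also have "\<dots> = (q (Cod K g) \<cdot> (g \<cdot> j (Dom K g))) \<cdot> (q (Dom K g) \<cdot> (f \<cdot> j (Dom K f)))"
      unfolding nat[OF g, symmetric] using y f g fg by (simp add: Comp_assoc)
    finally show "q (Cod K (g \<cdot> f)) \<cdot> (g \<cdot> f \<cdot> j (Dom K (g \<cdot> f))) =
        q (Cod K g) \<cdot> (g \<cdot> j (Dom K g)) \<cdot> (q (Cod K f) \<cdot> (f \<cdot> j (Dom K f)))"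
      using y f g fg by (simp add: Comp_assoc)
  qed
  have proj: "is_projection K J J_perp R"
    unfolding is_projection_def
  proof (intro conjI Rf exI)
    show "\<forall>X\<in>Obj K. A X \<in> J \<and> biproduct K (A X) (FObj R X) X (i X) (j X) (p X) (q X)"
      using dec by (simp add: R)
    show "\<forall>f\<in>Arr K. FArr R f \<cdot> q (Dom K f) = q (Cod K f) \<cdot> f" using nat by (simp add: R)
  qed
  have isoq: "is_iso L (cls (q X))" "is_iso L (cls (j X))" if X: "X \<in> Obj K" for X
  proof -
    have "null (i X \<cdot> p X)" by (rule nullI) (use ty(1-12)[OF X] dec[OF X] in auto)
    moreover have "i X \<cdot> p X = Id K X \<oplus> Neg K (j X \<cdot> q X)"
      unfolding ty(14)[OF X, symmetric] using ty(1-12)[OF X] by (simp add: Add_assoc)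
    ultimately have "cong (Id K X) (j X \<cdot> q X)" using ty(1-12)[OF X] X by (simp add: cong_def)
    then have c: "cong (j X \<cdot> q X) (Id K X)" by (rule cong_sym)
    show "is_iso L (cls (q X))"
      using is_iso_cls_iff[OF ty(4)[OF X]] ty[OF X] c BO[OF X] by (metis cong_refl Id_simps(1))
    show "is_iso L (cls (j X))"
      using is_iso_cls_iff[OF ty(2)[OF X]] ty[OF X] c BO[OF X] by (metis cong_refl Id_simps(1))
  qed
  have Ff: "is_functor ?F L pi"
    unfolding is_functor_def full_simps by (auto simp: in_Hom Id_L)
  have Hex: "exact_functor ?F L pi"
  proof -
    have "additive_functor ?F L pi"
      unfolding additive_functor_def using Ff by (auto simp: in_Hom full_simps)
    moreover have "natural_iso ?F L (fcomp pi (Susp ?F)) (fcomp (Susp L) pi) phi"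
      unfolding natural_iso_def
      by (auto simp: full_simps fcomp_def in_Hom FObj_SL phi_natural)
    moreover have "\<forall>(f, g, h) \<in> Tri ?F. (FArr pi f, FArr pi g, phi (Dom ?F f) \<cdot>\<^bsub>L\<^esub> FArr pi h) \<in> Tri L"
      using full_simps(9)[of J_perp] phi_Tri by (auto simp: full_simps(3))
    ultimately show ?thesis unfolding exact_functor_def by blast
  qed
  have Heq: "is_equivalence ?F L pi"
    unfolding is_equivalence_def
  proof (intro conjI ballI Ff)
    fix X Y assume "X \<in> Obj ?F" "Y \<in> Obj ?F"
    then have XY: "X \<in> J_perp" "Y \<in> J_perp" by (auto simp: full_simps)
    have H: "Hom ?F X Y = Hom K X Y" using XY by (auto simp: Hom_def full_simps)
    show "bij_betw (FArr pi) (Hom ?F X Y) (Hom L (FObj pi X) (FObj pi Y))"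
      unfolding bij_betw_def H
    proof
      show "inj_on (FArr pi) (Hom K X Y)"
        by (rule inj_onI) (use XY cong_on_J_perp in \<open>simp add: in_Hom cls_eq_iff\<close>)
      show "FArr pi ` Hom K X Y = Hom L (FObj pi X) (FObj pi Y)"
      proof (intro equalityI subsetI)
        fix F assume "F \<in> FArr pi ` Hom K X Y"
        then show "F \<in> Hom L (FObj pi X) (FObj pi Y)" by (auto simp: in_Hom)
      next
        fix F assume "F \<in> Hom L (FObj pi X) (FObj pi Y)"
        then have F: "F \<in> Arr L" "Dom L F = X" "Cod L F = Y" by (auto simp: in_Hom)
        obtain f where f: "f \<in> Arr K" "F = cls f" using F(1) by (rule L_ArrE)
        then show "F \<in> FArr pi ` Hom K X Y" using F by (intro image_eqI[of _ _ f]) (auto simp: in_Hom)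
      qed
    qed
  next
    fix Z assume "Z \<in> Obj L"
    then have Z: "Z \<in> Obj K" by simp
    show "\<exists>X \<in> Obj ?F. isomorphic L (FObj pi X) Z"
      unfolding isomorphic_def full_simps
      by (rule bexI[OF _ dec(2)[OF Z]], rule bexI[of _ "cls (j Z)"]) (use ty[OF Z] isoq[OF Z] in
        \<open>simp_all add: in_Hom\<close>)
  qed
  have "is_functor K L (fcomp pi R)"
    using Rf Ff unfolding is_functor_def fcomp_def by (auto simp: full_simps in_Hom)
  moreover have "natural_iso K L pi (fcomp pi R) (\<lambda>X. cls (q X))"
    unfolding natural_iso_def fcomp_def
    using ty isoq nat by (simp add: in_Hom R)
  ultimately have "naturally_isomorphic K L pi (fcomp pi R)"
    unfolding naturally_isomorphic_def using pi_functor by blast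
  then show ?thesis
    unfolding projection_onto_summand_def exact_equivalence_def
    using orthogonal_sum_J[OF ic] proj Hex Heq by blast
qed

end

theorem lemma4p13:
  fixes K :: "('o, 'm) tri_cat"
    and E :: "'m triangle set"
    and \<tau> :: "'o \<Rightarrow> 'm triangle"
  assumes "triangulated_category K"
    and "frobenius_class K E"
    and "injective_choice K E \<tau>"
  shows "let \<pi> = stable_functor K E; L = stable_category K E \<tau> in
    (exact_functor K L \<pi> \<longleftrightarrow> localization K L \<pi>) \<and>
    (exact_functor K L \<pi> \<and> idempotent_complete K \<longrightarrow>
       (\<exists>J'. projection_onto_summand K L \<pi> (E_proj K E) J'))"
proof -
  interpret F: frobenius_stable K E \<tau>
    using assms(2,3) by (intro frobenius_stable.intro frobenius_stable_axioms.intro)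
  have ex: "exact_stable K E \<tau>" if "exact_functor K F.L F.pi"
    using F.frobenius_stable_axioms that by (intro exact_stable.intro exact_stable_axioms.intro)
  show ?thesis
    unfolding Let_def
    using F.exact_if_localization exact_stable.localization_pi[OF ex]
      exact_stable.projection_onto_J_perp[OF ex]
    by blast
qed

end
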